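(* Let $N\ge3$, $\alpha\in\mathbb{R}$, and let $\theta\in C_c^\infty(\mathbb{R}^N)$ with $0\le\theta\le1$, $\theta=1$ on $B_{1/2}$ and $\theta=0$ on $\mathbb{R}^N\setminus B_1$. Let $d\mu=\mu(x)\,dx$ with $$\mu(x)=\theta(x)\left(\log\frac{1}{|x|}\right)^{\alpha},\qquad x\in\mathbb{R}^N$$ (so $\mu=0$ outside $B_1$). Put $c_0(N):=\left(\frac{N-2}{2}\right)^2$. (1) If $\alpha\le0$, then there exists a constant $C\ge0$ such that for all $u\in H^1_\mu$ $$c_0(N)\int_{\mathbb{R}^N}\frac{u^2}{|x|^2}\,d\mu\le\int_{\mathbb{R}^N}|\nabla u|^2\,d\mu+C\int_{\mathbb{R}^N}u^2\,d\mu,$$ and $c_0(N)$ is the best constant. (2) If $\alpha>0$, then for every $0\le c<c_0(N)$ there exists a constant $C\ge0$ such that for all $u\in H^1_\mu$ $$c\int_{\mathbb{R}^N}\frac{u^2}{|x|^2}\,d\mu\le\int_{\mathbb{R}^N}|\nabla u|^2\,d\mu+C\int_{\mathbb{R}^N}u^2\,d\mu,$$ and $c_0(N)$ is the best constant.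
   Context: $B_R$ denotes the open ball of $\mathbb{R}^N$ of radius $R$ centered at $0$. $L^2_\mu:=L^2(\mathbb{R}^N,d\mu)$, and $H^1_\mu$ is the Sobolev space of functions in $L^2_\mu$ whose weak first derivatives belong to $L^2_\mu$; functions are real-valued. "Best constant" means that for every $c>c_0(N)$ there is no constant $C$ for which the inequality $c\int\frac{u^2}{|x|^2}d\mu\le\int|\nabla u|^2d\mu+C\int u^2d\mu$ holds for all $u\in H^1_\mu$. *)

theory Defs
  imports "HOL-Analysis.Analysis"
begin

fun Ck :: "nat \<Rightarrow> ('a::euclidean_space \<Rightarrow> real) \<Rightarrow> bool" where
  "Ck 0 f \<longleftrightarrow> continuous_on UNIV f"
| "Ck (Suc k) f \<longleftrightarrow>
     (\<forall>x. f differentiable (at x)) \<and>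
     (\<forall>b\<in>Basis. Ck k (\<lambda>x. frechet_derivative f (at x) b))"

definition Cc_infinity :: "('a::euclidean_space \<Rightarrow> real) set" where
  "Cc_infinity = {\<phi>. (\<forall>k. Ck k \<phi>) \<and> compact (closure {x. \<phi> x \<noteq> 0})}"

definition locally_integrable :: "('a::euclidean_space \<Rightarrow> 'b::euclidean_space) \<Rightarrow> bool" where
  "locally_integrable f \<longleftrightarrow> (\<forall>K. compact K \<longrightarrow> set_integrable lborel K f)"

text \<open>The distributional gradient on the whole space; it is determined up to Lebesgue null sets.\<close>

definition is_weak_gradient ::
  "('a::euclidean_space \<Rightarrow> real) \<Rightarrow> ('a \<Rightarrow> 'a) \<Rightarrow> bool" where
  "is_weak_gradient u g \<longleftrightarrow>
     locally_integrable u \<and> locally_integrable g \<and>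
     (\<forall>\<phi>\<in>Cc_infinity. \<forall>b\<in>Basis.
        (LINT x|lborel. u x * frechet_derivative \<phi> (at x) b) =
        - (LINT x|lborel. (g x \<bullet> b) * \<phi> x))"

text \<open>Elements of \<open>L2\<close> and \<open>H1\<close> are Borel functions, not classes modulo null sets. Weak
  derivatives are taken on the whole space, so a class modulo \<open>M\<close>-null sets lies in the Sobolev
  space if some representative of it is in \<open>H1 M\<close>; this matters where the weight vanishes. The
  integrals in the Hardy inequality depend only on the class.\<close>

definition L2 :: "'a measure \<Rightarrow> ('a \<Rightarrow> 'b::euclidean_space) set" where
  "L2 M = {f \<in> borel_measurable M. integrable M (\<lambda>x. (norm (f x))\<^sup>2)}"

definition H1 :: "'a::euclidean_space measure \<Rightarrow> ('a \<Rightarrow> real) set" where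
  "H1 M = {u \<in> L2 M. \<exists>g\<in>L2 M. is_weak_gradient u g}"

text \<open>The integrals are taken in \<open>[0, \<infinity>]\<close>, so that the left-hand side is meaningful before it is
  known to be finite. The constant \<open>c\<close> is only used with \<open>c \<ge> 0\<close>. A negative \<open>C\<close> is
  truncated to \<open>0\<close>, which weakens the inequality, so that denying the existence of \<open>C\<close> below
  covers all real \<open>C\<close>.\<close>

definition hardy_inequality :: "'a::euclidean_space measure \<Rightarrow> real \<Rightarrow> real \<Rightarrow> bool" where
  "hardy_inequality M c C \<longleftrightarrow>
     (\<forall>u\<in>H1 M. \<forall>g. is_weak_gradient u g \<longrightarrow>
        ennreal c * (\<integral>\<^sup>+x. ennreal ((u x)\<^sup>2 / (norm x)\<^sup>2) \<partial>M)
        \<le> (\<integral>\<^sup>+x. ennreal ((norm (g x))\<^sup>2) \<partial>M)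
          + ennreal C * (\<integral>\<^sup>+x. ennreal ((u x)\<^sup>2) \<partial>M))"

definition best_hardy_constant :: "'a::euclidean_space measure \<Rightarrow> real \<Rightarrow> bool" where
  "best_hardy_constant M c\<^sub>0 \<longleftrightarrow> (\<forall>c>c\<^sub>0. \<not> (\<exists>C. hardy_inequality M c C))"

text \<open>The junk values of \<open>ln\<close> and \<open>powr\<close> are harmless: for \<open>norm x \<ge> 1\<close> the cutoff \<open>\<theta>\<close>
  vanishes, and the origin is a null set.\<close>

definition log_measure :: "('a::euclidean_space \<Rightarrow> real) \<Rightarrow> real \<Rightarrow> 'a measure" where
  "log_measure \<theta> \<alpha> = density lborel (\<lambda>x. ennreal (\<theta> x * (ln (1 / norm x)) powr \<alpha>))"

definition c_zero :: "nat \<Rightarrow> real" where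
  "c_zero N = ((real N - 2) / 2)\<^sup>2"

end

theory Submission
  imports Defs
begin

text \<open>Write \<open>k = (N - 2) / 2\<close>. Expanding \<open>\<integral> |\<nabla>u + u h|\<^sup>2 d\<mu> \<ge> 0\<close> with \<open>h = k x / |x|\<^sup>2\<close> and integrating by
  parts gives \<open>\<integral> |\<nabla>u|\<^sup>2 d\<mu> \<ge> \<integral> (k\<^sup>2 - k \<alpha> / log (1 / |x|)) u\<^sup>2 / |x|\<^sup>2 d\<mu>\<close> near the origin. The logarithmic
  term has the good sign for \<open>\<alpha> \<le> 0\<close>, and for \<open>\<alpha> > 0\<close> it is absorbed by \<open>k\<^sup>2 - c > 0\<close> on a small
  ball. The integration by parts is carried out on difference quotients of \<open>u\<close>, tested against a
  weight supported in an annulus; the inner radius then tends to \<open>0\<close>. For the optimality of \<open>k\<^sup>2\<close>, take a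
  truncation of \<open>(|x|\<^sup>2 + a\<^sup>2)\<^bsup>- \<gamma> / 2\<^esup>\<close> with \<open>k < \<gamma> < sqrt c\<close>: its energy is at most about \<open>\<gamma>\<^sup>2\<close> times the
  Hardy integral, and it blows up as \<open>a\<close> tends to \<open>0\<close>.\<close>

section \<open>Test functions and weak gradients\<close>


text \<open>The field \<open>h\<close> is minus the logarithmic gradient of \<open>|x|^(-k)\<close>,
  a positive solution of \<open>- \<Delta>v = k^2 v / |x|^2\<close>. Since \<open>x / |x|^2\<close>
  has divergence \<open>(N - 2) / |x|^2\<close>, a multiple \<open>k\<close> of it yields the
  constant \<open>k (N - 2) - k^2\<close>, which is largest at \<open>k = (N - 2) / 2\<close>. The
  obstacle is regularity: an element of \<open>H1\<close> has only a distributional gradient, and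
  the weight degenerates or blows up at the origin. Neither a product rule for \<open>u^2\<close>
  nor density of smooth functions is used; finite differences take their place. They are tied to the
  weak gradient by the fundamental lemma of the calculus of variations, for which rescaled and
  translated copies of the given \<open>\<theta>\<close> are test functions enough. Away from the
  origin the logarithmic weight is bounded below, so plain Lebesgue integrability of
  \<open>u^2\<close> and \<open>|g|^2\<close> is available there. For the optimality, the energy of
  \<open>|x|^(-\<gamma>)\<close> behaves like the integral of
  \<open>r^(2 (k - \<gamma>) - 1)\<close> times a power of the logarithm. It diverges for
  \<open>\<gamma> > k\<close>, and half of the excess \<open>2 (\<gamma> - k)\<close> in the
  exponent is enough to beat the logarithm.\<close>

text \<open>The factor \<open>c\<close> makes the statement stable under differentiation: a partial
  derivative has the same form, with \<open>c * r\<close> for \<open>c\<close> and a partial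
  derivative of \<open>f\<close> for \<open>f\<close>, so the induction closes.\<close>

lemma Ck_affine:
  fixes f :: "'a::euclidean_space \<Rightarrow> real"
  assumes "Ck k f"
  shows "Ck k (\<lambda>x. c * f (a + r *\<^sub>R x))"
  using assms
proof (induction k arbitrary: f c)
  case 0
  then show ?case
    by (auto intro!: continuous_intros continuous_on_compose2[of UNIV f])
next
  case (Suc k)
  have d: "((\<lambda>x. c * f (a + r *\<^sub>R x)) has_derivative
      (\<lambda>v. c * frechet_derivative f (at (a + r *\<^sub>R x)) (r *\<^sub>R v))) (at x)" for x
  proof -
    have "(f has_derivative frechet_derivative f (at (a + r *\<^sub>R x))) (at (a + r *\<^sub>R x))"
      using Suc.prems frechet_derivative_works by auto
    then have "(f \<circ> (\<lambda>x. a + r *\<^sub>R x) has_derivative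
        frechet_derivative f (at (a + r *\<^sub>R x)) \<circ> (\<lambda>v. r *\<^sub>R v)) (at x)"
      by (intro diff_chain_at) (auto intro!: derivative_eq_intros)
    then show ?thesis
      by (auto simp: o_def intro!: derivative_intros)
  qed
  have e: "frechet_derivative (\<lambda>x. c * f (a + r *\<^sub>R x)) (at x) b =
      (c * r) * frechet_derivative f (at (a + r *\<^sub>R x)) b" for x b
  proof -
    have "linear (frechet_derivative f (at (a + r *\<^sub>R x)))"
      using Suc.prems linear_frechet_derivative by auto
    then show ?thesis
      using frechet_derivative_at[OF d[of x], symmetric] by (simp add: linear_cmul)
  qed
  have "Ck k (\<lambda>x. (c * r) * frechet_derivative f (at (a + r *\<^sub>R x)) b)" if "b \<in> Basis" for b
    using that Suc.prems by (intro Suc.IH[of "\<lambda>x. frechet_derivative f (at x) b"]) auto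
  then show ?case
    using d by (auto simp: e differentiable_def)
qed

lemma Cc_infinity_affine:
  fixes \<phi> :: "'a::euclidean_space \<Rightarrow> real"
  assumes "\<phi> \<in> Cc_infinity" "r \<noteq> 0"
  shows "(\<lambda>x. \<phi> (a + r *\<^sub>R x)) \<in> Cc_infinity"
proof -
  have "bounded {x. \<phi> x \<noteq> 0}"
    using assms by (simp add: Cc_infinity_def compact_closure)
  then have "bounded ((\<lambda>y. (1 / r) *\<^sub>R (- a + y)) ` {x. \<phi> x \<noteq> 0})"
    using bounded_translation[of _ "- a"] bounded_scaling[of "(+) (- a) ` {x. \<phi> x \<noteq> 0}" "1 / r"]
    by (simp add: image_image)
  moreover have "{x. \<phi> (a + r *\<^sub>R x) \<noteq> 0} \<subseteq> (\<lambda>y. (1 / r) *\<^sub>R (- a + y)) ` {x. \<phi> x \<noteq> 0}"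
  proof
    fix x assume x: "x \<in> {x. \<phi> (a + r *\<^sub>R x) \<noteq> 0}"
    have "x = (1 / r) *\<^sub>R (- a + (a + r *\<^sub>R x))" using assms by simp
    with x show "x \<in> (\<lambda>y. (1 / r) *\<^sub>R (- a + y)) ` {x. \<phi> x \<noteq> 0}" by blast
  qed
  ultimately have "bounded {x. \<phi> (a + r *\<^sub>R x) \<noteq> 0}"
    using bounded_subset by blast
  moreover have "Ck k (\<lambda>x. \<phi> (a + r *\<^sub>R x))" for k
    using assms Ck_affine[of k \<phi> 1 a r] by (simp add: Cc_infinity_def)
  ultimately show ?thesis
    by (simp add: Cc_infinity_def compact_closure)
qed

lemma Cc_infinity_continuous:
  assumes "\<phi> \<in> Cc_infinity"
  shows "continuous_on UNIV \<phi>"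
proof -
  have "Ck 0 \<phi>" using assms unfolding Cc_infinity_def by blast
  then show ?thesis by simp
qed

lemma Cc_infinity_has_derivative:
  assumes "\<phi> \<in> Cc_infinity"
  shows "(\<phi> has_derivative frechet_derivative \<phi> (at x)) (at x)"
proof -
  have "Ck (Suc 0) \<phi>" using assms by (auto simp: Cc_infinity_def)
  then show ?thesis using frechet_derivative_works by auto
qed

lemma Cc_infinity_continuous_derivative:
  assumes "\<phi> \<in> Cc_infinity" "b \<in> Basis"
  shows "continuous_on UNIV (\<lambda>x. frechet_derivative \<phi> (at x) b)"
proof -
  have "Ck (Suc 0) \<phi>" using assms by (auto simp: Cc_infinity_def)
  then show ?thesis using assms by auto
qed

lemma has_derivative_line:
  fixes f :: "'a::real_normed_vector \<Rightarrow> 'b::real_normed_vector"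
  assumes "(f has_derivative f') (at (x + t *\<^sub>R b))"
  shows "((\<lambda>t. f (x + t *\<^sub>R b)) has_vector_derivative f' b) (at t)"
proof -
  have "((f \<circ> (\<lambda>t. x + t *\<^sub>R b)) has_derivative f' \<circ> (\<lambda>s. s *\<^sub>R b)) (at t)"
    using assms by (intro diff_chain_at) (auto intro!: derivative_eq_intros)
  moreover have "linear f'" using assms has_derivative_linear by blast
  ultimately show ?thesis
    by (simp add: has_vector_derivative_def o_def linear_cmul)
qed

lemma Cc_infinity_line:
  assumes "\<phi> \<in> Cc_infinity"
  shows "((\<lambda>t. \<phi> (x + t *\<^sub>R b)) has_real_derivative frechet_derivative \<phi> (at (x + t *\<^sub>R b)) b) (at t)"
  using has_derivative_line[OF Cc_infinity_has_derivative[OF assms]]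
  by (simp add: has_real_derivative_iff_has_vector_derivative)

lemma Cc_infinity_support:
  fixes \<phi> :: "'a::euclidean_space \<Rightarrow> real"
  assumes "\<phi> \<in> Cc_infinity"
  obtains R where "R > 0" "\<And>x. norm x > R \<Longrightarrow> \<phi> x = 0"
    "\<And>x b. norm x > R \<Longrightarrow> frechet_derivative \<phi> (at x) b = 0"
proof -
  have "bounded {x. \<phi> x \<noteq> 0}"
    using assms by (simp add: Cc_infinity_def compact_closure)
  then obtain R where R: "R > 0" "\<And>x. \<phi> x \<noteq> 0 \<Longrightarrow> norm x \<le> R"
    by (auto simp: bounded_pos)
  have "frechet_derivative \<phi> (at x) = (\<lambda>_. 0)" if "norm x > R" for x
  proof -
    have "open {y::'a. norm y > R}" by (intro open_Collect_less continuous_intros)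
    moreover have "((\<lambda>_. 0::real) has_derivative (\<lambda>_. 0)) (at x)" by simp
    ultimately have "(\<phi> has_derivative (\<lambda>_. 0)) (at x)"
      using that R by (rule_tac has_derivative_transform_within_open[of "\<lambda>_. 0" _ x UNIV "{y. norm y > R}"]) force+
    then show ?thesis
      using frechet_derivative_at by fastforce
  qed
  then show ?thesis using that R by (metis not_le)
qed

section \<open>Translation and scaling of Lebesgue integrals, local integrability\<close>

lemma nn_integral_lborel_shift:
  fixes f :: "'a::euclidean_space \<Rightarrow> ennreal"
  assumes [measurable]: "f \<in> borel_measurable borel"
  shows "(\<integral>\<^sup>+x. f (x + a) \<partial>lborel) = (\<integral>\<^sup>+x. f x \<partial>lborel)"
proof -
  have "(\<integral>\<^sup>+x. f x \<partial>lborel) = (\<integral>\<^sup>+x. f x \<partial>distr lborel borel ((+) a))"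
    by (simp add: lborel_distr_plus)
  also have "\<dots> = (\<integral>\<^sup>+x. f (x + a) \<partial>lborel)"
    by (subst nn_integral_distr) (auto simp: add.commute)
  finally show ?thesis by simp
qed

lemma has_bochner_integral_lborel_shift:
  fixes f :: "'a::euclidean_space \<Rightarrow> 'b::euclidean_space"
  assumes "integrable lborel f"
  shows "has_bochner_integral lborel (\<lambda>x. f (x + a)) (integral\<^sup>L lborel f)"
proof -
  have [measurable]: "f \<in> borel_measurable borel" using assms by auto
  have "integrable (distr lborel borel ((+) a)) f"
    using assms by (simp add: lborel_distr_plus)
  then have "integrable lborel (\<lambda>x. f (a + x))"
    by (subst (asm) integrable_distr_eq) auto
  moreover have "integral\<^sup>L lborel f = integral\<^sup>L (distr lborel borel ((+) a)) f"
    by (simp add: lborel_distr_plus)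
  then have "integral\<^sup>L lborel f = (\<integral>x. f (a + x) \<partial>lborel)"
    by (subst (asm) integral_distr) auto
  ultimately show ?thesis by (auto simp: has_bochner_integral_iff add.commute)
qed

lemmas integrable_lborel_shift = has_bochner_integral_lborel_shift[THEN integrable.intros]
lemmas integral_lborel_shift = has_bochner_integral_lborel_shift[THEN has_bochner_integral_integral_eq]

lemma lborel_affine_integral:
  fixes f :: "'a::euclidean_space \<Rightarrow> real"
  assumes [measurable]: "f \<in> borel_measurable borel" and "r > 0"
  shows "(\<integral>x. f x \<partial>lborel) = r ^ DIM('a) * (\<integral>x. f (a + r *\<^sub>R x) \<partial>lborel)"
proof -
  have "(\<integral>x. f x \<partial>lborel) =
    (\<integral>x. f x \<partial>density (distr lborel borel (\<lambda>x. a + r *\<^sub>R x)) (\<lambda>_. ennreal (r ^ DIM('a))))"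
    using lborel_affine[of r a] \<open>r > 0\<close> by simp
  also have "\<dots> = (\<integral>x. r ^ DIM('a) * f x \<partial>distr lborel borel (\<lambda>x. a + r *\<^sub>R x))"
    using \<open>r > 0\<close> by (subst integral_density) auto
  also have "\<dots> = r ^ DIM('a) * (\<integral>x. f (a + r *\<^sub>R x) \<partial>lborel)"
    by (subst integral_distr) auto
  finally show ?thesis .
qed

lemma continuous_compact_support_bounded:
  fixes f :: "'a::euclidean_space \<Rightarrow> real"
  assumes "continuous_on UNIV f" "\<And>x. norm x > R \<Longrightarrow> f x = 0"
  obtains B where "B \<ge> 0" "\<And>x. \<bar>f x\<bar> \<le> B"
proof -
  have "compact (f ` cball 0 R)"
    using assms by (intro compact_continuous_image) (auto intro: continuous_on_subset)
  then obtain B where B: "B > 0" "\<And>y. y \<in> f ` cball 0 R \<Longrightarrow> norm y \<le> B"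
    using compact_imp_bounded bounded_pos by metis
  have "\<bar>f x\<bar> \<le> B" for x
    using B(1) B(2)[of "f x"] assms(2)[of x] by (cases "norm x > R") auto
  then show ?thesis using that[of B] B by auto
qed

text \<open>The truncations to the balls of radius \<open>n\<close> are integrable, hence
  measurable, and at each point they are eventually equal to \<open>f\<close>.\<close>

lemma locally_integrable_measurable:
  assumes "locally_integrable f"
  shows "f \<in> borel_measurable borel"
proof (rule borel_measurable_LIMSEQ_metric)
  show "(\<lambda>x. indicator (cball 0 (real n)) x *\<^sub>R f x) \<in> borel_measurable borel" for n
    using assms borel_measurable_integrable[of lborel "\<lambda>x. indicator (cball 0 (real n)) x *\<^sub>R f x"]
    by (auto simp: locally_integrable_def set_integrable_def)
  fix x
  have "eventually (\<lambda>n. indicator (cball 0 (real n)) x *\<^sub>R f x = f x) sequentially"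
    using eventually_ge_at_top[of "nat \<lceil>norm x\<rceil>"]
    by eventually_elim (auto simp: indicator_def nat_le_iff ceiling_le_iff)
  then show "(\<lambda>n. indicator (cball 0 (real n)) x *\<^sub>R f x) \<longlonglongrightarrow> f x"
    by (rule tendsto_eventually)
qed

lemma continuous_locally_integrable:
  assumes "continuous_on UNIV f"
  shows "locally_integrable f"
  unfolding locally_integrable_def set_integrable_def
  using assms borel_integrable_compact continuous_on_subset by blast

lemma locally_integrable_mult:
  fixes f \<psi> :: "'a::euclidean_space \<Rightarrow> real"
  assumes f: "locally_integrable f" and [measurable]: "\<psi> \<in> borel_measurable borel"
    and B: "\<And>x. \<bar>\<psi> x\<bar> \<le> B" and R: "\<And>x. norm x > R \<Longrightarrow> \<psi> x = 0"
  shows "integrable lborel (\<lambda>x. f x * \<psi> x)"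
proof (rule Bochner_Integration.integrable_bound)
  have [measurable]: "f \<in> borel_measurable borel" using f by (rule locally_integrable_measurable)
  show "integrable lborel (\<lambda>x. B * (indicator (cball 0 R) x *\<^sub>R f x))"
    using f by (auto simp: locally_integrable_def set_integrable_def)
  show "(\<lambda>x. f x * \<psi> x) \<in> borel_measurable lborel" by measurable
  have "\<bar>f x * \<psi> x\<bar> \<le> \<bar>B * (indicator (cball 0 R) x *\<^sub>R f x)\<bar>" for x
    using B[of x] R[of x] mult_left_mono[OF B, of "\<bar>f x\<bar>" x]
    by (cases "norm x > R") (auto simp: abs_mult mult.commute)
  then show "AE x in lborel. norm (f x * \<psi> x) \<le> norm (B * (indicator (cball 0 R) x *\<^sub>R f x))"
    by simp
qed

lemma locally_integrable_inner:
  fixes g :: "'a::euclidean_space \<Rightarrow> 'b::euclidean_space"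
  assumes "locally_integrable g"
  shows "locally_integrable (\<lambda>x. g x \<bullet> b)"
  unfolding locally_integrable_def set_integrable_def
proof safe
  fix K :: "'a set" assume "compact K"
  then have "integrable lborel (\<lambda>x. (indicator K x *\<^sub>R g x) \<bullet> b)"
    using assms by (intro integrable_inner_left) (auto simp: locally_integrable_def set_integrable_def)
  then show "integrable lborel (\<lambda>x. indicator K x *\<^sub>R (g x \<bullet> b))" by simp
qed


section \<open>Convolutions and the fundamental lemma of the calculus of variations\<close>

text \<open>The map \<open>T\<close> lets one lemma serve two convolutions: \<open>T y = r y\<close>
  on the whole space is mollification, \<open>T t = t b\<close> on the real line is averaging along
  a segment. The two equations have the same right-hand side, so together they move the shift
  between \<open>f\<close> and \<open>\<psi>\<close>.\<close>

lemma convolution_fubini: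
  fixes f \<psi> :: "'a::euclidean_space \<Rightarrow> real" and \<kappa> :: "'b::euclidean_space \<Rightarrow> real"
    and T :: "'b \<Rightarrow> 'a"
  assumes f: "locally_integrable f"
    and \<psi>: "\<psi> \<in> borel_measurable borel" "\<And>x. \<bar>\<psi> x\<bar> \<le> B" "\<And>x. norm x > R \<Longrightarrow> \<psi> x = 0"
    and \<kappa>: "integrable lborel \<kappa>" "\<And>y. norm y > S \<Longrightarrow> \<kappa> y = 0"
    and T: "continuous_on UNIV T" "\<And>y. norm y \<le> S \<Longrightarrow> norm (T y) \<le> S'"
  shows "integrable (lborel \<Otimes>\<^sub>M lborel) (\<lambda>(x, y). f (x + T y) * \<psi> x * \<kappa> y)"
    and "(\<integral>x. f x * (\<integral>y. \<psi> (x - T y) * \<kappa> y \<partial>lborel) \<partial>lborel)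
      = (\<integral>y. (\<integral>x. f x * \<psi> (x - T y) \<partial>lborel) * \<kappa> y \<partial>lborel)"
    and "(\<integral>x. (\<integral>y. f (x + T y) * \<kappa> y \<partial>lborel) * \<psi> x \<partial>lborel)
      = (\<integral>y. (\<integral>x. f x * \<psi> (x - T y) \<partial>lborel) * \<kappa> y \<partial>lborel)"
proof -
  have [measurable]: "f \<in> borel_measurable borel" "\<psi> \<in> borel_measurable borel"
      "\<kappa> \<in> borel_measurable borel" "T \<in> borel_measurable borel"
    using f \<psi> \<kappa> T by (auto intro: locally_integrable_measurable borel_measurable_continuous_onI)
  have B0: "0 \<le> B" using \<psi>(2)[of 0] by linarith
  \<comment> \<open>The integrand vanishes unless \<open>norm y \<le> S\<close> and
    \<open>norm (x - T y) \<le> R\<close>, which forces \<open>norm x \<le> R + S'\<close>. So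
    \<open>f\<close> may be replaced by its integrable truncation \<open>D\<close> in all
    bounds.\<close>
  define D where "D = (\<lambda>x. indicator (cball 0 (R + S')) x *\<^sub>R f x)"
  have D: "integrable lborel D"
    using f by (auto simp: D_def locally_integrable_def set_integrable_def)
  have bnd: "\<bar>f x * \<psi> (x - T y) * \<kappa> y\<bar> \<le> B * \<bar>D x\<bar> * \<bar>\<kappa> y\<bar>" for x y
  proof (cases "norm y > S \<or> norm (x - T y) > R")
    case False
    then have "norm x \<le> R + S'"
      using T(2)[of y] norm_triangle_ineq[of "x - T y" "T y"] by auto
    then have "D x = f x" by (simp add: D_def)
    then show ?thesis
      using mult_right_mono[OF mult_left_mono[OF \<psi>(2)[of "x - T y"], of "\<bar>f x\<bar>"], of "\<bar>\<kappa> y\<bar>"]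
      by (simp add: abs_mult mult_ac)
  qed (use \<psi> \<kappa> B0 in auto)
  have shift: "integrable lborel (\<lambda>x. f x * \<psi> (x - T y))"
    if "norm y \<le> S" for y
  proof (rule locally_integrable_mult[OF f, where R="R + S'"])
    show "\<bar>\<psi> (x - T y)\<bar> \<le> B" for x using \<psi> by auto
    show "\<psi> (x - T y) = 0" if "norm x > R + S'" for x
      using that T(2)[OF \<open>norm y \<le> S\<close>] norm_triangle_ineq[of "x - T y" "T y"] \<psi>(3)[of "x - T y"]
      by auto
  qed measurable
  have shift': "integrable lborel (\<lambda>x. f x * \<psi> (x - T y) * \<kappa> y)" for y
    using shift[of y] \<kappa>(2)[of y] by (cases "norm y \<le> S") auto
  have moved: "(\<integral>x. f (x + T y) * \<psi> x \<partial>lborel) * \<kappa> y = (\<integral>x. f x * \<psi> (x - T y) \<partial>lborel) * \<kappa> y" for y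
    using integral_lborel_shift[OF shift, of y "T y"] \<kappa>(2)[of y] by (cases "norm y \<le> S") auto
  have *: "integrable (lborel \<Otimes>\<^sub>M lborel) (\<lambda>(y, x). f x * \<psi> (x - T y) * \<kappa> y)"
  proof (rule lborel_pair.Fubini_integrable)
    show "AE y in lborel. integrable lborel (\<lambda>x. case (y, x) of (y, x) \<Rightarrow> f x * \<psi> (x - T y) * \<kappa> y)"
      using shift' by simp
    show "integrable lborel (\<lambda>y. \<integral>x. norm (case (y, x) of (y, x) \<Rightarrow> f x * \<psi> (x - T y) * \<kappa> y) \<partial>lborel)"
    proof (rule Bochner_Integration.integrable_bound)
      show "integrable lborel (\<lambda>y. B * (\<integral>x. \<bar>D x\<bar> \<partial>lborel) * \<bar>\<kappa> y\<bar>)" using \<kappa> by simp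
      have "(\<integral>x. \<bar>f x * \<psi> (x - T y) * \<kappa> y\<bar> \<partial>lborel) \<le> (\<integral>x. B * \<bar>D x\<bar> * \<bar>\<kappa> y\<bar> \<partial>lborel)" for y
        using bnd shift' D by (intro integral_mono) auto
      then show "AE y in lborel. norm (\<integral>x. norm (case (y, x) of (y, x) \<Rightarrow> f x * \<psi> (x - T y) * \<kappa> y) \<partial>lborel)
          \<le> norm (B * (\<integral>x. \<bar>D x\<bar> \<partial>lborel) * \<bar>\<kappa> y\<bar>)"
        using B0 by (auto simp: abs_mult)
    qed measurable
  qed measurable
  \<comment> \<open>Translating the inner integral by \<open>T y\<close> reduces absolute
    integrability to that of the first form.\<close>
  have **: "integrable (lborel \<Otimes>\<^sub>M lborel) (\<lambda>(y, x). f (x + T y) * \<psi> x * \<kappa> y)"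
  proof (rule lborel_pair.Fubini_integrable)
    have "integrable lborel (\<lambda>x. f (x + T y) * \<psi> x * \<kappa> y)" for y
      using integrable_lborel_shift[OF shift'[of y], of "T y"] by simp
    then show "AE y in lborel. integrable lborel (\<lambda>x. case (y, x) of (y, x) \<Rightarrow> f (x + T y) * \<psi> x * \<kappa> y)"
      by simp
    have "(\<integral>x. \<bar>f (x + T y) * \<psi> x * \<kappa> y\<bar> \<partial>lborel) = (\<integral>x. \<bar>f x * \<psi> (x - T y) * \<kappa> y\<bar> \<partial>lborel)" for y
      using integral_lborel_shift[OF integrable_norm[OF shift'[of y]], of "T y"] by simp
    moreover have "integrable lborel (\<lambda>y. \<integral>x. \<bar>f x * \<psi> (x - T y) * \<kappa> y\<bar> \<partial>lborel)"
      using lborel_pair.integrable_fst'[OF integrable_norm[OF *]] by simp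
    ultimately show "integrable lborel (\<lambda>y. \<integral>x. norm (case (y, x) of (y, x) \<Rightarrow> f (x + T y) * \<psi> x * \<kappa> y) \<partial>lborel)"
      by simp
  qed measurable
  show ***: "integrable (lborel \<Otimes>\<^sub>M lborel) (\<lambda>(x, y). f (x + T y) * \<psi> x * \<kappa> y)"
    using lborel_pair.integrable_product_swap[OF **] by simp
  have "(\<integral>x. (\<integral>y. f x * \<psi> (x - T y) * \<kappa> y \<partial>lborel) \<partial>lborel) = (\<integral>y. (\<integral>x. f x * \<psi> (x - T y) * \<kappa> y \<partial>lborel) \<partial>lborel)"
    by (rule lborel_pair.Fubini_integral[OF *])
  moreover have "(\<integral>y. f x * \<psi> (x - T y) * \<kappa> y \<partial>lborel) = f x * (\<integral>y. \<psi> (x - T y) * \<kappa> y \<partial>lborel)" for x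
    by (simp add: mult.assoc)
  ultimately show "(\<integral>x. f x * (\<integral>y. \<psi> (x - T y) * \<kappa> y \<partial>lborel) \<partial>lborel)
      = (\<integral>y. (\<integral>x. f x * \<psi> (x - T y) \<partial>lborel) * \<kappa> y \<partial>lborel)"
    by simp
  have "(\<integral>x. (\<integral>y. f (x + T y) * \<psi> x * \<kappa> y \<partial>lborel) \<partial>lborel) = (\<integral>y. (\<integral>x. f (x + T y) * \<psi> x * \<kappa> y \<partial>lborel) \<partial>lborel)"
    by (rule lborel_pair.Fubini_integral[OF **])
  moreover have "(\<integral>y. f (x + T y) * \<psi> x * \<kappa> y \<partial>lborel) = (\<integral>y. f (x + T y) * \<kappa> y \<partial>lborel) * \<psi> x" for x
    by (simp add: mult_ac flip: integral_mult_right_zero)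
  ultimately show "(\<integral>x. (\<integral>y. f (x + T y) * \<kappa> y \<partial>lborel) * \<psi> x \<partial>lborel)
      = (\<integral>y. (\<integral>x. f x * \<psi> (x - T y) \<partial>lborel) * \<kappa> y \<partial>lborel)"
    by (simp add: moved)
qed

text \<open>The bump function \<open>\<theta>\<close> is the mollifier: \<open>\<psi>\<close> is approximated uniformly by its convolutions with
  rescaled copies of \<open>\<theta>\<close>, and Fubini turns these into test functions against \<open>f\<close>.\<close>

lemma integral_Lipschitz_eq_0:
  fixes f \<psi> \<theta> :: "'a::euclidean_space \<Rightarrow> real"
  assumes f: "locally_integrable f"
    and zero: "\<And>\<phi>. \<phi> \<in> Cc_infinity \<Longrightarrow> (\<integral>x. f x * \<phi> x \<partial>lborel) = 0"
    and \<theta>: "\<theta> \<in> Cc_infinity" "\<And>x. 0 \<le> \<theta> x" "(\<integral>x. \<theta> x \<partial>lborel) > 0"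
    and \<psi>: "L-lipschitz_on UNIV \<psi>" "\<And>x. norm x > R \<Longrightarrow> \<psi> x = 0"
  shows "(\<integral>x. f x * \<psi> x \<partial>lborel) = 0"
proof -
  define \<Theta> where "\<Theta> = (\<integral>x. \<theta> x \<partial>lborel)"
  obtain S where S: "S > 0" "\<And>x. norm x > S \<Longrightarrow> \<theta> x = 0"
    using Cc_infinity_support[OF \<theta>(1)] by metis
  have c\<theta>: "continuous_on UNIV \<theta>" using \<theta>(1) by (rule Cc_infinity_continuous)
  have c\<psi>: "continuous_on UNIV \<psi>" using \<psi>(1) by (rule lipschitz_on_continuous_on)
  have [measurable]: "\<theta> \<in> borel_measurable borel" "\<psi> \<in> borel_measurable borel" "f \<in> borel_measurable borel"
    using c\<theta> c\<psi> f by (auto intro: borel_measurable_continuous_onI locally_integrable_measurable)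
  obtain B where B: "B \<ge> 0" "\<And>x. \<bar>\<psi> x\<bar> \<le> B"
    using continuous_compact_support_bounded[OF c\<psi> \<psi>(2)] by metis
  obtain B' where B': "B' \<ge> 0" "\<And>x. \<bar>\<theta> x\<bar> \<le> B'"
    using continuous_compact_support_bounded[OF c\<theta> S(2)] by metis
  have "integrable lborel (\<lambda>x. 1 * \<theta> x)"
    using S B' by (intro locally_integrable_mult continuous_locally_integrable) auto
  then have i\<theta>: "integrable lborel \<theta>" by simp
  have L0: "L \<ge> 0" using \<psi>(1) by (rule lipschitz_on_nonneg)
  define D where "D = (\<lambda>x. indicator (cball 0 (R + S)) x *\<^sub>R f x)"
  have D: "integrable lborel D"
    using f by (auto simp: D_def locally_integrable_def set_integrable_def)
  \<comment> \<open>The condition \<open>r \<le> 1\<close> keeps all shifts \<open>r y\<close>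
    within radius \<open>S\<close>, so the constant in front of \<open>r\<close> does not depend on
    \<open>r\<close>.\<close>
  have bound: "\<bar>\<Theta> * (\<integral>x. f x * \<psi> x \<partial>lborel)\<bar> \<le> (L * S * \<Theta> * (\<integral>x. \<bar>D x\<bar> \<partial>lborel)) * r"
    if r: "0 < r" "r \<le> 1" for r
  proof -
    let ?T = "\<lambda>y::'a. r *\<^sub>R y"
    define \<psi>r where "\<psi>r = (\<lambda>x. \<integral>y. \<psi> (x - r *\<^sub>R y) * \<theta> y \<partial>lborel)"
    have T: "continuous_on UNIV ?T" "\<And>y. norm y \<le> S \<Longrightarrow> norm (?T y) \<le> S"
      using r by (auto intro!: continuous_intros order_trans[OF mult_left_le_one_le])
    note fub = convolution_fubini[OF f \<open>\<psi> \<in> borel_measurable borel\<close> B(2) \<psi>(2) i\<theta> S(2) T]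
    \<comment> \<open>With \<open>z = x + r y\<close> this is an integral of \<open>f\<close>
      against \<open>\<theta> ((z - x) / r)\<close>, which is again a test function.\<close>
    have int0: "(\<integral>y. f (x + r *\<^sub>R y) * \<theta> y \<partial>lborel) = 0" for x
    proof -
      let ?\<phi> = "\<lambda>z. \<theta> ((- (1 / r)) *\<^sub>R x + (1 / r) *\<^sub>R z)"
      have "(\<integral>z. f z * ?\<phi> z \<partial>lborel) = r ^ DIM('a) * (\<integral>y. f (x + r *\<^sub>R y) * ?\<phi> (x + r *\<^sub>R y) \<partial>lborel)"
        using r by (intro lborel_affine_integral) auto
      moreover have "?\<phi> (x + r *\<^sub>R y) = \<theta> y" for y
        using r by (simp add: algebra_simps)
      moreover have "(\<integral>z. f z * ?\<phi> z \<partial>lborel) = 0"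
        using r by (intro zero Cc_infinity_affine \<theta>) auto
      ultimately show ?thesis using r by simp
    qed
    have z: "(\<integral>x. f x * \<psi>r x \<partial>lborel) = 0"
      using fub(2,3) int0 unfolding \<psi>r_def by simp
    have int1: "integrable lborel (\<lambda>y. \<psi> (x - r *\<^sub>R y) * \<theta> y)" for x
    proof (rule Bochner_Integration.integrable_bound[OF integrable_mult_right[OF i\<theta>, of B]])
      show "AE y in lborel. norm (\<psi> (x - r *\<^sub>R y) * \<theta> y) \<le> norm (B * \<theta> y)"
        using B \<theta>(2) by (auto simp: abs_mult intro!: mult_right_mono)
    qed measurable
    have close: "\<bar>\<psi>r x - \<Theta> * \<psi> x\<bar> \<le> L * S * r * \<Theta>" for x
    proof -
      have "\<psi>r x - \<Theta> * \<psi> x = (\<integral>y. (\<psi> (x - r *\<^sub>R y) - \<psi> x) * \<theta> y \<partial>lborel)"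
        using int1[of x] i\<theta> by (simp add: \<psi>r_def \<Theta>_def left_diff_distrib)
      also have "\<bar>\<dots>\<bar> \<le> (\<integral>y. L * S * r * \<theta> y \<partial>lborel)"
      proof (rule integral_abs_bound_integral)
        show "integrable lborel (\<lambda>y. (\<psi> (x - r *\<^sub>R y) - \<psi> x) * \<theta> y)"
          using int1 i\<theta> by (simp add: left_diff_distrib)
        show "integrable lborel (\<lambda>y. L * S * r * \<theta> y)" using i\<theta> by simp
        fix y
        show "\<bar>(\<psi> (x - r *\<^sub>R y) - \<psi> x) * \<theta> y\<bar> \<le> L * S * r * \<theta> y"
        proof (cases "norm y > S")
          case False
          have "\<bar>\<psi> (x - r *\<^sub>R y) - \<psi> x\<bar> \<le> L * (r * norm y)"
            using lipschitz_onD[OF \<psi>(1), of "x - r *\<^sub>R y" x] r by (simp add: dist_norm)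
          also have "\<dots> \<le> L * (r * S)" using L0 r False by (intro mult_left_mono) auto
          finally have "\<bar>\<psi> (x - r *\<^sub>R y) - \<psi> x\<bar> * \<theta> y \<le> L * (r * S) * \<theta> y"
            using \<theta>(2) by (intro mult_right_mono) auto
          then show ?thesis using \<theta>(2)[of y] by (simp add: abs_mult mult_ac)
        qed (use S in auto)
      qed
      also have "\<dots> = L * S * r * \<Theta>" by (simp add: \<Theta>_def)
      finally show ?thesis .
    qed
    have supp: "\<psi>r x = 0 \<and> \<psi> x = 0" if "norm x > R + S" for x
    proof -
      have "\<psi> (x - r *\<^sub>R y) * \<theta> y = 0" for y
        using that S(2)[of y] \<psi>(2)[of "x - r *\<^sub>R y"] T(2)[of y] norm_triangle_ineq[of "x - r *\<^sub>R y" "r *\<^sub>R y"]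
        by (cases "norm y > S") auto
      then have "(\<lambda>y. \<psi> (x - r *\<^sub>R y) * \<theta> y) = (\<lambda>_. 0)" by blast
      then show ?thesis using that S \<psi>(2)[of x] by (simp add: \<psi>r_def del: mult_eq_0_iff)
    qed
    have m: "\<psi>r \<in> borel_measurable borel" unfolding \<psi>r_def by measurable
    have i\<psi>: "integrable lborel (\<lambda>x. f x * \<psi> x)"
      by (rule locally_integrable_mult[OF f _ B(2) \<psi>(2)]) auto
    have i\<psi>r: "integrable lborel (\<lambda>x. f x * \<psi>r x)"
    proof (rule locally_integrable_mult[OF f m])
      show "\<bar>\<psi>r x\<bar> \<le> L * S * r * \<Theta> + \<Theta> * B" for x
      proof -
        have "\<bar>\<Theta> * \<psi> x\<bar> \<le> \<Theta> * B"
          using B(2)[of x] \<theta>(3) by (simp add: \<Theta>_def abs_mult)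
        then show ?thesis using close[of x] by linarith
      qed
    qed (use supp in auto)
    have "\<bar>\<Theta> * (\<integral>x. f x * \<psi> x \<partial>lborel)\<bar> = \<bar>\<integral>x. f x * (\<psi>r x - \<Theta> * \<psi> x) \<partial>lborel\<bar>"
      using z i\<psi> i\<psi>r by (simp add: right_diff_distrib mult.left_commute)
    also have "\<dots> \<le> (\<integral>x. L * S * r * \<Theta> * \<bar>D x\<bar> \<partial>lborel)"
    proof (rule integral_abs_bound_integral)
      show "integrable lborel (\<lambda>x. f x * (\<psi>r x - \<Theta> * \<psi> x))"
        using i\<psi> i\<psi>r by (simp add: right_diff_distrib mult.left_commute)
      show "integrable lborel (\<lambda>x. L * S * r * \<Theta> * \<bar>D x\<bar>)" using D by simp
      show "\<bar>f x * (\<psi>r x - \<Theta> * \<psi> x)\<bar> \<le> L * S * r * \<Theta> * \<bar>D x\<bar>" for x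
        using supp[of x] mult_left_mono[OF close[of x], of "\<bar>f x\<bar>"]
        by (cases "norm x > R + S") (auto simp: D_def abs_mult mult_ac)
    qed
    also have "\<dots> = (L * S * \<Theta> * (\<integral>x. \<bar>D x\<bar> \<partial>lborel)) * r" by simp
    finally show ?thesis .
  qed
  define C where "C = L * S * \<Theta> * (\<integral>x. \<bar>D x\<bar> \<partial>lborel)"
  have "\<bar>\<Theta> * (\<integral>x. f x * \<psi> x \<partial>lborel)\<bar> \<le> 0"
  proof (rule tendsto_lowerbound)
    show "((\<lambda>r. C * r) \<longlongrightarrow> 0) (at_right 0)" by (auto intro!: tendsto_eq_intros)
    show "\<forall>\<^sub>F r in at_right 0. \<bar>\<Theta> * (\<integral>x. f x * \<psi> x \<partial>lborel)\<bar> \<le> C * r"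
      using eventually_at_right_real[of 0 1]
      by (rule eventually_mono) (use bound C_def in auto)
  qed simp
  then show ?thesis using \<theta>(3) by (simp add: \<Theta>_def)
qed


text \<open>The open sets are stable under intersection and generate the Borel sets, so by the
  pi-lambda theorem the integrals vanish over every Borel set, and a density is determined almost
  everywhere by these integrals.\<close>

lemma AE_eq_0_if_integral_open_eq_0:
  fixes f :: "'a::euclidean_space \<Rightarrow> real"
  assumes f: "integrable lborel f"
    and zero: "\<And>U. open U \<Longrightarrow> (LINT x:U|lborel. f x) = 0"
  shows "AE x in lborel. f x = 0"
proof -
  have "(LINT x:A|lborel. f x) = 0" if "A \<in> sets borel" for A
  proof -
    have "Int_stable {S::'a set. open S}" by (auto simp: Int_stable_def)
    moreover have "{S::'a set. open S} \<subseteq> Pow UNIV" by simp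
    moreover have "A \<in> sigma_sets UNIV {S. open S}" using that by (simp add: borel_def)
    ultimately show ?thesis
    proof (induction rule: sigma_sets_induct_disjoint)
      case (compl A)
      have A: "A \<in> sets borel" using compl(1) by (simp add: borel_def)
      have "(LINT x:UNIV - A|lborel. f x) = (\<integral>x. f x - indicator A x *\<^sub>R f x \<partial>lborel)"
        unfolding set_lebesgue_integral_def by (intro Bochner_Integration.integral_cong) (auto simp: indicator_def)
      also have "\<dots> = (\<integral>x. f x \<partial>lborel) - (LINT x:A|lborel. f x)"
        unfolding set_lebesgue_integral_def using f A
        by (intro Bochner_Integration.integral_diff integrable_mult_indicator) auto
      also have "\<dots> = 0" using compl zero[of UNIV] by (simp add: set_lebesgue_integral_def)
      finally show ?case .
    next
      case (union A)
      have A: "A i \<in> sets borel" for i using union(2) by (auto simp: borel_def)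
      have "(LINT x:(\<Union>i. A i)|lborel. f x) = (\<Sum>i. LINT x:A i|lborel. f x)"
      proof (rule lebesgue_integral_countable_add)
        show "set_integrable lborel (\<Union>i. A i) f"
          unfolding set_integrable_def using f A by (intro integrable_mult_indicator) auto
      qed (use A union(1) in \<open>auto simp: disjoint_family_on_def\<close>)
      then show ?case using union by simp
    qed (use zero in auto)
  qed
  then show ?thesis
    using density_unique_real[OF f, of "\<lambda>_. 0"] by (simp add: set_lebesgue_integral_def)
qed

text \<open>The indicator of a bounded open set \<open>V\<close> is the pointwise limit of the
  Lipschitz functions \<open>min 1 (k * infdist x (- V))\<close>, and these are already known to
  integrate to zero against \<open>f\<close>. Intersecting with balls provides bounded supports and
  an integrable majorant.\<close>

lemma fundamental_lemma_calculus_of_variations: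
  fixes f \<theta> :: "'a::euclidean_space \<Rightarrow> real"
  assumes f: "locally_integrable f"
    and zero: "\<And>\<phi>. \<phi> \<in> Cc_infinity \<Longrightarrow> (\<integral>x. f x * \<phi> x \<partial>lborel) = 0"
    and \<theta>: "\<theta> \<in> Cc_infinity" "\<And>x. 0 \<le> \<theta> x" "(\<integral>x. \<theta> x \<partial>lborel) > 0"
  shows "AE x in lborel. f x = 0"
proof -
  have [measurable]: "f \<in> borel_measurable borel" using f by (rule locally_integrable_measurable)
  have "AE x in lborel. indicator (ball 0 (real n)) x *\<^sub>R f x = 0" for n
  proof (rule AE_eq_0_if_integral_open_eq_0)
    have "integrable lborel (\<lambda>x. indicator (cball 0 (real n)) x *\<^sub>R f x)"
      using f by (auto simp: locally_integrable_def set_integrable_def)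
    from integrable_mult_indicator[OF _ this, of "ball 0 (real n)"]
    have "integrable lborel (\<lambda>x. indicator (ball 0 (real n)) x *\<^sub>R (indicator (cball 0 (real n)) x *\<^sub>R f x))"
      by simp
    moreover have "indicator (ball 0 (real n)) x *\<^sub>R (indicator (cball 0 (real n)) x *\<^sub>R f x)
       = indicator (ball 0 (real n)) x *\<^sub>R f x" for x
      by (auto simp: indicator_def)
    ultimately show "integrable lborel (\<lambda>x. indicator (ball 0 (real n)) x *\<^sub>R f x)"
      by (simp only:)
    fix U :: "'a set" assume U: "open U"
    define V where "V = U \<inter> ball 0 (real n)"
    \<comment> \<open>A nonempty complement is essential: \<open>infdist\<close> to the empty set is
      \<open>0\<close> by default, and the functions \<open>\<psi> k\<close> would then vanish
      identically.\<close>
    have V: "open V" "V \<noteq> UNIV"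
      using U bounded_subset[OF bounded_ball, of V 0 "real n"] not_bounded_UNIV
      by (auto simp: V_def)
    define \<psi> where "\<psi> = (\<lambda>k::nat. \<lambda>x. min 1 (real k * infdist x (- V)))"
    have supp: "\<psi> k x = 0" if "norm x > real n" for k x
    proof -
      have "x \<in> - V" using that by (auto simp: V_def)
      then show ?thesis by (simp add: \<psi>_def)
    qed
    have lip: "(real k)-lipschitz_on UNIV (\<psi> k)" for k
    proof (rule lipschitz_onI)
      fix x y :: 'a
      have "\<bar>infdist x (- V) - infdist y (- V)\<bar> \<le> dist x y"
        using infdist_triangle_abs[of x "- V" y] by simp
      then have "real k * \<bar>infdist x (- V) - infdist y (- V)\<bar> \<le> real k * dist x y"
        by (intro mult_left_mono) auto
      then have "\<bar>real k * infdist x (- V) - real k * infdist y (- V)\<bar> \<le> real k * dist x y"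
        by (simp add: abs_mult flip: right_diff_distrib)
      then show "dist (\<psi> k x) (\<psi> k y) \<le> real k * dist x y"
        by (auto simp: \<psi>_def dist_real_def min_def)
    qed simp
    have [measurable]: "\<psi> k \<in> borel_measurable borel" for k
      using lipschitz_on_continuous_on[OF lip] by (rule borel_measurable_continuous_onI)
    have b: "0 \<le> \<psi> k x" "\<psi> k x \<le> 1" for k x by (auto simp: \<psi>_def infdist_nonneg)
    have "(\<lambda>k. \<integral>x. f x * \<psi> k x \<partial>lborel) \<longlonglongrightarrow> (\<integral>x. indicator V x *\<^sub>R f x \<partial>lborel)"
    proof (rule integral_dominated_convergence[where w="\<lambda>x. norm (indicator (cball 0 (real n)) x *\<^sub>R f x)"])
      show "integrable lborel (\<lambda>x. norm (indicator (cball 0 (real n)) x *\<^sub>R f x))"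
        using f by (intro integrable_norm) (auto simp: locally_integrable_def set_integrable_def)
      show "AE x in lborel. (\<lambda>k. f x * \<psi> k x) \<longlonglongrightarrow> indicator V x *\<^sub>R f x"
      proof (rule AE_I2)
        fix x
        show "(\<lambda>k. f x * \<psi> k x) \<longlonglongrightarrow> indicator V x *\<^sub>R f x"
        proof (cases "x \<in> V")
          case True
          have "closed (- V)" "- V \<noteq> {}" using V by auto
          then have d: "infdist x (- V) > 0"
            using True in_closed_iff_infdist_zero[of "- V" x] infdist_nonneg[of x "- V"]
            by (metis ComplD less_eq_real_def)
          have "eventually (\<lambda>k. f x * \<psi> k x = f x) sequentially"
            using eventually_ge_at_top[of "nat \<lceil>1 / infdist x (- V)\<rceil>"]
          proof eventually_elim
            case (elim k)
            then have "1 / infdist x (- V) \<le> real k" by linarith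
            then show ?case using d by (simp add: \<psi>_def field_simps)
          qed
          then show ?thesis using True by (simp add: tendsto_eventually)
        next
          case False
          then show ?thesis by (simp add: \<psi>_def)
        qed
      qed
      show "AE x in lborel. norm (f x * \<psi> k x) \<le> norm (indicator (cball 0 (real n)) x *\<^sub>R f x)" for k
        using b[of k] supp by (auto simp: abs_mult mult_left_le indicator_def abs_of_nonneg)
    qed (use V(1) in auto)
    moreover have "(\<integral>x. f x * \<psi> k x \<partial>lborel) = 0" for k
      by (rule integral_Lipschitz_eq_0[OF f zero \<theta> lip supp])
    ultimately have "(\<integral>x. indicator V x *\<^sub>R f x \<partial>lborel) = 0"
      using LIMSEQ_unique[of "\<lambda>_. 0::real"] by simp
    then show "(LINT x:U|lborel. indicator (ball 0 (real n)) x *\<^sub>R f x) = 0"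
      by (simp add: set_lebesgue_integral_def V_def indicator_inter_arith mult.assoc)
  qed
  then have "AE x in lborel. \<forall>n. indicator (ball 0 (real n)) x *\<^sub>R f x = 0"
    unfolding AE_all_countable by blast
  then show ?thesis
  proof eventually_elim
    case (elim x)
    obtain n where "norm x < real n" using reals_Archimedean2 by blast
    then show ?case using elim[rule_format, of n] by simp
  qed
qed

section \<open>The fundamental theorem of calculus for weak gradients\<close>

text \<open>Both sides are compared after pairing with a test function. There the difference falls
  on the test function, for which the classical fundamental theorem holds, and Fubini carries the
  segment average back to \<open>g\<close>. The exceptional null set may depend on \<open>h\<close>,
  which is harmless since \<open>h\<close> is fixed in each use.\<close>

lemma weak_gradient_difference:
  fixes u \<theta> :: "'a::euclidean_space \<Rightarrow> real"
  assumes ug: "is_weak_gradient u g" and b: "b \<in> Basis" and h: "h \<ge> 0"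
    and \<theta>: "\<theta> \<in> Cc_infinity" "\<And>x. 0 \<le> \<theta> x" "(\<integral>x. \<theta> x \<partial>lborel) > 0"
  shows "AE x in lborel. u (x + h *\<^sub>R b) - u x = (\<integral>t. (g (x + t *\<^sub>R b) \<bullet> b) * indicator {0..h} t \<partial>lborel)"
proof -
  define G where "G = (\<lambda>x. g x \<bullet> b)"
  have u: "locally_integrable u" and G: "locally_integrable G"
    using ug by (auto simp: is_weak_gradient_def G_def locally_integrable_inner)
  have [measurable]: "u \<in> borel_measurable borel" "G \<in> borel_measurable borel"
    using u G by (auto intro: locally_integrable_measurable)
  let ?\<kappa> = "indicator {0..h} :: real \<Rightarrow> real"
  define I where "I = (\<lambda>x. \<integral>t. G (x + t *\<^sub>R b) * ?\<kappa> t \<partial>lborel)"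
  have [measurable]: "I \<in> borel_measurable borel" unfolding I_def by measurable
  have \<kappa>: "integrable lborel ?\<kappa>" "\<And>t. norm t > h \<Longrightarrow> ?\<kappa> t = 0"
    using h by (auto simp: indicator_def intro!: integrable_real_indicator)
  have T: "continuous_on UNIV (\<lambda>t. t *\<^sub>R b)" "\<And>t. norm t \<le> h \<Longrightarrow> norm (t *\<^sub>R b) \<le> h"
    using b by (auto intro!: continuous_intros)
  have Iint: "integrable lborel (\<lambda>x. I x * \<psi> x)"
    if "\<psi> \<in> borel_measurable borel" "\<And>x. \<bar>\<psi> x\<bar> \<le> B" "\<And>x. norm x > R \<Longrightarrow> \<psi> x = 0" for \<psi> B R
  proof -
    have "integrable lborel (\<lambda>x. \<integral>t. G (x + t *\<^sub>R b) * \<psi> x * ?\<kappa> t \<partial>lborel)"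
      using lborel_pair.integrable_fst'[OF convolution_fubini(1)[OF G that \<kappa> T]] by simp
    moreover have "(\<integral>t. G (x + t *\<^sub>R b) * \<psi> x * ?\<kappa> t \<partial>lborel) = I x * \<psi> x" for x
      unfolding I_def by (simp add: mult_ac flip: integral_mult_right_zero)
    ultimately show ?thesis by simp
  qed
  have shift: "locally_integrable (\<lambda>x. u (x + h *\<^sub>R b))"
    unfolding locally_integrable_def set_integrable_def
  proof safe
    fix K :: "'a set" assume K: "compact K"
    have "compact ((+) (h *\<^sub>R b) ` K)" using K by (rule compact_translation)
    then have "integrable lborel (\<lambda>x. indicator ((+) (h *\<^sub>R b) ` K) x *\<^sub>R u x)"
      using u by (simp add: locally_integrable_def set_integrable_def)
    then have "integrable lborel (\<lambda>x. indicator ((+) (h *\<^sub>R b) ` K) (x + h *\<^sub>R b) *\<^sub>R u (x + h *\<^sub>R b))"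
      by (rule integrable_lborel_shift)
    moreover have "indicator ((+) (h *\<^sub>R b) ` K) (x + h *\<^sub>R b) = (indicator K x :: real)" for x
      by (auto simp: indicator_def image_iff add.commute)
    ultimately show "integrable lborel (\<lambda>x. indicator K x *\<^sub>R u (x + h *\<^sub>R b))" by simp
  qed
  have Iloc: "locally_integrable I"
    unfolding locally_integrable_def set_integrable_def
  proof safe
    fix K :: "'a set" assume K: "compact K"
    then obtain R where "\<And>x. x \<in> K \<Longrightarrow> norm x \<le> R" using compact_imp_bounded bounded_iff by metis
    moreover have "K \<in> sets borel" using K by (simp add: borel_compact)
    ultimately have "integrable lborel (\<lambda>x. I x * indicator K x)"
      by (intro Iint[where B=1 and R=R]) (force simp: indicator_simps indicator_eq_0_iff split: split_indicator)+
    then show "integrable lborel (\<lambda>x. indicator K x *\<^sub>R I x)" by (simp add: mult.commute)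
  qed
  have "AE x in lborel. u (x + h *\<^sub>R b) - u x - I x = 0"
  proof (rule fundamental_lemma_calculus_of_variations[OF _ _ \<theta>])
    show "locally_integrable (\<lambda>x. u (x + h *\<^sub>R b) - u x - I x)"
      using shift u Iloc unfolding locally_integrable_def set_integrable_def
      by (simp add: right_diff_distrib)
    fix \<phi> :: "'a \<Rightarrow> real" assume \<phi>: "\<phi> \<in> Cc_infinity"
    define d where "d = (\<lambda>x. frechet_derivative \<phi> (at x) b)"
    have cd: "continuous_on UNIV d" and c\<phi>: "continuous_on UNIV \<phi>"
      using Cc_infinity_continuous_derivative[OF \<phi> b] Cc_infinity_continuous[OF \<phi>] by (simp_all add: d_def)
    have [measurable]: "\<phi> \<in> borel_measurable borel" "d \<in> borel_measurable borel"
      using cd c\<phi> by (auto intro: borel_measurable_continuous_onI)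
    obtain R where R: "R > 0" "\<And>x. norm x > R \<Longrightarrow> \<phi> x = 0" "\<And>x. norm x > R \<Longrightarrow> d x = 0"
      using Cc_infinity_support[OF \<phi>] unfolding d_def by metis
    obtain B where B: "\<And>x. \<bar>\<phi> x\<bar> \<le> B" using continuous_compact_support_bounded[OF c\<phi> R(2)] by metis
    obtain B' where B': "\<And>x. \<bar>d x\<bar> \<le> B'" using continuous_compact_support_bounded[OF cd R(3)] by metis
    have ftc: "(\<integral>t. d (x - t *\<^sub>R b) * ?\<kappa> t \<partial>lborel) = \<phi> x - \<phi> (x - h *\<^sub>R b)" for x
    proof -
      have der: "((\<lambda>t. - \<phi> (x + t *\<^sub>R (- b))) has_real_derivative d (x - t *\<^sub>R b)) (at t)" for t
      proof -
        have "frechet_derivative \<phi> (at y) (- b) = - d y" for y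
          using has_derivative_linear[OF Cc_infinity_has_derivative[OF \<phi>]] by (simp add: d_def linear_neg)
        then show ?thesis
          using Cc_infinity_line[OF \<phi>, of x "- b" t] by (auto intro!: derivative_eq_intros)
      qed
      have "continuous_on UNIV (\<lambda>t. d (x - t *\<^sub>R b))"
        by (intro continuous_on_compose2[OF cd] continuous_intros) auto
      then show ?thesis
        using integral_FTC_Icc_real[OF h der] by (simp add: continuous_on_eq_continuous_at)
    qed
    \<comment> \<open>Translates of \<open>\<phi>\<close> are test functions too, so the definition
      of the weak gradient applies for every \<open>t\<close>. Integrated over
      \<open>{0..h}\<close>, the left side becomes a difference by \<open>ftc\<close> and the right
      side becomes a pairing with \<open>I\<close>.\<close>
    have weak: "(\<integral>x. u x * d (x - t *\<^sub>R b) \<partial>lborel) = - (\<integral>x. G x * \<phi> (x - t *\<^sub>R b) \<partial>lborel)" for t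
    proof -
      have eq: "\<phi> (- (t *\<^sub>R b) + 1 *\<^sub>R x) = \<phi> (x - t *\<^sub>R b)" for x by (simp add: algebra_simps)
      have t: "(\<lambda>x. \<phi> (x - t *\<^sub>R b)) \<in> Cc_infinity"
        using Cc_infinity_affine[OF \<phi>, of 1 "- (t *\<^sub>R b)"] by (simp add: eq)
      have "frechet_derivative (\<lambda>x. \<phi> (x - t *\<^sub>R b)) (at x) = frechet_derivative \<phi> (at (x - t *\<^sub>R b))" for x
      proof (rule frechet_derivative_at[symmetric])
        have "((\<lambda>x. x - t *\<^sub>R b) has_derivative (\<lambda>v. v)) (at x)"
          by (auto intro!: derivative_eq_intros)
        from diff_chain_at[OF this Cc_infinity_has_derivative[OF \<phi>]]
        show "((\<lambda>x. \<phi> (x - t *\<^sub>R b)) has_derivative frechet_derivative \<phi> (at (x - t *\<^sub>R b))) (at x)"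
          by (simp add: o_def)
      qed
      then show ?thesis
        using ug t b by (auto simp: is_weak_gradient_def d_def G_def)
    qed
    have "(\<integral>x. u x * (\<phi> x - \<phi> (x - h *\<^sub>R b)) \<partial>lborel)
        = (\<integral>t. (\<integral>x. u x * d (x - t *\<^sub>R b) \<partial>lborel) * ?\<kappa> t \<partial>lborel)"
      using convolution_fubini(2)[OF u \<open>d \<in> borel_measurable borel\<close> B' R(3) \<kappa> T] by (simp add: ftc)
    also have "\<dots> = - (\<integral>x. I x * \<phi> x \<partial>lborel)"
      using convolution_fubini(3)[OF G \<open>\<phi> \<in> borel_measurable borel\<close> B R(2) \<kappa> T] by (simp add: weak I_def)
    finally have *: "(\<integral>x. u x * (\<phi> x - \<phi> (x - h *\<^sub>R b)) \<partial>lborel) = - (\<integral>x. I x * \<phi> x \<partial>lborel)" .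
    have i1: "integrable lborel (\<lambda>x. u x * \<phi> x)"
      by (rule locally_integrable_mult[OF u _ B R(2)]) auto
    have i2: "integrable lborel (\<lambda>x. u (x + h *\<^sub>R b) * \<phi> x)"
      by (rule locally_integrable_mult[OF shift _ B R(2)]) auto
    have i3: "integrable lborel (\<lambda>x. I x * \<phi> x)"
      by (rule Iint[OF _ B R(2)]) auto
    have i4: "integrable lborel (\<lambda>x. u x * \<phi> (x - h *\<^sub>R b))"
      using integrable_lborel_shift[OF i2, of "- (h *\<^sub>R b)"] by simp
    have "(\<integral>x. u (x + h *\<^sub>R b) * \<phi> x \<partial>lborel) = (\<integral>x. u x * \<phi> (x - h *\<^sub>R b) \<partial>lborel)"
      using integral_lborel_shift[OF i2, of "- (h *\<^sub>R b)"] by simp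
    then show "(\<integral>x. (u (x + h *\<^sub>R b) - u x - I x) * \<phi> x \<partial>lborel) = 0"
      using * i1 i2 i3 i4 by (simp add: left_diff_distrib right_diff_distrib)
  qed
  then show ?thesis by eventually_elim (simp add: I_def G_def)
qed


section \<open>Weighted inequalities from difference quotients\<close>

text \<open>Cauchy-Schwarz on an interval, obtained from the nonnegative variance of
  \<open>F\<close> around its mean \<open>m\<close>. An infinite right-hand side is treated apart
  because the variance is computed with real integrals.\<close>

lemma power2_integral_le:
  fixes F :: "real \<Rightarrow> real"
  assumes [measurable]: "F \<in> borel_measurable borel" and h: "h > 0"
  shows "ennreal ((\<integral>t. F t * indicator {0..h} t \<partial>lborel)\<^sup>2)
    \<le> ennreal h * (\<integral>\<^sup>+t. ennreal ((F t)\<^sup>2) * indicator {0..h} t \<partial>lborel)"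
proof (cases "(\<integral>\<^sup>+t. ennreal ((F t)\<^sup>2) * indicator {0..h} t \<partial>lborel) = \<infinity>")
  case True
  then show ?thesis using h by (simp add: ennreal_mult_top)
next
  case False
  let ?i = "indicator {0..h} :: real \<Rightarrow> real"
  have nn: "(\<integral>\<^sup>+t. ennreal ((F t)\<^sup>2 * ?i t) \<partial>lborel) = (\<integral>\<^sup>+t. ennreal ((F t)\<^sup>2) * indicator {0..h} t \<partial>lborel)"
    by (intro nn_integral_cong) (simp split: split_indicator)
  have i2: "integrable lborel (\<lambda>t. (F t)\<^sup>2 * ?i t)"
    using False nn by (intro integrableI_nonneg) (auto simp: top.not_eq_extremum)
  have i0: "integrable lborel ?i" using h by (auto intro!: integrable_real_indicator)
  have i1: "integrable lborel (\<lambda>t. F t * ?i t)"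
  proof (rule Bochner_Integration.integrable_bound[OF Bochner_Integration.integrable_add[OF i0 i2]])
    have "\<bar>y\<bar> \<le> 1 + y\<^sup>2" for y :: real
      using sum_squares_bound[of "\<bar>y\<bar>" 1] by (auto simp: power2_eq_square)
    then show "AE t in lborel. norm (F t * ?i t) \<le> norm (?i t + (F t)\<^sup>2 * ?i t)"
      by (auto simp: indicator_def)
  qed measurable
  define m where "m = (\<integral>t. F t * ?i t \<partial>lborel) / h"
  have "0 \<le> (\<integral>t. (F t - m)\<^sup>2 * ?i t \<partial>lborel)" by (intro integral_nonneg_AE) auto
  also have "\<dots> = (\<integral>t. (F t)\<^sup>2 * ?i t - 2 * m * (F t * ?i t) + m\<^sup>2 * ?i t \<partial>lborel)"
    by (intro Bochner_Integration.integral_cong) (auto simp: power2_eq_square algebra_simps)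
  also have "\<dots> = (\<integral>t. (F t)\<^sup>2 * ?i t \<partial>lborel) - 2 * m * (\<integral>t. F t * ?i t \<partial>lborel) + m\<^sup>2 * h"
    using i0 i1 i2 h by simp
  also have "\<dots> = (\<integral>t. (F t)\<^sup>2 * ?i t \<partial>lborel) - (\<integral>t. F t * ?i t \<partial>lborel)\<^sup>2 / h"
    using h by (simp add: m_def field_simps power2_eq_square)
  finally have "(\<integral>t. F t * ?i t \<partial>lborel)\<^sup>2 \<le> h * (\<integral>t. (F t)\<^sup>2 * ?i t \<partial>lborel)"
    using h by (simp add: field_simps)
  then have "ennreal ((\<integral>t. F t * ?i t \<partial>lborel)\<^sup>2) \<le> ennreal (h * (\<integral>t. (F t)\<^sup>2 * ?i t \<partial>lborel))"
    by (rule ennreal_leI)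
  also have "\<dots> = ennreal h * (\<integral>\<^sup>+t. ennreal ((F t)\<^sup>2 * ?i t) \<partial>lborel)"
    using h i2 by (subst nn_integral_eq_integral) (auto simp: ennreal_mult)
  finally show ?thesis by (simp add: nn)
qed

text \<open>Completing the square after multiplication by \<open>w\<close> avoids a division by the
  weight; where \<open>w = 0\<close>, the hypothesis forces \<open>\<Phi> = 0\<close>.\<close>

lemma quadratic_form_nonneg:
  fixes D v w q \<Phi> :: real
  assumes "0 \<le> w" "0 \<le> q" "\<Phi>\<^sup>2 \<le> q * w"
  shows "0 \<le> D\<^sup>2 * w + 2 * D * v * \<Phi> + v\<^sup>2 * q"
proof (cases "w = 0")
  case True
  then show ?thesis using assms by simp
next
  case False
  have "w * (D\<^sup>2 * w + 2 * D * v * \<Phi> + v\<^sup>2 * q) = (D * w + v * \<Phi>)\<^sup>2 + v\<^sup>2 * (q * w - \<Phi>\<^sup>2)"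
    by (simp add: power2_eq_square algebra_simps)
  also have "\<dots> \<ge> 0" using assms by simp
  finally show ?thesis using assms False by (simp add: zero_le_mult_iff)
qed

text \<open>This is \<open>\<integral> (\<partial>\<^sub>b u)\<^sup>2 w + 2 u (\<partial>\<^sub>b u) \<Phi> + u\<^sup>2 q \<ge> 0\<close> integrated by parts. It is proved with
  \<open>D = (u (x + h b) - u x) / h\<close> in place of \<open>\<partial>\<^sub>b u\<close> and the mean \<open>v\<close> of the two values in place of \<open>u\<close>:
  since \<open>2 D v\<close> is exactly the difference quotient of \<open>u\<^sup>2\<close>, it can be shifted onto the Lipschitz
  function \<open>\<Phi>\<close>, and no approximation of \<open>u\<close> by smooth functions is needed.\<close>

lemma weak_gradient_vector_field_inequality:
  fixes u w \<Phi> q d \<theta> :: "'a::euclidean_space \<Rightarrow> real"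
  assumes ug: "is_weak_gradient u g" and b: "b \<in> Basis"
    and \<theta>: "\<theta> \<in> Cc_infinity" "\<And>x. 0 \<le> \<theta> x" "(\<integral>x. \<theta> x \<partial>lborel) > 0"
    and meas [measurable]: "w \<in> borel_measurable borel" "\<Phi> \<in> borel_measurable borel"
      "q \<in> borel_measurable borel" "d \<in> borel_measurable borel" "K' \<in> sets borel"
    and K: "\<And>x. x \<notin> K \<Longrightarrow> w x = 0" "\<And>x. x \<notin> K \<Longrightarrow> \<Phi> x = 0" "\<And>x. x \<notin> K \<Longrightarrow> q x = 0"
    and h0: "h0 > 0" and K': "\<And>x y. x \<in> K \<Longrightarrow> dist x y \<le> h0 \<Longrightarrow> y \<in> K'"
    and u2: "integrable lborel (\<lambda>x. indicator K' x * (u x)\<^sup>2)"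
    and G2: "integrable lborel (\<lambda>x. indicator K' x * (g x \<bullet> b)\<^sup>2)"
    and lip: "\<And>x t. \<bar>w (x + t *\<^sub>R b) - w x\<bar> \<le> L * \<bar>t\<bar>"
      "\<And>x t. \<bar>\<Phi> (x + t *\<^sub>R b) - \<Phi> x\<bar> \<le> L * \<bar>t\<bar>" "\<And>x t. \<bar>q (x + t *\<^sub>R b) - q x\<bar> \<le> L * \<bar>t\<bar>"
    and nonneg: "\<And>x. 0 \<le> w x" "\<And>x. 0 \<le> q x" and young: "\<And>x. (\<Phi> x)\<^sup>2 \<le> q x * w x"
    and deriv: "\<And>x. ((\<lambda>t. \<Phi> (x + t *\<^sub>R b)) has_real_derivative d x) (at 0)"
    and bound: "\<And>x. \<bar>w x\<bar> \<le> B" "\<And>x. \<bar>\<Phi> x\<bar> \<le> B" "\<And>x. \<bar>q x\<bar> \<le> B"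
  shows "integrable lborel (\<lambda>x. (u x)\<^sup>2 * d x)"
    and "(\<integral>x. (u x)\<^sup>2 * d x \<partial>lborel) - (\<integral>x. (u x)\<^sup>2 * q x \<partial>lborel) \<le> (\<integral>x. (g x \<bullet> b)\<^sup>2 * w x \<partial>lborel)"
proof -
  define G where "G = (\<lambda>x. g x \<bullet> b)"
  have "locally_integrable G" using ug by (simp add: G_def is_weak_gradient_def locally_integrable_inner)
  then have [measurable]: "u \<in> borel_measurable borel" "G \<in> borel_measurable borel"
    using ug by (auto simp: is_weak_gradient_def intro: locally_integrable_measurable)
  have nb: "norm b = 1" using b by simp
  have L0: "L \<ge> 0" using lip(1)[of 0 1] by simp
  define IG where "IG = (\<integral>x. indicator K' x * (G x)\<^sup>2 \<partial>lborel)"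
  define Iu where "Iu = (\<integral>x. indicator K' x * (u x)\<^sup>2 \<partial>lborel)"
  have KK': "x \<in> K'" if "x \<in> K" for x using K'[OF that, of x] h0 by simp
  have shiftK: "x \<in> K'" if "x - t *\<^sub>R b \<in> K" "0 \<le> t" "t \<le> h0" for x t
    using K'[OF that(1), of x] that nb by (simp add: dist_norm)
  have supp_int: "integrable lborel (\<lambda>x. v x * f x)"
    if [measurable]: "f \<in> borel_measurable borel" "v \<in> borel_measurable borel"
      and v: "integrable lborel (\<lambda>x. indicator K' x * v x)"
      and fK: "\<And>x. x \<notin> K' \<Longrightarrow> f x = 0" and f: "\<And>x. \<bar>f x\<bar> \<le> B" for f v :: "'a \<Rightarrow> real"
  proof (rule Bochner_Integration.integrable_bound[OF integrable_mult_right[OF v, of B]])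
    have "\<bar>v x * f x\<bar> \<le> \<bar>B * (indicator K' x * v x)\<bar>" for x
    proof (cases "x \<in> K'")
      case True
      have "\<bar>f x\<bar> \<le> \<bar>B\<bar>" using f[of x] by linarith
      then have "\<bar>v x\<bar> * \<bar>f x\<bar> \<le> \<bar>v x\<bar> * \<bar>B\<bar>" by (rule mult_left_mono) simp
      then show ?thesis using True by (simp add: abs_mult mult.commute)
    qed (simp add: fK)
    then show "AE x in lborel. norm (v x * f x) \<le> norm (B * (indicator K' x * v x))" by simp
  qed measurable
  have G2': "integrable lborel (\<lambda>x. indicator K' x * (G x)\<^sup>2)" using G2 by (simp add: G_def)
  have int: "integrable lborel (\<lambda>x. (G x)\<^sup>2 * w x)" "integrable lborel (\<lambda>x. (u x)\<^sup>2 * q x)"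
    by (rule supp_int[OF _ _ G2'], use KK' K bound in auto)
      (rule supp_int[OF _ _ u2], use KK' K bound in auto)
  \<comment> \<open>The difference quotient is the mean of \<open>G\<close> over a segment, so its
    weighted energy is at most the average over \<open>t \<le> h\<close> of the energy of
    \<open>G\<close> against the shifted weight \<open>w (x - t b)\<close>. The Lipschitz bound
    replaces this weight by \<open>w\<close> at a cost \<open>L * h\<close> on \<open>K'\<close>,
    which contains every point reached by the shift.\<close>
  have energy: "integrable lborel (\<lambda>x. ((u (x + h *\<^sub>R b) - u x) / h)\<^sup>2 * w x) \<and>
      (\<integral>x. ((u (x + h *\<^sub>R b) - u x) / h)\<^sup>2 * w x \<partial>lborel) \<le> (\<integral>x. (G x)\<^sup>2 * w x \<partial>lborel) + L * h * IG"
    if h: "0 < h" "h \<le> h0" for h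
  proof -
    define Q where "Q = (\<lambda>x. ((u (x + h *\<^sub>R b) - u x) / h)\<^sup>2 * w x)"
    have [measurable]: "Q \<in> borel_measurable borel" by (simp add: Q_def)
    have "AE x in lborel. u (x + h *\<^sub>R b) - u x = (\<integral>t. G (x + t *\<^sub>R b) * indicator {0..h} t \<partial>lborel)"
      using weak_gradient_difference[OF ug b _ \<theta>, of h] h by (simp add: G_def)
    then have "AE x in lborel. ennreal (Q x) \<le>
        (\<integral>\<^sup>+t. ennreal (1 / h * w x * (G (x + t *\<^sub>R b))\<^sup>2) * indicator {0..h} t \<partial>lborel)"
    proof eventually_elim
      case (elim x)
      have "ennreal (Q x) = ennreal (w x / h\<^sup>2) * ennreal ((u (x + h *\<^sub>R b) - u x)\<^sup>2)"
        using nonneg by (simp add: Q_def power_divide ennreal_mult[symmetric])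
      also have "\<dots> \<le> ennreal (w x / h\<^sup>2) * (ennreal h * (\<integral>\<^sup>+t. ennreal ((G (x + t *\<^sub>R b))\<^sup>2) * indicator {0..h} t \<partial>lborel))"
        unfolding elim using h by (intro mult_left_mono power2_integral_le) auto
      also have "\<dots> = ennreal (1 / h * w x) * (\<integral>\<^sup>+t. ennreal ((G (x + t *\<^sub>R b))\<^sup>2) * indicator {0..h} t \<partial>lborel)"
        unfolding mult.assoc[symmetric] using nonneg h
        by (simp add: ennreal_mult[symmetric] power2_eq_square)
      also have "\<dots> = (\<integral>\<^sup>+t. ennreal (1 / h * w x) * (ennreal ((G (x + t *\<^sub>R b))\<^sup>2) * indicator {0..h} t) \<partial>lborel)"
        by (rule nn_integral_cmult[symmetric]) measurable
      also have "\<dots> = (\<integral>\<^sup>+t. ennreal (1 / h * w x * (G (x + t *\<^sub>R b))\<^sup>2) * indicator {0..h} t \<partial>lborel)"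
        using nonneg h by (intro nn_integral_cong) (simp add: mult.assoc[symmetric] ennreal_mult[symmetric])
      finally show ?case .
    qed
    then have "(\<integral>\<^sup>+x. ennreal (Q x) \<partial>lborel) \<le>
        (\<integral>\<^sup>+x. (\<integral>\<^sup>+t. ennreal (1 / h * w x * (G (x + t *\<^sub>R b))\<^sup>2) * indicator {0..h} t \<partial>lborel) \<partial>lborel)"
      by (rule nn_integral_mono_AE)
    also have "\<dots> = (\<integral>\<^sup>+t. (\<integral>\<^sup>+x. ennreal (1 / h * w x * (G (x + t *\<^sub>R b))\<^sup>2) * indicator {0..h} t \<partial>lborel) \<partial>lborel)"
      by (rule lborel_pair.Fubini') measurable
    also have "\<dots> \<le> (\<integral>\<^sup>+t. ennreal (1 / h) * ennreal ((\<integral>x. (G x)\<^sup>2 * w x \<partial>lborel) + L * h * IG) * indicator {0..h} t \<partial>lborel)"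
    proof (rule nn_integral_mono)
      fix t :: real
      show "(\<integral>\<^sup>+x. ennreal (1 / h * w x * (G (x + t *\<^sub>R b))\<^sup>2) * indicator {0..h} t \<partial>lborel)
        \<le> ennreal (1 / h) * ennreal ((\<integral>x. (G x)\<^sup>2 * w x \<partial>lborel) + L * h * IG) * indicator {0..h} t"
      proof (cases "t \<in> {0..h}")
        case True
        have "(\<integral>\<^sup>+x. ennreal (1 / h * w x * (G (x + t *\<^sub>R b))\<^sup>2) \<partial>lborel)
          = (\<integral>\<^sup>+x. ennreal (1 / h * w (x + t *\<^sub>R b - t *\<^sub>R b) * (G (x + t *\<^sub>R b))\<^sup>2) \<partial>lborel)" by simp
        also have "\<dots> = (\<integral>\<^sup>+x. ennreal (1 / h * w (x - t *\<^sub>R b) * (G x)\<^sup>2) \<partial>lborel)"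
          by (rule nn_integral_lborel_shift) measurable
        also have "\<dots> \<le> (\<integral>\<^sup>+x. ennreal (1 / h * ((G x)\<^sup>2 * w x + L * h * (indicator K' x * (G x)\<^sup>2))) \<partial>lborel)"
        proof (intro nn_integral_mono ennreal_leI)
          fix x
          have "w (x - t *\<^sub>R b) * (G x)\<^sup>2 \<le> (G x)\<^sup>2 * w x + L * h * (indicator K' x * (G x)\<^sup>2)"
          proof (cases "x - t *\<^sub>R b \<in> K")
            case in_K: True
            have "w (x - t *\<^sub>R b) \<le> w x + L * t"
              using lip(1)[of x "- t"] True by auto
            also have "\<dots> \<le> w x + L * h" using L0 True by (auto intro!: mult_left_mono)
            finally have "w (x - t *\<^sub>R b) * (G x)\<^sup>2 \<le> (w x + L * h) * (G x)\<^sup>2"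
              by (rule mult_right_mono) simp
            then show ?thesis using shiftK[OF in_K] True h by (simp add: algebra_simps)
          qed (use K nonneg L0 h in auto)
          then show "1 / h * w (x - t *\<^sub>R b) * (G x)\<^sup>2 \<le> 1 / h * ((G x)\<^sup>2 * w x + L * h * (indicator K' x * (G x)\<^sup>2))"
            using h by (simp add: divide_right_mono)
        qed
        also have "\<dots> = ennreal (\<integral>x. 1 / h * ((G x)\<^sup>2 * w x + L * h * (indicator K' x * (G x)\<^sup>2)) \<partial>lborel)"
          using int(1) G2' nonneg L0 h
          by (intro nn_integral_eq_integral) auto
        also have "\<dots> = ennreal (1 / h * ((\<integral>x. (G x)\<^sup>2 * w x \<partial>lborel) + L * h * IG))"
          using int(1) G2' by (simp add: IG_def)
        also have "\<dots> = ennreal (1 / h) * ennreal ((\<integral>x. (G x)\<^sup>2 * w x \<partial>lborel) + L * h * IG)"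
          using h by (intro ennreal_mult') simp
        finally show ?thesis using True by simp
      qed simp
    qed
    also have "\<dots> = ennreal (1 / h) * ennreal ((\<integral>x. (G x)\<^sup>2 * w x \<partial>lborel) + L * h * IG) * ennreal h"
      using h by (subst nn_integral_cmult) auto
    also have "\<dots> = ennreal (1 / h * ((\<integral>x. (G x)\<^sup>2 * w x \<partial>lborel) + L * h * IG) * h)"
      using h by (simp add: ennreal_mult'[symmetric] ennreal_mult''[symmetric])
    finally have le: "(\<integral>\<^sup>+x. ennreal (Q x) \<partial>lborel) \<le> ennreal ((\<integral>x. (G x)\<^sup>2 * w x \<partial>lborel) + L * h * IG)"
      using h by simp
    have Q0: "Q x \<ge> 0" for x using nonneg by (simp add: Q_def)
    have Qi: "integrable lborel Q"
      using le Q0 by (intro integrableI_nonneg) (auto simp: top_unique less_top[symmetric])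
    have "ennreal (integral\<^sup>L lborel Q) \<le> ennreal ((\<integral>x. (G x)\<^sup>2 * w x \<partial>lborel) + L * h * IG)"
      using le nn_integral_eq_integral[OF Qi] Q0 by simp
    moreover have "IG \<ge> 0" "(\<integral>x. (G x)\<^sup>2 * w x \<partial>lborel) \<ge> 0"
      using nonneg by (auto simp: IG_def intro!: integral_nonneg_AE)
    ultimately have "integral\<^sup>L lborel Q \<le> (\<integral>x. (G x)\<^sup>2 * w x \<partial>lborel) + L * h * IG"
      using L0 h by (subst (asm) ennreal_le_iff) auto
    then show ?thesis using Qi by (simp add: Q_def)
  qed
  have du: "integrable lborel (\<lambda>x. (u x)\<^sup>2 * ((\<Phi> x - \<Phi> (x - h *\<^sub>R b)) / h))"
    "\<bar>(u x)\<^sup>2 * ((\<Phi> x - \<Phi> (x - h *\<^sub>R b)) / h)\<bar> \<le> L * (indicator K' x * (u x)\<^sup>2)"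
    if h: "0 < h" "h \<le> h0" for h x
  proof -
    have *: "\<bar>(u x)\<^sup>2 * ((\<Phi> x - \<Phi> (x - h *\<^sub>R b)) / h)\<bar> \<le> L * (indicator K' x * (u x)\<^sup>2)" for x
    proof (cases "x \<in> K'")
      case True
      have "\<bar>(\<Phi> x - \<Phi> (x - h *\<^sub>R b)) / h\<bar> \<le> L"
        using lip(2)[of x "- h"] h by (simp add: abs_minus_commute field_simps)
      from mult_left_mono[OF this, of "(u x)\<^sup>2"] show ?thesis
        using True by (simp add: abs_mult mult.commute)
    next
      case False
      then have "x \<notin> K" "x - h *\<^sub>R b \<notin> K"
        using KK'[of x] shiftK[of x h] h by auto
      then have "\<Phi> x = 0" "\<Phi> (x - h *\<^sub>R b) = 0" by (simp_all add: K(2))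
      then show ?thesis using False by simp
    qed
    then show "\<bar>(u x)\<^sup>2 * ((\<Phi> x - \<Phi> (x - h *\<^sub>R b)) / h)\<bar> \<le> L * (indicator K' x * (u x)\<^sup>2)" .
    show "integrable lborel (\<lambda>x. (u x)\<^sup>2 * ((\<Phi> x - \<Phi> (x - h *\<^sub>R b)) / h))"
      by (rule Bochner_Integration.integrable_bound[OF integrable_mult_right[OF u2, of L]])
        (use * in \<open>auto intro: order_trans[OF _ abs_ge_self] simp del: abs_divide abs_mult times_divide_eq_right\<close>)
  qed
  have step: "(\<integral>x. (u x)\<^sup>2 * ((\<Phi> x - \<Phi> (x - h *\<^sub>R b)) / h) \<partial>lborel)
      \<le> (\<integral>x. (G x)\<^sup>2 * w x \<partial>lborel) + (\<integral>x. (u x)\<^sup>2 * q x \<partial>lborel) + L * h * (IG + Iu)"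
    if h: "0 < h" "h \<le> h0" for h
  proof -
    have shift_int: "integrable lborel (\<lambda>x. (u (x + h *\<^sub>R b))\<^sup>2 * f x)"
      "integrable lborel (\<lambda>x. (u x)\<^sup>2 * f x)"
      "integrable lborel (\<lambda>x. (u x)\<^sup>2 * f (x - h *\<^sub>R b))"
      "(\<integral>x. (u (x + h *\<^sub>R b))\<^sup>2 * f x \<partial>lborel) = (\<integral>x. (u x)\<^sup>2 * f (x - h *\<^sub>R b) \<partial>lborel)"
      if [measurable]: "f \<in> borel_measurable borel" and fK: "\<And>x. x \<notin> K \<Longrightarrow> f x = 0" and B: "\<And>x. \<bar>f x\<bar> \<le> B" for f
    proof -
      show 1: "integrable lborel (\<lambda>x. (u x)\<^sup>2 * f (x - h *\<^sub>R b))"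
        by (rule supp_int[OF _ _ u2]) (use shiftK[of _ h] h fK B in auto)
      show "integrable lborel (\<lambda>x. (u (x + h *\<^sub>R b))\<^sup>2 * f x)"
        using integrable_lborel_shift[OF 1, of "h *\<^sub>R b"] by simp
      show "(\<integral>x. (u (x + h *\<^sub>R b))\<^sup>2 * f x \<partial>lborel) = (\<integral>x. (u x)\<^sup>2 * f (x - h *\<^sub>R b) \<partial>lborel)"
        using integral_lborel_shift[OF 1, of "h *\<^sub>R b"] by simp
      show "integrable lborel (\<lambda>x. (u x)\<^sup>2 * f x)"
        by (rule supp_int[OF _ _ u2]) (use KK' fK B in auto)
    qed
    note s\<Phi> = shift_int[OF meas(2) K(2) bound(2)] and sq = shift_int[OF meas(3) K(3) bound(3)]
    \<comment> \<open>This is the quadratic form at the difference quotient and the mean value, with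
      the square of the mean enlarged to the mean of the squares. In the terms with
      \<open>\<Phi>\<close> and \<open>q\<close> only squares of \<open>u\<close> and of its
      translate remain, so the translation can be moved onto \<open>\<Phi>\<close> and
      \<open>q\<close>.\<close>
    define P where "P = (\<lambda>x. ((u (x + h *\<^sub>R b) - u x) / h)\<^sup>2 * w x
      + ((u (x + h *\<^sub>R b))\<^sup>2 * \<Phi> x - (u x)\<^sup>2 * \<Phi> x) / h + ((u (x + h *\<^sub>R b))\<^sup>2 * q x + (u x)\<^sup>2 * q x) / 2)"
    have "0 \<le> P x" for x
    proof -
      let ?a = "u (x + h *\<^sub>R b)" and ?c = "u x"
      have e1: "2 * ((?a - ?c) / h) * ((?a + ?c) / 2) * \<Phi> x = (?a\<^sup>2 * \<Phi> x - ?c\<^sup>2 * \<Phi> x) / h"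
        using h by (simp add: field_simps power2_eq_square)
      have "((?a + ?c) / 2)\<^sup>2 \<le> (?a\<^sup>2 + ?c\<^sup>2) / 2"
        using sum_squares_bound[of ?a ?c] by (simp add: field_simps power2_eq_square)
      then have e2: "((?a + ?c) / 2)\<^sup>2 * q x \<le> (?a\<^sup>2 + ?c\<^sup>2) / 2 * q x"
        using nonneg(2) by (rule mult_right_mono)
      have "0 \<le> ((?a - ?c) / h)\<^sup>2 * w x + 2 * ((?a - ?c) / h) * ((?a + ?c) / 2) * \<Phi> x + ((?a + ?c) / 2)\<^sup>2 * q x"
        using nonneg young by (rule quadratic_form_nonneg)
      moreover have "P x = ((?a - ?c) / h)\<^sup>2 * w x + (?a\<^sup>2 * \<Phi> x - ?c\<^sup>2 * \<Phi> x) / h + (?a\<^sup>2 + ?c\<^sup>2) / 2 * q x"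
        by (simp add: P_def algebra_simps add_divide_distrib)
      ultimately show ?thesis using e1 e2 by linarith
    qed
    then have "0 \<le> (\<integral>x. P x \<partial>lborel)" by (intro integral_nonneg_AE) auto
    also have "\<dots> = (\<integral>x. ((u (x + h *\<^sub>R b) - u x) / h)\<^sup>2 * w x \<partial>lborel)
      + ((\<integral>x. (u x)\<^sup>2 * \<Phi> (x - h *\<^sub>R b) \<partial>lborel) - (\<integral>x. (u x)\<^sup>2 * \<Phi> x \<partial>lborel)) / h
      + ((\<integral>x. (u x)\<^sup>2 * q (x - h *\<^sub>R b) \<partial>lborel) + (\<integral>x. (u x)\<^sup>2 * q x \<partial>lborel)) / 2"
      using energy[OF h] s\<Phi> sq unfolding P_def by simp
    finally have 1: "0 \<le> \<dots>" .
    have 2: "(\<integral>x. (u x)\<^sup>2 * q (x - h *\<^sub>R b) \<partial>lborel) \<le> (\<integral>x. (u x)\<^sup>2 * q x + L * h * (indicator K' x * (u x)\<^sup>2) \<partial>lborel)"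
    proof (rule integral_mono)
      fix x
      show "(u x)\<^sup>2 * q (x - h *\<^sub>R b) \<le> (u x)\<^sup>2 * q x + L * h * (indicator K' x * (u x)\<^sup>2)"
      proof (cases "x - h *\<^sub>R b \<in> K")
        case in_K: True
        have "q (x - h *\<^sub>R b) \<le> q x + L * h" using lip(3)[of x "- h"] h by auto
        then have "(u x)\<^sup>2 * q (x - h *\<^sub>R b) \<le> (u x)\<^sup>2 * (q x + L * h)"
          by (rule mult_left_mono) simp
        then show ?thesis using shiftK[OF in_K] h by (simp add: algebra_simps)
      qed (use K nonneg L0 h in auto)
    qed (use sq u2 in auto)
    have 3: "(\<integral>x. (u x)\<^sup>2 * q x + L * h * (indicator K' x * (u x)\<^sup>2) \<partial>lborel) = (\<integral>x. (u x)\<^sup>2 * q x \<partial>lborel) + L * h * Iu"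
      using sq u2 by (simp add: Iu_def)
    have 4: "(\<integral>x. (u x)\<^sup>2 * ((\<Phi> x - \<Phi> (x - h *\<^sub>R b)) / h) \<partial>lborel)
        = ((\<integral>x. (u x)\<^sup>2 * \<Phi> x \<partial>lborel) - (\<integral>x. (u x)\<^sup>2 * \<Phi> (x - h *\<^sub>R b) \<partial>lborel)) / h"
      using s\<Phi> by (simp add: right_diff_distrib diff_divide_distrib)
    have 5: "L * h * Iu \<ge> 0" using L0 h by (auto simp: Iu_def intro!: mult_nonneg_nonneg integral_nonneg_AE)
    have "((\<integral>x. (u x)\<^sup>2 * \<Phi> x \<partial>lborel) - (\<integral>x. (u x)\<^sup>2 * \<Phi> (x - h *\<^sub>R b) \<partial>lborel)) / h
       = - (((\<integral>x. (u x)\<^sup>2 * \<Phi> (x - h *\<^sub>R b) \<partial>lborel) - (\<integral>x. (u x)\<^sup>2 * \<Phi> x \<partial>lborel)) / h)"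
      by (simp add: diff_divide_distrib)
    moreover have "x \<le> f + r' + (m + n)"
      if "0 \<le> e + y + (r + r') / 2" "r \<le> r' + n" "e \<le> f + m" "x = - y" "0 \<le> n"
      for e f r r' x y m n :: real
      using that by (simp add: field_simps)
    ultimately show ?thesis
      using 1 2 5 energy[OF h, THEN conjunct2] unfolding 3 4 distrib_left[of "L * h"] by blast
  qed
  define hn where "hn = (\<lambda>n::nat. h0 / (real n + 1))"
  have hn: "0 < hn n" "hn n \<le> h0" for n
    using h0 by (auto simp: hn_def field_simps)
  have hn0: "hn \<longlonglongrightarrow> 0"
    using tendsto_mult[OF tendsto_const[of h0] LIMSEQ_inverse_real_of_nat] by (simp add: hn_def field_simps)
  have lim: "(\<lambda>n. (\<Phi> x - \<Phi> (x - hn n *\<^sub>R b)) / hn n) \<longlonglongrightarrow> d x" for x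
  proof -
    have "((\<lambda>t. (\<Phi> (x + t *\<^sub>R b) - \<Phi> x) / t) \<longlongrightarrow> d x) (at 0)"
      using deriv[of x] by (simp add: has_field_derivative_iff)
    moreover have "filterlim (\<lambda>n. - hn n) (at 0) sequentially"
      using tendsto_minus[OF hn0] hn by (auto simp: filterlim_at less_imp_neq[symmetric])
    ultimately have "(\<lambda>n. (\<Phi> (x + (- hn n) *\<^sub>R b) - \<Phi> x) / (- hn n)) \<longlonglongrightarrow> d x"
      by (rule filterlim_compose)
    then show ?thesis by (simp add: diff_divide_distrib)
  qed
  \<comment> \<open>The Lipschitz constant bounds the difference quotients of \<open>\<Phi>\<close>,
    and \<open>K'\<close> contains their supports for all steps up to \<open>h0\<close>, so one
    majorant serves for all \<open>n\<close>.\<close>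
  have dom: "AE x in lborel. (\<lambda>n. (u x)\<^sup>2 * ((\<Phi> x - \<Phi> (x - hn n *\<^sub>R b)) / hn n)) \<longlonglongrightarrow> (u x)\<^sup>2 * d x"
    "\<And>n. AE x in lborel. norm ((u x)\<^sup>2 * ((\<Phi> x - \<Phi> (x - hn n *\<^sub>R b)) / hn n)) \<le> L * (indicator K' x * (u x)\<^sup>2)"
    by (intro AE_I2 tendsto_mult_left lim) (use du(2)[OF hn] in simp)
  show "integrable lborel (\<lambda>x. (u x)\<^sup>2 * d x)"
    by (rule integrable_dominated_convergence[OF _ _ integrable_mult_right[OF u2, of L] dom]) measurable
  have l1: "(\<lambda>n. \<integral>x. (u x)\<^sup>2 * ((\<Phi> x - \<Phi> (x - hn n *\<^sub>R b)) / hn n) \<partial>lborel) \<longlonglongrightarrow> (\<integral>x. (u x)\<^sup>2 * d x \<partial>lborel)"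
    by (rule integral_dominated_convergence[OF _ _ integrable_mult_right[OF u2, of L] dom]) measurable
  have l2: "(\<lambda>n. (\<integral>x. (G x)\<^sup>2 * w x \<partial>lborel) + (\<integral>x. (u x)\<^sup>2 * q x \<partial>lborel) + L * hn n * (IG + Iu))
      \<longlonglongrightarrow> (\<integral>x. (G x)\<^sup>2 * w x \<partial>lborel) + (\<integral>x. (u x)\<^sup>2 * q x \<partial>lborel) + L * 0 * (IG + Iu)"
    by (intro tendsto_intros hn0)
  have "(\<integral>x. (u x)\<^sup>2 * d x \<partial>lborel) \<le> (\<integral>x. (G x)\<^sup>2 * w x \<partial>lborel) + (\<integral>x. (u x)\<^sup>2 * q x \<partial>lborel) + L * 0 * (IG + Iu)"
    by (rule LIMSEQ_le[OF l1 l2]) (use step[OF hn] in blast)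
  then show "(\<integral>x. (u x)\<^sup>2 * d x \<partial>lborel) - (\<integral>x. (u x)\<^sup>2 * q x \<partial>lborel) \<le> (\<integral>x. (g x \<bullet> b)\<^sup>2 * w x \<partial>lborel)"
    by (simp add: G_def)
qed


section \<open>Directional derivatives and classical gradients\<close>

lemma directional_derivative_bound:
  fixes f :: "'a::real_normed_vector \<Rightarrow> real"
  assumes "\<And>x. ((\<lambda>t. f (x + t *\<^sub>R b)) has_real_derivative d x) (at 0)" "\<And>x. \<bar>d x\<bar> \<le> L"
  shows "\<bar>f (x + t *\<^sub>R b) - f x\<bar> \<le> L * \<bar>t\<bar>"
proof -
  have "((\<lambda>t. f (x + t *\<^sub>R b)) has_real_derivative d (x + s *\<^sub>R b)) (at s)" for s
    using assms(1)[of "x + s *\<^sub>R b"] DERIV_shift[of "\<lambda>t. f (x + t *\<^sub>R b)" "d (x + s *\<^sub>R b)" 0 s]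
    by (simp add: algebra_simps)
  then have "norm (f (x + t *\<^sub>R b) - f (x + 0 *\<^sub>R b)) \<le> L * norm (t - 0)"
    using assms(2) by (intro field_differentiable_bound[where S=UNIV and f'="\<lambda>s. d (x + s *\<^sub>R b)"]) auto
  then show ?thesis by simp
qed

text \<open>By translation invariance every difference quotient of \<open>f\<close> has integral
  zero, and dominated convergence passes this to the derivative. With steps at most \<open>1\<close>
  and \<open>norm b \<le> 1\<close> all quotients live in the ball of radius
  \<open>R + 1\<close>.\<close>

lemma integral_directional_derivative_eq_0:
  fixes f d :: "'a::euclidean_space \<Rightarrow> real"
  assumes deriv: "\<And>x. ((\<lambda>t. f (x + t *\<^sub>R b)) has_real_derivative d x) (at 0)"
    and cont: "continuous_on UNIV f" "continuous_on UNIV d" and b: "norm b \<le> 1"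
    and R: "\<And>x. norm x > R \<Longrightarrow> f x = 0" "\<And>x. norm x > R \<Longrightarrow> d x = 0"
  shows "(\<integral>x. d x \<partial>lborel) = 0"
proof -
  obtain B where B: "B \<ge> 0" "\<And>x. \<bar>d x\<bar> \<le> B"
    using continuous_compact_support_bounded[OF cont(2) R(2)] by metis
  obtain B' where B': "\<And>x. \<bar>f x\<bar> \<le> B'"
    using continuous_compact_support_bounded[OF cont(1) R(1)] by metis
  note lip = directional_derivative_bound[OF deriv B(2)]
  have [measurable]: "f \<in> borel_measurable borel" "d \<in> borel_measurable borel"
    using cont by (auto intro: borel_measurable_continuous_onI)
  have "integrable lborel (\<lambda>x. 1 * f x)"
    by (rule locally_integrable_mult[OF continuous_locally_integrable _ B' R(1)]) auto
  then have fi: "integrable lborel f" by simp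
  define hn where "hn = (\<lambda>n::nat. 1 / (real n + 1))"
  have hn: "0 < hn n" "hn n \<le> 1" for n by (auto simp: hn_def field_simps)
  have hn0: "hn \<longlonglongrightarrow> 0"
    using LIMSEQ_inverse_real_of_nat by (simp add: hn_def field_simps)
  have "(\<lambda>n. \<integral>x. (f (x + hn n *\<^sub>R b) - f x) / hn n \<partial>lborel) \<longlonglongrightarrow> (\<integral>x. d x \<partial>lborel)"
  proof (rule integral_dominated_convergence[where w="\<lambda>x. B * indicator (cball 0 (R + 1)) x"])
    show "integrable lborel (\<lambda>x::'a. B * indicator (cball 0 (R + 1)) x)"
      by (intro integrable_mult_right integrable_real_indicator) (use emeasure_bounded_finite[OF bounded_cball] in auto)
    show "AE x in lborel. (\<lambda>n. (f (x + hn n *\<^sub>R b) - f x) / hn n) \<longlonglongrightarrow> d x"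
    proof (rule AE_I2)
      fix x
      have "((\<lambda>t. (f (x + t *\<^sub>R b) - f x) / t) \<longlongrightarrow> d x) (at 0)"
        using deriv[of x] by (simp add: has_field_derivative_iff)
      moreover have "filterlim hn (at 0) sequentially"
        using hn0 hn by (auto simp: filterlim_at less_imp_neq[symmetric])
      ultimately show "(\<lambda>n. (f (x + hn n *\<^sub>R b) - f x) / hn n) \<longlonglongrightarrow> d x"
        by (rule filterlim_compose)
    qed
    show "AE x in lborel. norm ((f (x + hn n *\<^sub>R b) - f x) / hn n) \<le> B * indicator (cball 0 (R + 1)) x" for n
    proof (rule AE_I2)
      fix x
      show "norm ((f (x + hn n *\<^sub>R b) - f x) / hn n) \<le> B * indicator (cball 0 (R + 1)) x"
      proof (cases "norm x \<le> R + 1")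
        case True
        then show ?thesis using lip[of x "hn n"] hn[of n] by (simp add: field_simps)
      next
        case False
        have "norm (hn n *\<^sub>R b) \<le> 1" using hn[of n] b by (simp add: mult_le_one)
        then have "norm (x + hn n *\<^sub>R b) > R"
          using False norm_triangle_ineq4[of "x + hn n *\<^sub>R b" "hn n *\<^sub>R b"] by simp
        then show ?thesis using R(1) False by simp
      qed
    qed
  qed measurable
  moreover have "(\<integral>x. (f (x + hn n *\<^sub>R b) - f x) / hn n \<partial>lborel) = 0" for n
    using fi integrable_lborel_shift[OF fi] integral_lborel_shift[OF fi] by simp
  ultimately have "(\<lambda>_. 0) \<longlonglongrightarrow> (\<integral>x. d x \<partial>lborel)" by (simp only:)
  then show ?thesis by (simp add: LIMSEQ_const_iff)
qed

text \<open>The defining identity says that the directional derivative of \<open>u * \<phi>\<close>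
  has integral zero.\<close>

lemma C1_is_weak_gradient:
  fixes u :: "'a::euclidean_space \<Rightarrow> real"
  assumes u: "\<And>x. (u has_derivative (\<lambda>v. g x \<bullet> v)) (at x)" and g: "continuous_on UNIV g"
  shows "is_weak_gradient u g"
  unfolding is_weak_gradient_def
proof (intro conjI ballI)
  have cu: "continuous_on UNIV u"
    using u has_derivative_continuous continuous_at_imp_continuous_on by blast
  show lu: "locally_integrable u" and lg: "locally_integrable g"
    using cu g by (auto intro: continuous_locally_integrable)
  fix \<phi> :: "'a \<Rightarrow> real" and b :: 'a
  assume \<phi>: "\<phi> \<in> Cc_infinity" and b: "b \<in> Basis"
  let ?d = "\<lambda>x. frechet_derivative \<phi> (at x) b"
  have cd: "continuous_on UNIV ?d" and c\<phi>: "continuous_on UNIV \<phi>"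
    using Cc_infinity_continuous_derivative[OF \<phi> b] Cc_infinity_continuous[OF \<phi>] by simp_all
  obtain R where R: "\<And>x. norm x > R \<Longrightarrow> \<phi> x = 0" "\<And>x. norm x > R \<Longrightarrow> ?d x = 0"
    using Cc_infinity_support[OF \<phi>] by metis
  obtain B where B: "\<And>x. \<bar>\<phi> x\<bar> \<le> B" using continuous_compact_support_bounded[OF c\<phi> R(1)] by metis
  obtain B' where B': "\<And>x. \<bar>?d x\<bar> \<le> B'" using continuous_compact_support_bounded[OF cd R(2)] by metis
  have "((\<lambda>t. u (x + t *\<^sub>R b) * \<phi> (x + t *\<^sub>R b)) has_real_derivative u x * ?d x + (g x \<bullet> b) * \<phi> x) (at 0)" for x
    using has_derivative_line[of u _ x 0 b, OF u] Cc_infinity_line[OF \<phi>, of x b 0]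
    by (auto simp: has_real_derivative_iff_has_vector_derivative[symmetric] intro!: derivative_eq_intros)
  then have "(\<integral>x. u x * ?d x + (g x \<bullet> b) * \<phi> x \<partial>lborel) = 0"
    by (rule integral_directional_derivative_eq_0)
      (use R b cu g c\<phi> cd in \<open>auto intro!: continuous_intros\<close>)
  moreover have "integrable lborel (\<lambda>x. u x * ?d x)"
    by (rule locally_integrable_mult[OF lu _ B' R(2)]) (use cd in \<open>auto intro: borel_measurable_continuous_onI\<close>)
  moreover have "integrable lborel (\<lambda>x. (g x \<bullet> b) * \<phi> x)"
    by (rule locally_integrable_mult[OF locally_integrable_inner[OF lg] _ B R(1)])
      (use c\<phi> in \<open>auto intro: borel_measurable_continuous_onI\<close>)
  ultimately show "(\<integral>x. u x * ?d x \<partial>lborel) = - (\<integral>x. (g x \<bullet> b) * \<phi> x \<partial>lborel)"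
    by (simp add: eq_neg_iff_add_eq_0)
qed

section \<open>Radial weights supported in an annulus\<close>

text \<open>At \<open>s = 0\<close> the quotient is locally constant, and the formula for its
  derivative agrees because division by zero gives \<open>0\<close>. Hence no case distinction is
  needed when the lemma is applied twice in a row.\<close>

lemma DERIV_divide_vanishing_near_0:
  fixes W W' :: "real \<Rightarrow> real"
  assumes W: "\<And>s. (W has_real_derivative W' s) (at s)" and a: "0 < a" "\<And>s. s < a \<Longrightarrow> W s = 0"
  shows "((\<lambda>s. W s / s) has_real_derivative W' s / s - W s / s\<^sup>2) (at s)"
proof (cases "s = 0")
  case True
  have "((\<lambda>_. 0::real) has_real_derivative 0) (at s)" by simp
  then have "((\<lambda>s. W s / s) has_real_derivative 0) (at s)"
    by (rule DERIV_cong_ev[THEN iffD1, rotated -1])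
      (use a True in \<open>auto intro!: eventually_nhds_metric[THEN iffD2] exI[of _ a] simp: dist_real_def\<close>)
  then show ?thesis using True by simp
next
  case False
  then show ?thesis
    by (auto intro!: derivative_eq_intros W simp: field_simps power2_eq_square)
qed

lemma continuous_interval_support_bounded:
  fixes F :: "real \<Rightarrow> real"
  assumes "continuous_on {a..r} F" "\<And>s. s \<notin> {a..r} \<Longrightarrow> F s = 0"
  obtains B where "0 \<le> B" "\<And>s. \<bar>F s\<bar> \<le> B"
proof -
  have "compact (F ` {a..r})" using assms(1) by (intro compact_continuous_image) auto
  then obtain B where "B > 0" "\<And>y. y \<in> F ` {a..r} \<Longrightarrow> norm y \<le> B"
    using compact_imp_bounded bounded_pos by metis
  then have "\<bar>F s\<bar> \<le> B" for s using assms(2)[of s] by (cases "s \<in> {a..r}") auto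
  then show ?thesis using that[of B] \<open>B > 0\<close> by auto
qed

text \<open>This is the sum over the coordinate directions of the one-directional inequality, with
  the field \<open>k x / |x|^2\<close> and the weight \<open>W (x \<bullet> x)\<close>. Since
  \<open>W\<close> vanishes near the origin, the singular field is multiplied into bounded Lipschitz
  functions, and integrability of \<open>u^2\<close> and \<open>|g|^2\<close> on a slightly larger
  annulus suffices.\<close>

lemma radial_weight_inequality:
  fixes u \<theta> :: "'a::euclidean_space \<Rightarrow> real" and W W' :: "real \<Rightarrow> real"
  assumes ug: "is_weak_gradient u g"
    and \<theta>: "\<theta> \<in> Cc_infinity" "\<And>x. 0 \<le> \<theta> x" "(\<integral>x. \<theta> x \<partial>lborel) > 0"
    and W: "\<And>s. (W has_real_derivative W' s) (at s)" "\<And>s. 0 \<le> W s"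
    and W': "continuous_on {a\<^sup>2..r\<^sup>2} W'" "W' \<in> borel_measurable borel"
    and supp: "\<And>s. s \<notin> {a\<^sup>2..r\<^sup>2} \<Longrightarrow> W s = 0" "\<And>s. s \<notin> {a\<^sup>2..r\<^sup>2} \<Longrightarrow> W' s = 0"
    and a: "0 < a" and r: "0 < r" "r < r'"
    and u2: "integrable lborel (\<lambda>x. indicator {x. a / 2 \<le> norm x \<and> norm x \<le> r'} x * (u x)\<^sup>2)"
    and g2: "integrable lborel (\<lambda>x. indicator {x. a / 2 \<le> norm x \<and> norm x \<le> r'} x * (norm (g x))\<^sup>2)"
    and k: "k = (real DIM('a) - 2) / 2"
  shows "integrable lborel (\<lambda>x. (u x)\<^sup>2 * (2 * k * W' (x \<bullet> x) + k\<^sup>2 * (W (x \<bullet> x) / (x \<bullet> x))))"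
    and "(\<integral>x. (u x)\<^sup>2 * (2 * k * W' (x \<bullet> x) + k\<^sup>2 * (W (x \<bullet> x) / (x \<bullet> x))) \<partial>lborel)
      \<le> (\<integral>x. (norm (g x))\<^sup>2 * W (x \<bullet> x) \<partial>lborel)"
    and "integrable lborel (\<lambda>x. (norm (g x))\<^sup>2 * W (x \<bullet> x))"
proof -
  define K where "K = {x::'a. a \<le> norm x \<and> norm x \<le> r}"
  define K' where "K' = {x::'a. a / 2 \<le> norm x \<and> norm x \<le> r'}"
  have [measurable]: "K' \<in> sets borel" unfolding K'_def by measurable
  have g_meas [measurable]: "g \<in> borel_measurable borel"
    using ug by (auto simp: is_weak_gradient_def intro: locally_integrable_measurable)
  have u_meas [measurable]: "u \<in> borel_measurable borel"
    using ug by (auto simp: is_weak_gradient_def intro: locally_integrable_measurable)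
  have K_iff: "x \<in> K \<longleftrightarrow> x \<bullet> x \<in> {a\<^sup>2..r\<^sup>2}" for x
    using a r by (simp add: K_def power2_norm_eq_inner[symmetric] abs_le_square_iff[symmetric])
  define h0 where "h0 = min (a / 2) (r' - r)"
  have h0: "h0 > 0" using a r by (simp add: h0_def)
  have K': "y \<in> K'" if "x \<in> K" "dist x y \<le> h0" for x y
    using that norm_triangle_ineq2[of x y] norm_triangle_ineq2[of y x]
    by (auto simp: K_def K'_def h0_def dist_norm norm_minus_commute)
  define A where "A = (\<lambda>s. W s / s)"
  define A' where "A' = (\<lambda>s. W' s / s - W s / s\<^sup>2)"
  define Q where "Q = (\<lambda>s. A s / s)"
  define Q' where "Q' = (\<lambda>s. A' s / s - A s / s\<^sup>2)"
  have below: "s \<notin> {a\<^sup>2..r\<^sup>2}" if "s < a\<^sup>2" for s using that by simp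
  have A: "(A has_real_derivative A' s) (at s)" for s
    unfolding A_def A'_def using supp below a
    by (intro DERIV_divide_vanishing_near_0[where a="a\<^sup>2"] W) auto
  have Q: "(Q has_real_derivative Q' s) (at s)" for s
    unfolding Q_def Q'_def using supp below a
    by (intro DERIV_divide_vanishing_near_0[where a="a\<^sup>2"] A) (auto simp: A_def)
  have cW: "continuous_on S W" for S
    using W(1) by (meson DERIV_continuous continuous_at_imp_continuous_on)
  have cA: "continuous_on S A" for S
    using A by (meson DERIV_continuous continuous_at_imp_continuous_on)
  have cQ: "continuous_on S Q" for S
    using Q by (meson DERIV_continuous continuous_at_imp_continuous_on)
  have cA': "continuous_on {a\<^sup>2..r\<^sup>2} A'" unfolding A'_def
    using a by (auto intro!: continuous_intros cW W')
  have cQ': "continuous_on {a\<^sup>2..r\<^sup>2} Q'" unfolding Q'_def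
    using a by (auto intro!: continuous_intros cA cA')
  have [measurable]: "W \<in> borel_measurable borel" "A \<in> borel_measurable borel" "Q \<in> borel_measurable borel"
    using cW cA cQ by (auto intro: borel_measurable_continuous_onI)
  have [measurable]: "W' \<in> borel_measurable borel" by fact
  have [measurable]: "A' \<in> borel_measurable borel" unfolding A'_def by measurable
  have suppA: "A s = 0" "A' s = 0" "Q s = 0" "Q' s = 0" if "s \<notin> {a\<^sup>2..r\<^sup>2}" for s
    using supp[OF that] by (auto simp: A_def A'_def Q_def Q'_def)
  obtain BW where BW: "0 \<le> BW" "\<And>s. \<bar>W s\<bar> \<le> BW"
    using continuous_interval_support_bounded[OF cW supp(1)] by metis
  obtain BW' where BW': "0 \<le> BW'" "\<And>s. \<bar>W' s\<bar> \<le> BW'"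
    using continuous_interval_support_bounded[OF W'(1) supp(2)] by metis
  obtain BA where BA: "0 \<le> BA" "\<And>s. \<bar>A s\<bar> \<le> BA"
    using continuous_interval_support_bounded[OF cA suppA(1)] by metis
  obtain BA' where BA': "0 \<le> BA'" "\<And>s. \<bar>A' s\<bar> \<le> BA'"
    using continuous_interval_support_bounded[OF cA' suppA(2)] by metis
  obtain BQ where BQ: "0 \<le> BQ" "\<And>s. \<bar>Q s\<bar> \<le> BQ"
    using continuous_interval_support_bounded[OF cQ suppA(3)] by metis
  obtain BQ' where BQ': "0 \<le> BQ'" "\<And>s. \<bar>Q' s\<bar> \<le> BQ'"
    using continuous_interval_support_bounded[OF cQ' suppA(4)] by metis
  have square: "((\<lambda>t. (x + t *\<^sub>R b) \<bullet> (x + t *\<^sub>R b)) has_real_derivative 2 * (x \<bullet> b)) (at 0)" for x b :: 'a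
    by (auto intro!: derivative_eq_intros simp: inner_commute has_real_derivative_iff_has_vector_derivative
        has_vector_derivative_def algebra_simps)
  have radial: "((\<lambda>t. F ((x + t *\<^sub>R b) \<bullet> (x + t *\<^sub>R b))) has_real_derivative F' (x \<bullet> x) * (2 * (x \<bullet> b))) (at 0)"
    if "\<And>s. (F has_real_derivative F' s) (at s)" for F F' and x b :: 'a
    using DERIV_chain2[of F "F' (x \<bullet> x)" "\<lambda>t. (x + t *\<^sub>R b) \<bullet> (x + t *\<^sub>R b)" 0, OF _ square] that
    by simp
  have lin: "((\<lambda>t. (x + t *\<^sub>R b) \<bullet> b) has_real_derivative 1) (at 0)" if "b \<in> Basis" for x b :: 'a
    using that by (auto intro!: derivative_eq_intros simp: inner_commute has_real_derivative_iff_has_vector_derivative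
        has_vector_derivative_def algebra_simps inner_Basis)
  have rbound: "\<bar>F (x \<bullet> x) * (x \<bullet> b) ^ j\<bar> \<le> BF * r ^ j"
    if "b \<in> Basis" "0 \<le> BF" "\<And>s. \<bar>F s\<bar> \<le> BF" "\<And>s. s \<notin> {a\<^sup>2..r\<^sup>2} \<Longrightarrow> F s = 0" for F BF j and x b :: 'a
  proof (cases "x \<in> K")
    case True
    then have "\<bar>x \<bullet> b\<bar> \<le> r" using Basis_le_norm[OF that(1), of x] by (simp add: K_def)
    then have "\<bar>x \<bullet> b\<bar> ^ j \<le> r ^ j" by (intro power_mono) auto
    then show ?thesis using that by (simp add: abs_mult power_abs mult_mono)
  next
    case False
    then show ?thesis using that r by (simp add: K_iff)
  qed
  \<comment> \<open>With \<open>h_b = k (x \<bullet> b) / |x|^2\<close> one has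
    \<open>\<Phi> b = w h_b\<close> and \<open>q b = w h_b^2\<close>, so the condition
    \<open>\<Phi>^2 \<le> q w\<close> holds with equality. The functions \<open>dw\<close>,
    \<open>d\<close>, \<open>dq\<close> are the derivatives in direction \<open>b\<close>; only
    their boundedness matters for \<open>w\<close> and \<open>q\<close>.\<close>
  define w where "w = (\<lambda>x::'a. W (x \<bullet> x))"
  define \<Phi> where "\<Phi> = (\<lambda>b x::'a. k * (A (x \<bullet> x) * (x \<bullet> b)))"
  define q where "q = (\<lambda>b x::'a. k\<^sup>2 * (Q (x \<bullet> x) * (x \<bullet> b)\<^sup>2))"
  define dw where "dw = (\<lambda>b x::'a. W' (x \<bullet> x) * (2 * (x \<bullet> b)))"
  define d where "d = (\<lambda>b x::'a. k * (A' (x \<bullet> x) * (2 * (x \<bullet> b)\<^sup>2) + A (x \<bullet> x)))"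
  define dq where "dq = (\<lambda>b x::'a. k\<^sup>2 * (Q' (x \<bullet> x) * (2 * (x \<bullet> b) ^ 3) + Q (x \<bullet> x) * (2 * (x \<bullet> b))))"
  have der: "((\<lambda>t. w (x + t *\<^sub>R b)) has_real_derivative dw b x) (at 0)"
    "((\<lambda>t. \<Phi> b (x + t *\<^sub>R b)) has_real_derivative d b x) (at 0)"
    "((\<lambda>t. q b (x + t *\<^sub>R b)) has_real_derivative dq b x) (at 0)" if "b \<in> Basis" for x b
  proof -
    have rA: "((\<lambda>t. A ((x + t *\<^sub>R b) \<bullet> (x + t *\<^sub>R b))) has_real_derivative A' (x \<bullet> x) * (2 * (x \<bullet> b))) (at 0)"
      by (rule radial[OF A])
    have rQ: "((\<lambda>t. Q ((x + t *\<^sub>R b) \<bullet> (x + t *\<^sub>R b))) has_real_derivative Q' (x \<bullet> x) * (2 * (x \<bullet> b))) (at 0)"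
      by (rule radial[OF Q])
    have rl: "((\<lambda>t. (x + t *\<^sub>R b) \<bullet> b) has_real_derivative 1) (at 0)"
      by (rule lin[OF that])
    show "((\<lambda>t. w (x + t *\<^sub>R b)) has_real_derivative dw b x) (at 0)"
      unfolding w_def dw_def by (rule radial[OF W(1)])
    show "((\<lambda>t. \<Phi> b (x + t *\<^sub>R b)) has_real_derivative d b x) (at 0)"
      using DERIV_cmult[OF DERIV_mult[OF rA rl], of k]
      unfolding \<Phi>_def by (rule DERIV_cong) (simp add: d_def power2_eq_square)
    show "((\<lambda>t. q b (x + t *\<^sub>R b)) has_real_derivative dq b x) (at 0)"
      using DERIV_cmult[OF DERIV_mult[OF rQ DERIV_power[OF rl, of 2]], of "k\<^sup>2"]
      unfolding q_def by (rule DERIV_cong) (simp add: dq_def power2_eq_square power3_eq_cube)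
  qed
  define L where "L = max (2 * (BW' * r)) (max (\<bar>k\<bar> * (2 * (BA' * r\<^sup>2) + BA)) (k\<^sup>2 * (2 * (BQ' * r ^ 3) + 2 * (BQ * r))))"
  have dbound: "\<bar>dw b x\<bar> \<le> L" "\<bar>d b x\<bar> \<le> L" "\<bar>dq b x\<bar> \<le> L" if b: "b \<in> Basis" for b x
  proof -
    have "\<bar>dw b x\<bar> \<le> 2 * (BW' * r)"
      using rbound[where F=W' and x=x and j=1, OF b BW' supp(2)] by (simp add: dw_def abs_mult)
    moreover have "\<bar>d b x\<bar> \<le> \<bar>k\<bar> * (2 * (BA' * r\<^sup>2) + BA)"
      unfolding d_def abs_mult[of k]
      using rbound[where F=A' and x=x and j=2, OF b BA' suppA(2)] rbound[where F=A and x=x and j=0, OF b BA suppA(1)]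
      by (intro mult_left_mono order_trans[OF abs_triangle_ineq]) (auto simp: abs_mult)
    moreover have "\<bar>dq b x\<bar> \<le> k\<^sup>2 * (2 * (BQ' * r ^ 3) + 2 * (BQ * r))"
      unfolding dq_def abs_mult[of "k\<^sup>2"] abs_power2
      using rbound[where F=Q' and x=x and j=3, OF b BQ' suppA(4)] rbound[where F=Q and x=x and j=1, OF b BQ suppA(3)]
      by (intro mult_left_mono order_trans[OF abs_triangle_ineq]) (auto simp: abs_mult)
    ultimately show "\<bar>dw b x\<bar> \<le> L" "\<bar>d b x\<bar> \<le> L" "\<bar>dq b x\<bar> \<le> L" by (auto simp: L_def)
  qed
  define B where "B = max BW (max (\<bar>k\<bar> * (BA * r)) (k\<^sup>2 * (BQ * r\<^sup>2)))"
  have bound: "\<bar>w x\<bar> \<le> B" "\<bar>\<Phi> b x\<bar> \<le> B" "\<bar>q b x\<bar> \<le> B" if b: "b \<in> Basis" for b x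
  proof -
    have "\<bar>\<Phi> b x\<bar> \<le> \<bar>k\<bar> * (BA * r)"
      using mult_left_mono[OF rbound[where F=A and x=x and j=1, OF b BA suppA(1)], of "\<bar>k\<bar>"] by (simp add: \<Phi>_def abs_mult)
    moreover have "\<bar>q b x\<bar> \<le> k\<^sup>2 * (BQ * r\<^sup>2)"
      using mult_left_mono[OF rbound[where F=Q and x=x and j=2, OF b BQ suppA(3)], of "k\<^sup>2"] by (simp add: q_def abs_mult)
    ultimately show "\<bar>w x\<bar> \<le> B" "\<bar>\<Phi> b x\<bar> \<le> B" "\<bar>q b x\<bar> \<le> B"
      using BW(2)[of "x \<bullet> x"] by (auto simp: B_def w_def)
  qed
  have Q_nonneg: "0 \<le> Q s" for s
    using W(2)[of s] by (simp add: Q_def A_def divide_divide_eq_left zero_le_divide_iff)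
  have w_meas: "w \<in> borel_measurable borel" unfolding w_def by measurable
  have meas: "\<Phi> b \<in> borel_measurable borel" "q b \<in> borel_measurable borel" "d b \<in> borel_measurable borel" for b
    unfolding \<Phi>_def q_def d_def by measurable
  have vanish: "w x = 0" "\<Phi> b x = 0" "q b x = 0" if "x \<notin> K" for b x
    using that supp suppA by (auto simp: K_iff w_def \<Phi>_def q_def)
  have g2b: "integrable lborel (\<lambda>x. indicator K' x * (g x \<bullet> b)\<^sup>2)" if b: "b \<in> Basis" for b
  proof (rule Bochner_Integration.integrable_bound[OF g2[folded K'_def]])
    show "(\<lambda>x. indicator K' x * (g x \<bullet> b)\<^sup>2) \<in> borel_measurable lborel" by measurable
    have "(g x \<bullet> b)\<^sup>2 \<le> (norm (g x))\<^sup>2" for x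
      using Basis_le_norm[OF b, of "g x"] by (simp add: abs_le_square_iff[symmetric])
    then show "AE x in lborel. norm (indicator K' x * (g x \<bullet> b)\<^sup>2) \<le> norm (indicator K' x * (norm (g x))\<^sup>2)"
      by (auto intro!: mult_left_mono)
  qed
  have young: "(\<Phi> b x)\<^sup>2 \<le> q b x * w x" for b x
  proof -
    have "(\<Phi> b x)\<^sup>2 = q b x * w x"
      by (simp add: \<Phi>_def q_def w_def Q_def A_def power_mult_distrib power_divide) (simp add: power2_eq_square)
    then show ?thesis by simp
  qed
  have nonneg: "0 \<le> w x" "0 \<le> q b x" for b x
    using W(2) Q_nonneg by (auto simp: w_def q_def)
  have *: "integrable lborel (\<lambda>x. (u x)\<^sup>2 * d b x) \<and>
      (\<integral>x. (u x)\<^sup>2 * d b x \<partial>lborel) - (\<integral>x. (u x)\<^sup>2 * q b x \<partial>lborel) \<le> (\<integral>x. (g x \<bullet> b)\<^sup>2 * w x \<partial>lborel)"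
    if b: "b \<in> Basis" for b
  proof -
    note lip = directional_derivative_bound[OF der(1)[OF b] dbound(1)[OF b]]
      directional_derivative_bound[OF der(2)[OF b] dbound(2)[OF b]]
      directional_derivative_bound[OF der(3)[OF b] dbound(3)[OF b]]
    note ineq = weak_gradient_vector_field_inequality[where w=w and \<Phi>="\<Phi> b" and q="q b" and d="d b"
        and K=K and K'=K' and ?h0.0=h0 and L=L and B=B, OF ug b \<theta> w_meas meas \<open>K' \<in> sets borel\<close>
        vanish h0 K' u2[folded K'_def] g2b[OF b] lip nonneg young der(2)[OF b] bound[OF b]]
    show ?thesis by (rule conjI[OF ineq])
  qed
  have KK': "x \<in> K'" if "x \<in> K" for x using K'[OF that, of x] h0 by simp
  have supp_int: "integrable lborel (\<lambda>x. v x * f x)"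
    if [measurable]: "f \<in> borel_measurable borel" "v \<in> borel_measurable borel"
      and v: "integrable lborel (\<lambda>x. indicator K' x * v x)"
      and fK: "\<And>x. x \<notin> K \<Longrightarrow> f x = 0" and f: "\<And>x. \<bar>f x\<bar> \<le> B" for f v :: "'a \<Rightarrow> real" and B
  proof (rule Bochner_Integration.integrable_bound[OF integrable_mult_right[OF v, of B]])
    have "\<bar>v x * f x\<bar> \<le> \<bar>B * (indicator K' x * v x)\<bar>" for x
    proof (cases "x \<in> K")
      case True
      have "\<bar>f x\<bar> \<le> \<bar>B\<bar>" using f[of x] by linarith
      then have "\<bar>v x\<bar> * \<bar>f x\<bar> \<le> \<bar>v x\<bar> * \<bar>B\<bar>" by (rule mult_left_mono) simp
      then show ?thesis using KK'[OF True] by (simp add: abs_mult mult.commute)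
    qed (simp add: fK)
    then show "AE x in lborel. norm (v x * f x) \<le> norm (B * (indicator K' x * v x))" by simp
  qed measurable
  have uq: "integrable lborel (\<lambda>x. (u x)\<^sup>2 * q b x)" if b: "b \<in> Basis" for b
    by (rule supp_int[OF _ _ u2[folded K'_def]]) (use vanish bound[OF b] meas in auto)
  have gw: "integrable lborel (\<lambda>x. (g x \<bullet> b)\<^sup>2 * w x)" if b: "b \<in> Basis" for b
    by (rule supp_int[OF _ _ g2b[OF b]]) (use vanish bound[OF b] w_meas in auto)
  have sq: "(\<Sum>b\<in>Basis. (x \<bullet> b)\<^sup>2) = x \<bullet> x" for x :: 'a
    by (simp add: power2_eq_square euclidean_inner[symmetric])
  \<comment> \<open>With \<open>s = x \<bullet> x\<close>, the divergence of the weighted field is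
    \<open>k (2 s A' + N A)\<close>, where \<open>s A' = W' - W / s\<close> and
    \<open>A = W / s\<close>; the sum of the \<open>q b\<close> is \<open>k^2 W / s\<close>.\<close>
  have sd: "(\<Sum>b\<in>Basis. (u x)\<^sup>2 * d b x - (u x)\<^sup>2 * q b x)
      = (u x)\<^sup>2 * (2 * k * W' (x \<bullet> x) + k\<^sup>2 * (W (x \<bullet> x) / (x \<bullet> x)))" for x
  proof (cases "x = 0")
    case True
    then show ?thesis using supp(2)[of 0] suppA[of 0] a by (simp add: d_def q_def)
  next
    case False
    then have s: "x \<bullet> x \<noteq> 0" by simp
    have "(\<Sum>b\<in>Basis. (u x)\<^sup>2 * d b x - (u x)\<^sup>2 * q b x)
      = (u x)\<^sup>2 * (k * (A' (x \<bullet> x) * (2 * (\<Sum>b\<in>Basis. (x \<bullet> b)\<^sup>2)) + real DIM('a) * A (x \<bullet> x))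
         - k\<^sup>2 * (Q (x \<bullet> x) * (\<Sum>b\<in>Basis. (x \<bullet> b)\<^sup>2)))"
      by (simp add: d_def q_def sum.distrib sum_subtractf sum_distrib_left[symmetric] right_diff_distrib[symmetric])
    also have "\<dots> = (u x)\<^sup>2 * (2 * k * W' (x \<bullet> x) + (k * (real DIM('a) - 2) - k\<^sup>2) * (W (x \<bullet> x) / (x \<bullet> x)))"
      unfolding sq A'_def Q_def A_def using s by (simp add: field_simps power2_eq_square)
    \<comment> \<open>Here the value of \<open>k\<close> enters:
      \<open>k (N - 2) = 2 k^2\<close>.\<close>
    also have "k * (real DIM('a) - 2) - k\<^sup>2 = k\<^sup>2" by (simp add: k power2_eq_square)
    finally show ?thesis .
  qed
  have sg: "(\<Sum>b\<in>Basis. (g x \<bullet> b)\<^sup>2 * w x) = (norm (g x))\<^sup>2 * W (x \<bullet> x)" for x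
    by (simp add: sum_distrib_right[symmetric] sq power2_norm_eq_inner w_def)
  show "integrable lborel (\<lambda>x. (u x)\<^sup>2 * (2 * k * W' (x \<bullet> x) + k\<^sup>2 * (W (x \<bullet> x) / (x \<bullet> x))))"
    unfolding sd[symmetric] using * uq by (intro Bochner_Integration.integrable_sum) auto
  show "integrable lborel (\<lambda>x. (norm (g x))\<^sup>2 * W (x \<bullet> x))"
    unfolding sg[symmetric] using gw by (intro Bochner_Integration.integrable_sum) auto
  have "(\<Sum>b\<in>Basis. \<integral>x. (u x)\<^sup>2 * d b x - (u x)\<^sup>2 * q b x \<partial>lborel) \<le> (\<Sum>b\<in>Basis. \<integral>x. (g x \<bullet> b)\<^sup>2 * w x \<partial>lborel)"
    using * uq by (intro sum_mono) simp
  also have "(\<Sum>b\<in>Basis. \<integral>x. (u x)\<^sup>2 * d b x - (u x)\<^sup>2 * q b x \<partial>lborel)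
     = (\<integral>x. (\<Sum>b\<in>Basis. (u x)\<^sup>2 * d b x - (u x)\<^sup>2 * q b x) \<partial>lborel)"
    using * uq by (intro Bochner_Integration.integral_sum[symmetric]) auto
  also have "(\<Sum>b\<in>Basis. \<integral>x. (g x \<bullet> b)\<^sup>2 * w x \<partial>lborel) = (\<integral>x. (\<Sum>b\<in>Basis. (g x \<bullet> b)\<^sup>2 * w x) \<partial>lborel)"
    using gw by (intro Bochner_Integration.integral_sum[symmetric]) auto
  finally show "(\<integral>x. (u x)\<^sup>2 * (2 * k * W' (x \<bullet> x) + k\<^sup>2 * (W (x \<bullet> x) / (x \<bullet> x))) \<partial>lborel)
      \<le> (\<integral>x. (norm (g x))\<^sup>2 * W (x \<bullet> x) \<partial>lborel)"
    by (simp add: sd sg)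
qed


section \<open>The Hardy inequality\<close>

text \<open>Squaring the positive part gives cutoffs that are differentiable also at the edge of
  their support.\<close>

lemma DERIV_pos_part_square:
  "((\<lambda>y::real. (max 0 y)\<^sup>2) has_real_derivative 2 * max 0 y) (at y)"
proof (cases "y = 0")
  case True
  have "((\<lambda>h::real. ((max 0 h)\<^sup>2) / h) \<longlongrightarrow> 0) (at 0)"
  proof (rule Lim_null_comparison)
    show "\<forall>\<^sub>F h in at (0::real). norm ((max 0 h)\<^sup>2 / h) \<le> \<bar>h\<bar>"
      by (auto simp: eventually_at_filter max_def power2_eq_square)
    show "((\<lambda>h::real. \<bar>h\<bar>) \<longlongrightarrow> 0) (at 0)" by (auto intro!: tendsto_eq_intros)
  qed
  then show ?thesis using True by (simp add: has_field_derivative_iff)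
next
  case False
  show ?thesis
  proof (cases "y > 0")
    case True
    have "((\<lambda>y::real. y\<^sup>2) has_real_derivative 2 * y) (at y)" by (auto intro!: derivative_eq_intros)
    moreover have "\<forall>\<^sub>F z in nhds y. z\<^sup>2 = (max 0 z)\<^sup>2"
      using eventually_nhds_in_open[of "{0<..}" y] True by (auto elim!: eventually_mono)
    ultimately show ?thesis
      using True DERIV_cong_ev[of y y "\<lambda>z. z\<^sup>2" "\<lambda>z. (max 0 z)\<^sup>2" "2 * y" "2 * max 0 y"] by simp
  next
    case neg: False
    have "((\<lambda>_::real. 0::real) has_real_derivative 0) (at y)" by simp
    moreover have "\<forall>\<^sub>F z in nhds y. 0 = (max 0 z)\<^sup>2"
      using eventually_nhds_in_open[of "{..<0}" y] neg False by (auto elim!: eventually_mono)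
    ultimately show ?thesis
      using neg False DERIV_cong_ev[of y y "\<lambda>_. 0" "\<lambda>z. (max 0 z)\<^sup>2" 0 "2 * max 0 y"] by simp
  qed
qed

text \<open>The error \<open>1 / s - (1 - s b)^2 / s = 2 b - s b^2\<close> is bounded, so removing
  the outer cutoff from the Hardy term costs only a multiple of the integral of
  \<open>u^2\<close>.\<close>

lemma inverse_le_square_cutoff:
  fixes s b :: real
  assumes "0 < s"
  shows "1 / s \<le> (1 - s * b)\<^sup>2 / s + 2 * b"
proof -
  have "(1 - s * b)\<^sup>2 / s + 2 * b = 1 / s + s * b\<^sup>2"
    using assms by (simp add: field_simps power2_eq_square)
  then show ?thesis using assms by simp
qed

text \<open>In the variable \<open>s = |x|\<^sup>2\<close>. The inner cutoff is increasing, so its derivative has the favourable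
  sign and leaves no trace as \<open>e\<close> tends to \<open>0\<close>; the outer one costs the term \<open>4 k / r\<^sup>2 * l s\<close>.\<close>

lemma log_weight:
  fixes e r \<alpha> k c :: real
  assumes e: "0 < e" "e < r" "r < 1" and k: "0 \<le> k"
    and c: "\<And>s. 0 < s \<Longrightarrow> s \<le> r\<^sup>2 \<Longrightarrow> k * \<alpha> / (- (ln s / 2)) \<le> k\<^sup>2 - c"
  defines "l \<equiv> \<lambda>s. (- (ln s / 2)) powr \<alpha>"
  defines "W \<equiv> \<lambda>s. (max 0 (s - e\<^sup>2))\<^sup>2 / s\<^sup>2 * (max 0 (1 - s / r\<^sup>2))\<^sup>2 * l s"
  obtains W' where "\<And>s. (W has_real_derivative W' s) (at s)" "continuous_on {e\<^sup>2..r\<^sup>2} W'"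
    "W' \<in> borel_measurable borel" "\<And>s. s \<notin> {e\<^sup>2..r\<^sup>2} \<Longrightarrow> W' s = 0"
    "\<And>s. s \<in> {e\<^sup>2..r\<^sup>2} \<Longrightarrow> c * (W s / s) \<le> 2 * k * W' s + k\<^sup>2 * (W s / s) + 4 * k / r\<^sup>2 * l s"
proof -
  \<comment> \<open>In the variable \<open>s = |x|^2\<close> the expression
    \<open>- (ln s / 2)\<close> is \<open>log (1 / |x|)\<close>, so \<open>l\<close> is the
    logarithmic weight and \<open>l'\<close> its derivative on \<open>0 < s < 1\<close>.\<close>
  define l' where "l' = (\<lambda>s. - (\<alpha> * (- (ln s / 2)) powr (\<alpha> - 1)) / (2 * s))"
  define A where "A = (\<lambda>s. (max 0 (s - e\<^sup>2))\<^sup>2 / s\<^sup>2)"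
  define A' where "A' = (\<lambda>s. (2 * max 0 (s - e\<^sup>2)) / s\<^sup>2 - 2 * (max 0 (s - e\<^sup>2))\<^sup>2 / s ^ 3)"
  define B where "B = (\<lambda>s. (max 0 (1 - s / r\<^sup>2))\<^sup>2)"
  define B' where "B' = (\<lambda>s. - (2 * max 0 (1 - s / r\<^sup>2) / r\<^sup>2))"
  define W' where "W' = (\<lambda>s. (A' s * B s + A s * B' s) * l s + A s * B s * l' s)"
  have r0: "0 < r" using e by simp
  have r2: "0 < e\<^sup>2" "e\<^sup>2 < r\<^sup>2" "r\<^sup>2 < 1"
    using e power_strict_mono[of e r 2] power_strict_mono[of r 1 2] by auto
  have W: "W s = A s * B s * l s" for s by (simp add: W_def A_def B_def)
  have dA: "(A has_real_derivative A' s) (at s)" if "0 < s" for s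
  proof -
    have 1: "((\<lambda>s. (max 0 (s - e\<^sup>2))\<^sup>2) has_real_derivative 2 * max 0 (s - e\<^sup>2) * 1) (at s)"
      by (rule DERIV_chain2[OF DERIV_pos_part_square]) (auto intro!: derivative_eq_intros)
    have 2: "((\<lambda>s. s\<^sup>2) has_real_derivative 2 * s) (at s)" by (auto intro!: derivative_eq_intros)
    show ?thesis unfolding A_def A'_def
      by (rule DERIV_cong[OF DERIV_divide[OF 1 2]])
        (use that in \<open>simp_all add: diff_divide_distrib power2_eq_square power3_eq_cube mult_ac\<close>)
  qed
  have dB: "(B has_real_derivative B' s) (at s)" for s
  proof -
    have "((\<lambda>s. (max 0 (1 - s / r\<^sup>2))\<^sup>2) has_real_derivative 2 * max 0 (1 - s / r\<^sup>2) * (- (1 / r\<^sup>2))) (at s)"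
    proof (rule DERIV_chain2[OF DERIV_pos_part_square])
      have "((\<lambda>s. 1 - s / r\<^sup>2) has_real_derivative 0 - 1 / r\<^sup>2) (at s)"
        by (intro DERIV_diff DERIV_const DERIV_cdivide DERIV_ident)
      then show "((\<lambda>s. 1 - s / r\<^sup>2) has_real_derivative - (1 / r\<^sup>2)) (at s)" by simp
    qed
    then show ?thesis by (simp add: B_def[abs_def] B'_def)
  qed
  have dl: "(l has_real_derivative l' s) (at s)" if "0 < s" "s < 1" for s
    unfolding l_def l'_def using that
    by (auto intro!: derivative_eq_intros simp: ln_less_zero powr_diff field_simps)
  have out: "W s = 0" "W' s = 0" if "s \<notin> {e\<^sup>2..r\<^sup>2}" for s
  proof -
    have "s < e\<^sup>2 \<or> s > r\<^sup>2" using that by auto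
    then show "W s = 0" "W' s = 0"
      using r0 by (auto simp: W W'_def A_def A'_def B_def B'_def max_def field_simps)
  qed
  show ?thesis
  proof (rule that)
    show "(W has_real_derivative W' s) (at s)" for s
    proof (cases "e\<^sup>2 \<le> s \<and> s \<le> r\<^sup>2")
      case True
      then have s: "0 < s" "s < 1" using r2 by linarith+
      have "((\<lambda>s. A s * B s * l s) has_real_derivative W' s) (at s)"
        by (rule DERIV_cong[OF DERIV_mult[OF DERIV_mult[OF dA[OF s(1)] dB] dl[OF s]]])
          (simp add: W'_def algebra_simps)
      then show ?thesis by (simp add: W[abs_def])
    next
      case False
      have "(W has_real_derivative 0) (at s)"
      proof (rule has_field_derivative_transform_within_open)
        show "((\<lambda>_. 0::real) has_real_derivative 0) (at s)" by simp
        show "open ({..<e\<^sup>2} \<union> {r\<^sup>2<..})" by auto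
        show "s \<in> {..<e\<^sup>2} \<union> {r\<^sup>2<..}" using False by auto
        show "0 = W x" if "x \<in> {..<e\<^sup>2} \<union> {r\<^sup>2<..}" for x
          using that out(1)[of x] by auto
      qed
      then show ?thesis using False by (simp add: out)
    qed
    show "continuous_on {e\<^sup>2..r\<^sup>2} W'"
    proof -
      let ?I = "{e\<^sup>2..r\<^sup>2}"
      have pos: "0 < s" "ln s < 0" "s \<noteq> 0" "s < 1" if "s \<in> ?I" for s
      proof -
        have "0 < s" "s < 1" using that r2 unfolding atLeastAtMost_iff by linarith+
        then show "0 < s" "ln s < 0" "s \<noteq> 0" "s < 1" by (simp_all add: ln_less_zero)
      qed
      have "continuous_on ?I A"
        by (intro continuous_at_imp_continuous_on ballI DERIV_isCont[OF dA]) (rule pos(1))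
      moreover have "continuous_on ?I B"
        by (intro continuous_at_imp_continuous_on ballI DERIV_isCont[OF dB])
      moreover have "continuous_on ?I l"
        by (intro continuous_at_imp_continuous_on ballI DERIV_isCont[OF dl]) (rule pos(1) pos(4), assumption)+
      moreover have ne: "\<forall>s\<in>?I. s ^ n \<noteq> 0" "\<forall>s\<in>?I. 2 * s \<noteq> 0" "\<forall>s\<in>?I. s \<noteq> 0" "\<forall>s\<in>?I. - (ln s / 2) \<noteq> 0" for n
        using pos(2,3) by fastforce+
      have "continuous_on ?I A'"
        unfolding A'_def
        by (intro continuous_on_diff continuous_on_divide continuous_on_mult continuous_on_power continuous_on_max
            continuous_on_id continuous_on_const ne)
      moreover have "continuous_on ?I B'"
        unfolding B'_def using r0
        by (intro continuous_on_diff continuous_on_divide continuous_on_mult continuous_on_max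
            continuous_on_minus continuous_on_id continuous_on_const) auto
      moreover have "continuous_on ?I (\<lambda>s. (- (ln s / 2)) powr (\<alpha> - 1))"
        by (intro continuous_on_powr continuous_on_minus continuous_on_divide continuous_on_ln
            continuous_on_id continuous_on_const ne) auto
      then have "continuous_on ?I l'"
        unfolding l'_def
        by (intro continuous_on_divide continuous_on_minus continuous_on_mult continuous_on_id continuous_on_const ne)
      ultimately show ?thesis
        unfolding W'_def by (intro continuous_on_add continuous_on_mult)
    qed
    show "W' \<in> borel_measurable borel"
      unfolding W'_def A_def A'_def B_def B'_def l_def l'_def by measurable
    show "W' s = 0" if "s \<notin> {e\<^sup>2..r\<^sup>2}" for s using out that by simp
    fix s assume s: "s \<in> {e\<^sup>2..r\<^sup>2}"
    then have s01: "0 < s" "s < 1" using r2 unfolding atLeastAtMost_iff by linarith+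
    define y where "y = s - e\<^sup>2"
    define z where "z = 1 - s / r\<^sup>2"
    have y: "0 \<le> y" "y \<le> s" and z: "0 \<le> z" "z \<le> 1"
    proof -
      have "s / r\<^sup>2 \<le> 1" "0 \<le> s / r\<^sup>2" using s s01(1) r0 by simp_all
      then show "0 \<le> y" "y \<le> s" "0 \<le> z" "z \<le> 1" using s by (simp_all add: y_def z_def)
    qed
    define \<Lambda> where "\<Lambda> = - (ln s / 2)"
    have \<Lambda>: "0 < \<Lambda>" using s01 by (simp add: \<Lambda>_def ln_less_zero)
    have As: "A s = y\<^sup>2 / s\<^sup>2" "A' s = 2 * y / s\<^sup>2 - 2 * y\<^sup>2 / s ^ 3" "B s = z\<^sup>2" "B' s = - (2 * z / r\<^sup>2)"
      using y z by (simp_all add: A_def A'_def B_def B'_def y_def z_def)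
    have l0: "0 < l s" using \<Lambda> by (simp add: l_def \<Lambda>_def)
    have ls': "l' s = - (\<alpha> * l s / (2 * s * \<Lambda>))"
    proof -
      have "l s = \<Lambda> powr \<alpha>" "l' s = - (\<alpha> * \<Lambda> powr (\<alpha> - 1)) / (2 * s)"
        by (simp_all add: l_def l'_def \<Lambda>_def)
      then show ?thesis using \<Lambda> by (simp add: powr_diff)
    qed
    have "A' s = 2 * y * (s - y) / s ^ 3"
      using s01 by (simp add: As field_simps power2_eq_square power3_eq_cube)
    then have A'0: "0 \<le> A' s" using y s01 by simp
    have A1: "0 \<le> A s" "A s \<le> 1" using y s01 by (auto simp: As power_mono)
    have B'1: "- (2 / r\<^sup>2) \<le> A s * B' s"
    proof -
      have "A s * (2 * z / r\<^sup>2) \<le> 1 * (2 * 1 / r\<^sup>2)"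
        using A1 z r0 by (intro mult_mono divide_right_mono) auto
      then show ?thesis by (simp add: As(4))
    qed
    have W0: "0 \<le> W s" using A1 l0 by (simp add: W As)
    \<comment> \<open>The term with \<open>A'\<close> is nonnegative and is dropped, the term with
      \<open>B'\<close> is at least \<open>- (2 / r^2) l\<close>, and the logarithmic derivative of
      \<open>l\<close> is \<open>- \<alpha> / (2 s \<Lambda>)\<close>. After multiplication by
      \<open>2 k\<close> the last one is the term that hypothesis \<open>c\<close> compares with
      \<open>k^2 - c\<close>.\<close>
    have "W' s \<ge> - (2 / r\<^sup>2) * l s + W s * (- (\<alpha> / (2 * s * \<Lambda>)))"
    proof -
      have "- (2 / r\<^sup>2) * l s \<le> (A' s * B s + A s * B' s) * l s"
        using A'0 B'1 l0 As(3) by (intro mult_right_mono) (auto intro: add_increasing)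
      moreover have "A s * B s * l' s = W s * (- (\<alpha> / (2 * s * \<Lambda>)))"
        unfolding W ls' by simp
      ultimately show ?thesis by (simp add: W'_def)
    qed
    then have "2 * k * W' s \<ge> 2 * k * (- (2 / r\<^sup>2) * l s + W s * (- (\<alpha> / (2 * s * \<Lambda>))))"
      using k by (intro mult_left_mono) auto
    moreover have "2 * k * (- (2 / r\<^sup>2) * l s + W s * (- (\<alpha> / (2 * s * \<Lambda>))))
        = - (4 * k / r\<^sup>2 * l s) - (k * \<alpha> / \<Lambda>) * (W s / s)"
      using s01 \<Lambda> by (simp add: field_simps)
    moreover have "(k * \<alpha> / \<Lambda>) * (W s / s) \<le> (k\<^sup>2 - c) * (W s / s)"
      using c[of s] s s01 W0 by (intro mult_right_mono) (auto simp: \<Lambda>_def)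
    moreover have "(k\<^sup>2 - c) * (W s / s) = k\<^sup>2 * (W s / s) - c * (W s / s)"
      by (rule left_diff_distrib)
    ultimately show "c * (W s / s) \<le> 2 * k * W' s + k\<^sup>2 * (W s / s) + 4 * k / r\<^sup>2 * l s" by linarith
  qed
qed


section \<open>The inequality for the logarithmic weight\<close>

text \<open>The two ranges of \<open>\<alpha>\<close> are treated together: the disjunction in the
  last hypothesis provides a radius below which
  \<open>k \<alpha> / log (1 / |x|) \<le> k^2 - c\<close>, and nothing else in the proof depends on
  the sign of \<open>\<alpha>\<close>.\<close>

lemma hardy_inequality_log_measure:
  fixes \<theta> :: "'a::euclidean_space \<Rightarrow> real" and \<alpha> c :: real
  assumes dim: "DIM('a) \<ge> 3" and \<theta>: "\<theta> \<in> Cc_infinity"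
    and \<theta>1: "\<And>x. 0 \<le> \<theta> x \<and> \<theta> x \<le> 1" and \<theta>2: "\<And>x. x \<in> ball 0 (1/2) \<Longrightarrow> \<theta> x = 1"
    and c: "0 \<le> c" "c \<le> c_zero DIM('a)" "\<alpha> \<le> 0 \<or> c < c_zero DIM('a)"
  shows "\<exists>C\<ge>0. hardy_inequality (log_measure \<theta> \<alpha>) c C"
proof -
  define k where "k = (real DIM('a) - 2) / 2"
  have k: "0 < k" using dim by (simp add: k_def)
  have cz: "c_zero DIM('a) = k\<^sup>2" by (simp add: c_zero_def k_def)
  obtain r where r: "0 < r" "r < 1 / 2"
    and rc: "\<And>s. 0 < s \<Longrightarrow> s \<le> r\<^sup>2 \<Longrightarrow> k * \<alpha> / (- (ln s / 2)) \<le> k\<^sup>2 - c"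
  proof (cases "\<alpha> \<le> 0")
    case True
    show ?thesis
    proof (rule that[of "1/4"])
      fix s :: real assume "0 < s" "s \<le> (1/4)\<^sup>2"
      then have "ln s < 0" by (simp add: power2_eq_square)
      moreover have "k * \<alpha> \<le> 0" using True k by (simp add: mult_le_0_iff)
      ultimately have "k * \<alpha> / (- (ln s / 2)) \<le> 0" by (intro divide_nonpos_pos) auto
      then show "k * \<alpha> / (- (ln s / 2)) \<le> k\<^sup>2 - c" using c cz by simp
    qed auto
  next
    case False
    \<comment> \<open>The requirement is \<open>log (1 / |x|) \<ge> E\<close>, which holds for
      \<open>|x| \<le> exp (- E)\<close>. The bound \<open>1/4\<close> keeps the ball inside the
      region where \<open>\<theta> = 1\<close>.\<close>
    define E where "E = k * \<alpha> / (k\<^sup>2 - c)"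
    have E: "0 < E" "0 < k\<^sup>2 - c" using False c cz k by (auto simp: E_def)
    define r where "r = min (1/4) (exp (- E))"
    have r0: "0 < r" by (simp add: r_def)
    show ?thesis
    proof (rule that[of r])
      fix s :: real assume s: "0 < s" "s \<le> r\<^sup>2"
      have "ln r \<le> ln (exp (- E))" using r0 by (subst ln_le_cancel_iff) (auto simp: r_def)
      moreover have "ln s \<le> ln (r\<^sup>2)" using s r0 by simp
      moreover have "ln (r\<^sup>2) = 2 * ln r" using r0 by (simp add: ln_realpow)
      ultimately have L: "E \<le> - (ln s / 2)" by simp
      have "k * \<alpha> = E * (k\<^sup>2 - c)" using E by (simp add: E_def)
      also have "\<dots> \<le> - (ln s / 2) * (k\<^sup>2 - c)" using E L by (intro mult_right_mono) auto
      finally show "k * \<alpha> / (- (ln s / 2)) \<le> k\<^sup>2 - c"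
        using L E by (simp add: pos_divide_le_eq mult.commute del: divide_minus_right minus_divide_right)
    qed (auto simp: r_def r0)
  qed
  define l where "l = (\<lambda>s. (- (ln s / 2)) powr \<alpha>)"
  define m where "m = (\<lambda>x::'a. \<theta> x * (ln (1 / norm x)) powr \<alpha>)"
  define M where "M = log_measure \<theta> \<alpha>"
  have [measurable]: "\<theta> \<in> borel_measurable borel"
    using Cc_infinity_continuous[OF \<theta>] by (rule borel_measurable_continuous_onI)
  have m_meas [measurable]: "m \<in> borel_measurable borel" unfolding m_def by measurable
  have M: "M = density lborel (\<lambda>x. ennreal (m x))" by (simp add: M_def m_def log_measure_def)
  have m0: "0 \<le> m x" for x using \<theta>1 by (simp add: m_def)
  have ml: "m x = l (x \<bullet> x)" if "x \<noteq> 0" "norm x < 1 / 2" for x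
  proof -
    have "ln (x \<bullet> x) = 2 * ln (norm x)"
      using that by (simp add: power2_norm_eq_inner[symmetric] ln_realpow)
    then show ?thesis using that \<theta>2[of x] by (simp add: m_def l_def ln_div)
  qed
  have l0: "0 \<le> l s" for s by (simp add: l_def)
  have [measurable]: "l \<in> borel_measurable borel" unfolding l_def by measurable
  have nnM: "(\<integral>\<^sup>+x. ennreal (f x) \<partial>M) = (\<integral>\<^sup>+x. ennreal (m x * f x) \<partial>lborel)"
    if "f \<in> borel_measurable borel" "\<And>x. 0 \<le> f x" for f
    using that m0 unfolding M by (subst nn_integral_density) (auto simp: ennreal_mult)
  have \<Theta>: "(\<integral>x. \<theta> x \<partial>lborel) > 0"
  proof -
    obtain R where R: "\<And>x. norm x > R \<Longrightarrow> \<theta> x = 0" using Cc_infinity_support[OF \<theta>] by metis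
    have "integrable lborel (\<lambda>x. 1 * \<theta> x)"
      using \<theta>1 R by (intro locally_integrable_mult[where B=1 and R=R] continuous_locally_integrable) auto
    then have i: "integrable lborel \<theta>" by simp
    have "0 < measure lborel (ball (0::'a) (1/2))" by (simp add: content_ball_pos)
    also have "\<dots> = (\<integral>x. indicator (ball (0::'a) (1/2)) x \<partial>lborel)" by simp
    also have "\<dots> \<le> (\<integral>x. \<theta> x \<partial>lborel)"
    proof (rule integral_mono[OF _ i])
      show "integrable lborel (indicator (ball (0::'a) (1/2)) :: 'a \<Rightarrow> real)"
        using emeasure_bounded_finite[OF bounded_ball[of "0::'a" "1/2"]] by (intro integrable_real_indicator) auto
      show "indicator (ball 0 (1/2)) x \<le> \<theta> x" for x
        using \<theta>1[of x] \<theta>2[of x] by (auto simp: indicator_def)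
    qed
    finally show ?thesis .
  qed
  \<comment> \<open>The first summand is the cost of the derivative of the outer cutoff, the second
    the cost of removing that cutoff from the Hardy term.\<close>
  define C where "C = 4 * k / r\<^sup>2 + 2 * c / r\<^sup>2"
  have C: "0 \<le> C" using c k by (simp add: C_def)
  have "hardy_inequality M c C"
    unfolding hardy_inequality_def
  proof (intro ballI allI impI)
    fix u g assume u: "u \<in> H1 M" and ug: "is_weak_gradient u g"
    have [measurable]: "u \<in> borel_measurable borel" "g \<in> borel_measurable borel"
      using ug by (auto simp: is_weak_gradient_def intro: locally_integrable_measurable)
    have u2: "integrable M (\<lambda>x. (u x)\<^sup>2)" using u by (auto simp: H1_def L2_def)
    show "ennreal c * (\<integral>\<^sup>+x. ennreal ((u x)\<^sup>2 / (norm x)\<^sup>2) \<partial>M)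
        \<le> (\<integral>\<^sup>+x. ennreal ((norm (g x))\<^sup>2) \<partial>M) + ennreal C * (\<integral>\<^sup>+x. ennreal ((u x)\<^sup>2) \<partial>M)"
    \<comment> \<open>The inequality concerns every weak gradient \<open>g\<close>. Splitting on
      whether its energy is finite avoids comparing \<open>g\<close> with the square integrable
      gradient contained in \<open>H1\<close>.\<close>
    proof (cases "(\<integral>\<^sup>+x. ennreal ((norm (g x))\<^sup>2) \<partial>M) = \<infinity>")
      case False
      define Ig where "Ig = (\<integral>\<^sup>+x. ennreal ((norm (g x))\<^sup>2) \<partial>M)"
      define Iu where "Iu = (\<integral>\<^sup>+x. ennreal ((u x)\<^sup>2) \<partial>M)"
      have Ig: "Ig = (\<integral>\<^sup>+x. ennreal (m x * (norm (g x))\<^sup>2) \<partial>lborel)" "Ig < \<infinity>"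
        unfolding Ig_def using False by (auto simp: nnM less_top)
      have Iu: "Iu = (\<integral>\<^sup>+x. ennreal (m x * (u x)\<^sup>2) \<partial>lborel)" "Iu < \<infinity>"
        unfolding Iu_def using u2 by (auto simp: nnM integrable_iff_bounded)
      \<comment> \<open>On a closed annulus inside \<open>0 < |x| < 1/2\<close> the weight has a
        positive minimum, so integrability against \<open>m\<close> implies integrability against
        Lebesgue measure.\<close>
      have annulus: "integrable lborel (\<lambda>x. indicator {x. a \<le> norm x \<and> norm x \<le> r'} x * f x)"
        if f [measurable]: "f \<in> borel_measurable borel" and f0: "\<And>x. 0 \<le> f x"
          and fin: "(\<integral>\<^sup>+x. ennreal (m x * f x) \<partial>lborel) < \<infinity>" and ar: "0 < a" "r' < 1 / 2" for f :: "'a \<Rightarrow> real" and a r'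
      proof (cases "a \<le> r'")
        case True
        have s: "0 < s \<and> s < 1" if "s \<in> {a\<^sup>2..r'\<^sup>2}" for s
        proof -
          have "r'\<^sup>2 < 1\<^sup>2" using ar True by (intro power_strict_mono) auto
          moreover have "0 < a\<^sup>2" using ar by simp
          ultimately show ?thesis using that unfolding atLeastAtMost_iff power_one by linarith
        qed
        have "continuous_on {a\<^sup>2..r'\<^sup>2} l" unfolding l_def
          by (intro continuous_intros) (use s in \<open>force simp: ln_less_zero\<close>)+
        moreover have "a\<^sup>2 \<in> {a\<^sup>2..r'\<^sup>2}" using True ar by (auto intro: power_mono)
        ultimately obtain s0 where s0: "s0 \<in> {a\<^sup>2..r'\<^sup>2}" "\<And>s. s \<in> {a\<^sup>2..r'\<^sup>2} \<Longrightarrow> l s0 \<le> l s"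
          using continuous_attains_inf[of "{a\<^sup>2..r'\<^sup>2}" l] by (metis compact_Icc empty_iff)
        have ls0: "0 < l s0" using s[OF s0(1)] by (simp add: l_def ln_less_zero)
        have le: "indicator {x. a \<le> norm x \<and> norm x \<le> r'} x * f x \<le> 1 / l s0 * (m x * f x)" for x
        proof (cases "a \<le> norm x \<and> norm x \<le> r'")
          case True
          then have "x \<bullet> x \<in> {a\<^sup>2..r'\<^sup>2}"
            using ar by (auto simp: power2_norm_eq_inner[symmetric] intro: power_mono)
          then have "l s0 \<le> l (x \<bullet> x)" by (rule s0(2))
          also have "l (x \<bullet> x) = m x" by (rule ml[symmetric]) (use True ar in auto)
          finally have "l s0 \<le> m x" .
          then have "l s0 * f x \<le> m x * f x" using f0 by (intro mult_right_mono) auto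
          then show ?thesis using True ls0 by (simp add: field_simps)
        qed (use m0 f0 ls0 in auto)
        show ?thesis
        proof (rule integrableI_nonneg)
          have "(\<integral>\<^sup>+x. ennreal (indicator {x. a \<le> norm x \<and> norm x \<le> r'} x * f x) \<partial>lborel)
            \<le> (\<integral>\<^sup>+x. ennreal (1 / l s0) * ennreal (m x * f x) \<partial>lborel)"
            using le ls0 m0 f0 by (intro nn_integral_mono) (auto simp: ennreal_mult[symmetric] intro!: ennreal_leI)
          also have "\<dots> = ennreal (1 / l s0) * (\<integral>\<^sup>+x. ennreal (m x * f x) \<partial>lborel)"
            by (intro nn_integral_cmult) measurable
          also have "\<dots> < \<infinity>" using fin by (simp add: ennreal_mult_less_top)
          finally show "(\<integral>\<^sup>+x. ennreal (indicator {x. a \<le> norm x \<and> norm x \<le> r'} x * f x) \<partial>lborel) < \<infinity>" .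
        qed (use f0 in auto)
      next
        case False
        then have "{x::'a. a \<le> norm x \<and> norm x \<le> r'} = {}" by auto
        then show ?thesis by simp
      qed
      define W where "W = (\<lambda>e s. (max 0 (s - e\<^sup>2))\<^sup>2 / s\<^sup>2 * (max 0 (1 - s / r\<^sup>2))\<^sup>2 * l s)"
      define W0 where "W0 = (\<lambda>s. (max 0 (1 - s / r\<^sup>2))\<^sup>2 * l s)"
      have [measurable]: "W e \<in> borel_measurable borel" for e unfolding W_def by measurable
      have W_nonneg: "0 \<le> W e s" for e s using l0 by (simp add: W_def)
      \<comment> \<open>The right-hand side does not depend on the inner radius \<open>e\<close>;
        this is what permits the limit below.\<close>
      have truncated: "(\<integral>\<^sup>+x. ennreal (c * (u x)\<^sup>2 * (W e (x \<bullet> x) / (x \<bullet> x))) \<partial>lborel)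
          \<le> Ig + ennreal (4 * k / r\<^sup>2) * Iu" if e: "0 < e" "e < r" for e
      proof -
        have r1: "r < 1" using r by simp
        obtain W' where W': "\<And>s. (W e has_real_derivative W' s) (at s)" "continuous_on {e\<^sup>2..r\<^sup>2} W'"
          "W' \<in> borel_measurable borel" "\<And>s. s \<notin> {e\<^sup>2..r\<^sup>2} \<Longrightarrow> W' s = 0"
          "\<And>s. s \<in> {e\<^sup>2..r\<^sup>2} \<Longrightarrow> c * (W e s / s) \<le> 2 * k * W' s + k\<^sup>2 * (W e s / s) + 4 * k / r\<^sup>2 * l s"
          using log_weight[OF e r1 less_imp_le[OF k] rc] unfolding W_def l_def by blast
        have W_out: "W e s = 0" if "s \<notin> {e\<^sup>2..r\<^sup>2}" for s
        proof -
          have "s < e\<^sup>2 \<or> s > r\<^sup>2" using that by auto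
          then show ?thesis using r by (auto simp: W_def max_def field_simps)
        qed
        define r' where "r' = (r + 1/2) / 2"
        have r': "r < r'" "r' < 1/2" using r by (auto simp: r'_def)
        have iu: "integrable lborel (\<lambda>x. indicator {x. a \<le> norm x \<and> norm x \<le> r'} x * (u x)\<^sup>2)" if "0 < a" for a
          using Iu r' that by (intro annulus) auto
        have ig: "integrable lborel (\<lambda>x. indicator {x. a \<le> norm x \<and> norm x \<le> r'} x * (norm (g x))\<^sup>2)" if "0 < a" for a
          using Ig r' that by (intro annulus) auto
        have e2: "0 < e / 2" using e by simp
        define F where "F = (\<lambda>x. (u x)\<^sup>2 * (2 * k * W' (x \<bullet> x) + k\<^sup>2 * (W e (x \<bullet> x) / (x \<bullet> x))))"
        have F: "integrable lborel F" "(\<integral>x. F x \<partial>lborel) \<le> (\<integral>x. (norm (g x))\<^sup>2 * W e (x \<bullet> x) \<partial>lborel)"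
          "integrable lborel (\<lambda>x. (norm (g x))\<^sup>2 * W e (x \<bullet> x))"
          unfolding F_def
          by (rule radial_weight_inequality[OF ug \<theta> _ \<Theta> W'(1) W_nonneg W'(2,3) W_out W'(4) e(1) r(1) r'(1)
                iu[OF e2] ig[OF e2] k_def]; use \<theta>1 in blast)+
        define K where "K = {x::'a. e \<le> norm x \<and> norm x \<le> r}"
        have K_iff: "x \<in> K \<longleftrightarrow> x \<bullet> x \<in> {e\<^sup>2..r\<^sup>2}" for x
          using e r by (simp add: K_def power2_norm_eq_inner[symmetric] abs_le_square_iff[symmetric])
        have [measurable]: "K \<in> sets borel" unfolding K_def by measurable
        define Z where "Z = (\<lambda>x. 4 * k / r\<^sup>2 * (indicator K x * (m x * (u x)\<^sup>2)))"
        have mK: "m x = l (x \<bullet> x)" if "x \<in> K" for x 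
          by (rule ml) (use that e r in \<open>auto simp: K_def\<close>)
        have W_le: "W e (x \<bullet> x) \<le> m x" for x
        proof (cases "x \<in> K")
          case True
          then have s: "e\<^sup>2 \<le> x \<bullet> x" "x \<bullet> x \<le> r\<^sup>2" "0 < x \<bullet> x"
            using e K_iff[of x] by (auto simp: K_def)
          have "(max 0 (x \<bullet> x - e\<^sup>2))\<^sup>2 / (x \<bullet> x)\<^sup>2 \<le> 1"
            using s by (auto intro!: power_mono)
          moreover have "(max 0 (1 - x \<bullet> x / r\<^sup>2))\<^sup>2 \<le> 1"
            using s r by (auto intro!: power_le_one)
          ultimately have "(max 0 (x \<bullet> x - e\<^sup>2))\<^sup>2 / (x \<bullet> x)\<^sup>2 * (max 0 (1 - x \<bullet> x / r\<^sup>2))\<^sup>2 \<le> 1 * 1"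
            by (intro mult_mono) auto
          from mult_right_mono[OF this l0] show ?thesis by (simp add: W_def mK[OF True])
        qed (use W_out m0 in \<open>auto simp: K_iff\<close>)
        have Z: "integrable lborel Z"
        proof -
          have "(\<integral>\<^sup>+x. ennreal (m x * (u x)\<^sup>2) \<partial>lborel) < \<infinity>" using Iu by simp
          then have "integrable lborel (\<lambda>x. m x * (u x)\<^sup>2)" using m0 by (intro integrableI_nonneg) auto
          then have "integrable lborel (\<lambda>x. indicator K x *\<^sub>R (m x * (u x)\<^sup>2))" by (intro integrable_mult_indicator) auto
          then show ?thesis by (simp add: Z_def)
        qed
        have Z0: "0 \<le> Z x" for x using k m0 by (simp add: Z_def)
        \<comment> \<open>\<open>F\<close> itself may be negative, but \<open>F + Z\<close>
          dominates the nonnegative Hardy density, so its Bochner integral can be read as a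
          nonnegative integral.\<close>
        have le: "c * (u x)\<^sup>2 * (W e (x \<bullet> x) / (x \<bullet> x)) \<le> F x + Z x" for x
        proof (cases "x \<in> K")
          case True
          then have "x \<bullet> x \<in> {e\<^sup>2..r\<^sup>2}" by (simp only: K_iff)
          from mult_left_mono[OF W'(5)[OF this] zero_le_power2[of "u x"]] show ?thesis
            using True by (simp add: F_def Z_def mK[OF True] distrib_left mult_ac)
        next
          case False
          then show ?thesis using W_out W'(4) by (simp add: F_def Z_def K_iff)
        qed
        have X0: "0 \<le> c * (u x)\<^sup>2 * (W e (x \<bullet> x) / (x \<bullet> x))" for x
          using c W_nonneg by simp
        have "(\<integral>\<^sup>+x. ennreal (c * (u x)\<^sup>2 * (W e (x \<bullet> x) / (x \<bullet> x))) \<partial>lborel) \<le> (\<integral>\<^sup>+x. ennreal (F x + Z x) \<partial>lborel)"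
          using le by (intro nn_integral_mono ennreal_leI)
        also have "\<dots> = ennreal (\<integral>x. F x + Z x \<partial>lborel)"
          using F Z order_trans[OF X0 le] by (intro nn_integral_eq_integral) auto
        also have "\<dots> \<le> ennreal ((\<integral>x. (norm (g x))\<^sup>2 * W e (x \<bullet> x) \<partial>lborel) + (\<integral>x. Z x \<partial>lborel))"
          using F Z by (intro ennreal_leI) simp
        also have "\<dots> = ennreal (\<integral>x. (norm (g x))\<^sup>2 * W e (x \<bullet> x) \<partial>lborel) + ennreal (\<integral>x. Z x \<partial>lborel)"
          using Z0 W_nonneg by (intro ennreal_plus integral_nonneg_AE) auto
        also have "ennreal (\<integral>x. (norm (g x))\<^sup>2 * W e (x \<bullet> x) \<partial>lborel) = (\<integral>\<^sup>+x. ennreal ((norm (g x))\<^sup>2 * W e (x \<bullet> x)) \<partial>lborel)"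
          using F(3) W_nonneg by (intro nn_integral_eq_integral[symmetric]) auto
        also have "\<dots> \<le> Ig" unfolding Ig
        proof (intro nn_integral_mono ennreal_leI)
          show "(norm (g x))\<^sup>2 * W e (x \<bullet> x) \<le> m x * (norm (g x))\<^sup>2" for x
            using mult_right_mono[OF W_le[of x] zero_le_power2[of "norm (g x)"]] by (simp add: mult.commute)
        qed
        also have "ennreal (\<integral>x. Z x \<partial>lborel) = (\<integral>\<^sup>+x. ennreal (Z x) \<partial>lborel)"
          using Z Z0 by (intro nn_integral_eq_integral[symmetric]) auto
        also have "\<dots> \<le> (\<integral>\<^sup>+x. ennreal (4 * k / r\<^sup>2) * ennreal (m x * (u x)\<^sup>2) \<partial>lborel)"
          using k m0 by (intro nn_integral_mono) (auto simp: Z_def ennreal_mult[symmetric] indicator_def)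
        also have "\<dots> = ennreal (4 * k / r\<^sup>2) * Iu"
          unfolding Iu by (intro nn_integral_cmult) measurable
        finally show ?thesis by (simp add: add_mono)
      qed
      \<comment> \<open>Fatou's lemma along these radii replaces \<open>W e\<close> by
        \<open>W0\<close>, which has only the outer cutoff. The shift by \<open>2\<close> keeps
        \<open>en n < r\<close> already at \<open>n = 0\<close>.\<close>
      define en where "en = (\<lambda>n::nat. r / real (n + 2))"
      have en: "0 < en n" "en n < r" for n using r by (auto simp: en_def field_simps add_pos_nonneg)
      have en0: "en \<longlonglongrightarrow> 0" unfolding en_def by (rule LIMSEQ_ignore_initial_segment[OF lim_const_over_n])
      have lim: "(\<lambda>n. c * (u x)\<^sup>2 * (W (en n) (x \<bullet> x) / (x \<bullet> x))) \<longlonglongrightarrow> c * (u x)\<^sup>2 * (W0 (x \<bullet> x) / (x \<bullet> x))" for x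
      proof (cases "x = 0")
        case False
        then have s: "0 < x \<bullet> x" by simp
        have "(\<lambda>n. c * (u x)\<^sup>2 * (W (en n) (x \<bullet> x) / (x \<bullet> x))) \<longlonglongrightarrow>
          c * (u x)\<^sup>2 * (((max 0 (x \<bullet> x - 0\<^sup>2))\<^sup>2 / (x \<bullet> x)\<^sup>2 * (max 0 (1 - x \<bullet> x / r\<^sup>2))\<^sup>2 * l (x \<bullet> x)) / (x \<bullet> x))"
          unfolding W_def using s by (intro tendsto_intros en0) auto
        then show ?thesis using s by (simp add: W0_def max_def)
      qed simp
      have "(\<integral>\<^sup>+x. ennreal (c * (u x)\<^sup>2 * (W0 (x \<bullet> x) / (x \<bullet> x))) \<partial>lborel)
          = (\<integral>\<^sup>+x. liminf (\<lambda>n. ennreal (c * (u x)\<^sup>2 * (W (en n) (x \<bullet> x) / (x \<bullet> x)))) \<partial>lborel)"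
        by (intro nn_integral_cong lim_imp_Liminf[symmetric] tendsto_ennrealI lim) simp
      also have "\<dots> \<le> liminf (\<lambda>n. \<integral>\<^sup>+x. ennreal (c * (u x)\<^sup>2 * (W (en n) (x \<bullet> x) / (x \<bullet> x))) \<partial>lborel)"
        by (rule nn_integral_liminf) measurable
      also have "\<dots> \<le> liminf (\<lambda>n. Ig + ennreal (4 * k / r\<^sup>2) * Iu)"
        using truncated[OF en] by (intro Liminf_mono always_eventually allI)
      also have "\<dots> = Ig + ennreal (4 * k / r\<^sup>2) * Iu" by (simp add: Liminf_const)
      finally have main: "(\<integral>\<^sup>+x. ennreal (c * (u x)\<^sup>2 * (W0 (x \<bullet> x) / (x \<bullet> x))) \<partial>lborel) \<le> Ig + ennreal (4 * k / r\<^sup>2) * Iu" .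
      \<comment> \<open>Inside radius \<open>r\<close> the outer cutoff is removed at the cost
        \<open>2 / r^2\<close>. Outside it \<open>1 / |x|^2\<close> is at most
        \<open>1 / r^2\<close>, whatever the values of \<open>\<theta>\<close> there.\<close>
      have pointwise: "c * (m x * ((u x)\<^sup>2 / (norm x)\<^sup>2))
          \<le> c * (u x)\<^sup>2 * (W0 (x \<bullet> x) / (x \<bullet> x)) + 2 * c / r\<^sup>2 * (m x * (u x)\<^sup>2)" for x
      proof (cases "x = 0")
        case False
        define s where "s = x \<bullet> x"
        have s: "0 < s" "(norm x)\<^sup>2 = s" using False by (auto simp: s_def power2_norm_eq_inner)
        have "m x / s \<le> W0 s / s + 2 / r\<^sup>2 * m x"
        proof (cases "s < r\<^sup>2")
          case True
          then have "norm x < r"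
            unfolding s(2)[symmetric] by (rule power2_less_imp_less) (use r(1) in simp)
          then have "norm x < 1 / 2" using r(2) by linarith
          then have ms: "m x = l s" unfolding s_def by (rule ml[OF False])
          have "m x / s \<le> (1 - s / r\<^sup>2)\<^sup>2 * l s / s + 2 / r\<^sup>2 * m x"
            using mult_right_mono[OF inverse_le_square_cutoff[OF s(1), of "1 / r\<^sup>2"] l0[of s]]
            by (simp add: ms distrib_right)
          moreover have "max 0 (1 - s / r\<^sup>2) = 1 - s / r\<^sup>2"
            using True r(1) by (simp add: max_def)
          ultimately show ?thesis by (simp add: W0_def)
        next
          case False
          have "1 / s \<le> 2 / r\<^sup>2" using False s r(1) by (intro frac_le) auto
          from mult_right_mono[OF this m0[of x]] show ?thesis
            using l0[of s] s by (simp add: W0_def add_increasing)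
        qed
        from mult_left_mono[OF this, of "c * (u x)\<^sup>2"] c
        have "c * (u x)\<^sup>2 * (m x / s) \<le> c * (u x)\<^sup>2 * (W0 s / s + 2 / r\<^sup>2 * m x)" by simp
        then show ?thesis unfolding s(2) s_def[symmetric] by (simp add: algebra_simps)
      qed (use c m0 in simp)
      have nn: "0 \<le> c * (u x)\<^sup>2 * (W0 (x \<bullet> x) / (x \<bullet> x))" for x
        using c l0 by (simp add: W0_def)
      have [measurable]: "W0 \<in> borel_measurable borel" unfolding W0_def by measurable
      have "ennreal c * (\<integral>\<^sup>+x. ennreal ((u x)\<^sup>2 / (norm x)\<^sup>2) \<partial>M)
          = ennreal c * (\<integral>\<^sup>+x. ennreal (m x * ((u x)\<^sup>2 / (norm x)\<^sup>2)) \<partial>lborel)"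
        by (subst nnM) auto
      also have "\<dots> = (\<integral>\<^sup>+x. ennreal c * ennreal (m x * ((u x)\<^sup>2 / (norm x)\<^sup>2)) \<partial>lborel)"
        by (intro nn_integral_cmult[symmetric]) measurable
      also have "\<dots> \<le> (\<integral>\<^sup>+x. ennreal (c * (u x)\<^sup>2 * (W0 (x \<bullet> x) / (x \<bullet> x))) + ennreal (2 * c / r\<^sup>2) * ennreal (m x * (u x)\<^sup>2) \<partial>lborel)"
        using pointwise c m0 nn
        by (intro nn_integral_mono) (simp add: ennreal_mult[symmetric] ennreal_plus[symmetric] del: ennreal_plus)
      also have "\<dots> = (\<integral>\<^sup>+x. ennreal (c * (u x)\<^sup>2 * (W0 (x \<bullet> x) / (x \<bullet> x))) \<partial>lborel) + ennreal (2 * c / r\<^sup>2) * Iu"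
        unfolding Iu by (subst nn_integral_add) (auto simp: nn_integral_cmult)
      also have "\<dots> \<le> (Ig + ennreal (4 * k / r\<^sup>2) * Iu) + ennreal (2 * c / r\<^sup>2) * Iu"
        using main by (rule add_right_mono)
      also have "\<dots> = Ig + ennreal C * Iu"
        using c k by (simp add: C_def add.assoc distrib_right[symmetric])
      finally show ?thesis by (simp add: Ig_def Iu_def)
    qed simp
  qed
  then show ?thesis using C by (auto simp: M_def)
qed


section \<open>Optimality of the constant\<close>

text \<open>For \<open>\<alpha> > 0\<close> this is \<open>ln y \<le> y\<close> at
  \<open>y = r powr (- \<tau> / \<alpha>)\<close>, raised to the power \<open>\<alpha>\<close>; for
  \<open>\<alpha> \<le> 0\<close> the logarithm is bounded below by \<open>ln 2\<close>. With
  exponent \<open>\<alpha>\<close> it bounds the weight from above, with \<open>- \<alpha>\<close>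
  from below.\<close>

lemma log_powr_le_powr:
  fixes \<alpha> \<tau> :: real
  assumes \<tau>: "0 < \<tau>"
  obtains B where "0 < B" "\<And>r. 0 < r \<Longrightarrow> r \<le> 1 / 2 \<Longrightarrow> (ln (1 / r)) powr \<alpha> \<le> B * r powr (- \<tau>)"
proof (cases "\<alpha> \<le> 0")
  case True
  show ?thesis
  proof (rule that[of "(ln 2) powr \<alpha>"])
    fix r :: real assume r: "0 < r" "r \<le> 1 / 2"
    then have "ln 2 \<le> ln (1 / r)" by (subst ln_le_cancel_iff) (auto simp: field_simps)
    then have "(ln (1 / r)) powr \<alpha> \<le> (ln 2) powr \<alpha>" using True by (intro powr_mono2') auto
    also have "\<dots> = (ln 2) powr \<alpha> * 1" by simp
    also have "\<dots> \<le> (ln 2) powr \<alpha> * r powr (- \<tau>)"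
    proof (rule mult_left_mono)
      have "1 powr (- \<tau>) \<le> r powr (- \<tau>)" using r \<tau> by (intro powr_mono2') auto
      then show "1 \<le> r powr (- \<tau>)" by simp
    qed simp
    finally show "(ln (1 / r)) powr \<alpha> \<le> (ln 2) powr \<alpha> * r powr (- \<tau>)" .
  qed simp
next
  case False
  show ?thesis
  proof (rule that[of "(\<alpha> / \<tau>) powr \<alpha>"])
    fix r :: real assume r: "0 < r" "r \<le> 1 / 2"
    have "\<tau> / \<alpha> * ln (1 / r) = ln (r powr (- \<tau> / \<alpha>))"
      using r by (simp add: ln_powr ln_div)
    also have "\<dots> \<le> r powr (- \<tau> / \<alpha>)" using ln_bound[of "r powr (- \<tau> / \<alpha>)"] r by simp
    finally have "ln (1 / r) \<le> \<alpha> / \<tau> * r powr (- \<tau> / \<alpha>)"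
      using False \<tau> by (simp add: field_simps)
    moreover have "0 \<le> ln (1 / r)" using r by (simp add: field_simps)
    ultimately have "(ln (1 / r)) powr \<alpha> \<le> (\<alpha> / \<tau> * r powr (- \<tau> / \<alpha>)) powr \<alpha>"
      using False by (intro powr_mono2) auto
    also have "\<dots> = (\<alpha> / \<tau>) powr \<alpha> * r powr (- \<tau>)"
      using False by (subst powr_mult) (simp_all add: powr_powr)
    finally show "(ln (1 / r)) powr \<alpha> \<le> (\<alpha> / \<tau>) powr \<alpha> * r powr (- \<tau>)" .
  qed (use False \<tau> in simp)
qed

text \<open>Dividing the square of the positive part by \<open>V s\<close> makes \<open>U\<close> continuously differentiable at \<open>R\<close>
  and keeps \<open>\<bar>U' s\<bar> \<le> \<bar>V' s\<bar>\<close>.\<close>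

lemma truncated_power_profile:
  fixes \<gamma> e R :: real
  assumes \<gamma>: "0 < \<gamma>" and e: "0 < e" and R: "0 < R"
    and V_def: "V = (\<lambda>s. (s + e) powr (- (\<gamma> / 2)))"
    and U_def: "U = (\<lambda>s. (max 0 (V s - V R))\<^sup>2 / V s)"
    and U'_def: "U' = (\<lambda>s. - (\<gamma> / 2) * (s + e) powr (- (\<gamma> / 2) - 1) * (1 - (min 1 (V R / V s))\<^sup>2))"
  shows "\<And>s. 0 \<le> s \<Longrightarrow> (U has_real_derivative U' s) (at s)"
    and "continuous_on {0..} U'"
    and "\<And>s. R \<le> s \<Longrightarrow> U s = 0" and "\<And>s. R \<le> s \<Longrightarrow> U' s = 0"
    and "\<And>s. 0 \<le> s \<Longrightarrow> (U s)\<^sup>2 \<le> (s + e) powr (- \<gamma>)"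
    and "\<And>s. 0 \<le> s \<Longrightarrow> 4 * (U' s)\<^sup>2 \<le> \<gamma>\<^sup>2 * (s + e) powr (- \<gamma> - 2)"
    and "\<And>s q. 0 \<le> s \<Longrightarrow> V R \<le> q * V s \<Longrightarrow> q \<le> 1 \<Longrightarrow> (1 - q) ^ 4 * (s + e) powr (- \<gamma>) \<le> (U s)\<^sup>2"
    and "\<And>s q. 0 \<le> s \<Longrightarrow> V R \<le> q * V s \<Longrightarrow> q \<le> 1 \<Longrightarrow>
      \<gamma>\<^sup>2 * (1 - q\<^sup>2)\<^sup>2 * (s + e) powr (- \<gamma> - 2) \<le> 4 * (U' s)\<^sup>2"
proof -
  define V' where "V' = (\<lambda>s. - (\<gamma> / 2) * (s + e) powr (- (\<gamma> / 2) - 1))"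
  have V0: "0 < V s" if "0 \<le> s" for s using that e by (simp add: V_def)
  have VR: "0 < V R" using V0 R by simp
  have V2: "(V s)\<^sup>2 = (s + e) powr (- \<gamma>)" if "0 \<le> s" for s
    using that e by (simp add: V_def power2_eq_square powr_add[symmetric])
  have V'2: "4 * (V' s)\<^sup>2 = \<gamma>\<^sup>2 * (s + e) powr (- \<gamma> - 2)" if "0 \<le> s" for s
    using that e by (simp add: V'_def power2_eq_square powr_add[symmetric])
  have U': "U' s = V' s * (1 - (min 1 (V R / V s))\<^sup>2)" for s by (simp add: U'_def V'_def)
  have dV: "(V has_real_derivative V' s) (at s)" if "0 \<le> s" for s
    unfolding V_def V'_def using that e
    by (auto intro!: derivative_eq_intros)
  show "(U has_real_derivative U' s) (at s)" if s: "0 \<le> s" for s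
  proof -
    have 1: "((\<lambda>s. V s - V R) has_real_derivative V' s) (at s)"
      using DERIV_diff[OF dV[OF s] DERIV_const] by simp
    have "(U has_real_derivative
        (2 * max 0 (V s - V R) * V' s * V s - (max 0 (V s - V R))\<^sup>2 * V' s) / (V s * V s)) (at s)"
      unfolding U_def using V0[OF s] by (intro DERIV_divide DERIV_chain2[OF DERIV_pos_part_square 1] dV s) simp
    moreover have "(2 * max 0 (V s - V R) * V' s * V s - (max 0 (V s - V R))\<^sup>2 * V' s) / (V s * V s) = U' s"
    proof (cases "V R \<le> V s")
      case True
      \<comment> \<open>With \<open>x = V s\<close> and \<open>y = V s - V R\<close> the numerator
        is \<open>w (x^2 - (x - y)^2)\<close>, so the factor is
        \<open>1 - (V R / V s)^2\<close>.\<close>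
      have eq: "(2 * y * w * x - y\<^sup>2 * w) / (x * x) = w * (1 - ((x - y) / x)\<^sup>2)" if "x \<noteq> 0" for x y w :: real
        using that by (simp add: field_simps power2_eq_square)
      show ?thesis using True eq[of "V s" "V s - V R" "V' s"] V0[OF s] by (simp add: U' max_def min_def)
    next
      case False
      then have "1 \<le> V R / V s" using V0[OF s] by simp
      then show ?thesis using False by (simp add: U' max_def min_def)
    qed
    ultimately show ?thesis by (rule DERIV_cong)
  qed
  have "continuous_on {0..} V"
    by (intro continuous_at_imp_continuous_on ballI DERIV_isCont[OF dV]) simp
  moreover have "continuous_on {0..} (\<lambda>s. (s + e) powr (- (\<gamma> / 2) - 1))"
    by (intro continuous_on_powr continuous_on_add continuous_on_id continuous_on_const) (use e in auto)
  ultimately show "continuous_on {0..} U'"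
    unfolding U'_def
    by (intro continuous_on_mult continuous_on_diff continuous_on_power continuous_on_min continuous_on_divide continuous_on_const)
      (use V0 in \<open>auto simp: less_imp_neq[symmetric]\<close>)
  have VR_ge: "V s \<le> V R" if "R \<le> s" for s
    unfolding V_def using that R e \<gamma> by (intro powr_mono2') auto
  show "U s = 0" if "R \<le> s" for s using VR_ge[OF that] by (simp add: U_def)
  show "U' s = 0" if "R \<le> s" for s using VR_ge[OF that] V0[of s] that R by (simp add: U' min_def)
  show "(U s)\<^sup>2 \<le> (s + e) powr (- \<gamma>)" if s: "0 \<le> s" for s
  proof -
    have "(max 0 (V s - V R))\<^sup>2 \<le> (V s)\<^sup>2" using V0[OF s] VR by (intro power_mono) auto
    then have "U s \<le> V s" using V0[OF s] by (simp add: U_def divide_le_eq power2_eq_square)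
    then have "(U s)\<^sup>2 \<le> (V s)\<^sup>2" using V0[OF s] by (intro power_mono) (auto simp: U_def)
    then show ?thesis by (simp add: V2[OF s])
  qed
  have m01: "0 \<le> min 1 (V R / V s)" "min 1 (V R / V s) \<le> 1" if "0 \<le> s" for s
    using V0[OF that] VR by auto
  show "4 * (U' s)\<^sup>2 \<le> \<gamma>\<^sup>2 * (s + e) powr (- \<gamma> - 2)" if s: "0 \<le> s" for s
  proof -
    have "(min 1 (V R / V s))\<^sup>2 \<le> 1" using m01[OF s] by (intro power_le_one)
    then have "(1 - (min 1 (V R / V s))\<^sup>2)\<^sup>2 \<le> 1" by (intro power_le_one) auto
    then have "4 * (V' s)\<^sup>2 * (1 - (min 1 (V R / V s))\<^sup>2)\<^sup>2 \<le> 4 * (V' s)\<^sup>2 * 1"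
      by (intro mult_left_mono) auto
    then show ?thesis unfolding U' power_mult_distrib V'2[OF s, symmetric] by simp
  qed
  \<comment> \<open>Where the truncation level is at most the fraction \<open>q\<close> of
    \<open>V s\<close>, truncation costs only a factor: \<open>U \<ge> (1 - q)^2 V\<close>, and
    \<open>|U'| \<ge> (1 - q^2) |V'|\<close> in the next estimate.\<close>
  show "(1 - q) ^ 4 * (s + e) powr (- \<gamma>) \<le> (U s)\<^sup>2" if s: "0 \<le> s" and q: "V R \<le> q * V s" "q \<le> 1" for s q
  proof -
    have "(1 - q) * V s \<le> max 0 (V s - V R)" using q by (simp add: left_diff_distrib)
    then have "((1 - q) * V s)\<^sup>2 \<le> (max 0 (V s - V R))\<^sup>2"
      using q V0[OF s] by (intro power_mono) auto
    then have "((1 - q) * V s)\<^sup>2 / V s \<le> U s"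
      unfolding U_def using V0[OF s] by (intro divide_right_mono) auto
    moreover have "((1 - q) * V s)\<^sup>2 / V s = (1 - q)\<^sup>2 * V s"
      using V0[OF s] by (simp add: power2_eq_square)
    ultimately have "((1 - q)\<^sup>2 * V s)\<^sup>2 \<le> (U s)\<^sup>2"
      using V0[OF s] by (intro power_mono) auto
    moreover have "((1 - q)\<^sup>2 * V s)\<^sup>2 = (1 - q) ^ 4 * (V s)\<^sup>2"
      by (simp add: power_mult_distrib)
    ultimately show ?thesis by (simp add: V2[OF s])
  qed
  show "\<gamma>\<^sup>2 * (1 - q\<^sup>2)\<^sup>2 * (s + e) powr (- \<gamma> - 2) \<le> 4 * (U' s)\<^sup>2"
    if s: "0 \<le> s" and q: "V R \<le> q * V s" "q \<le> 1" for s q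
  proof -
    have "V R / V s \<le> q" using q V0[OF s] by (simp add: divide_le_eq)
    then have "min 1 (V R / V s) \<le> q" by simp
    moreover have "0 \<le> min 1 (V R / V s)" using m01[OF s] by simp
    ultimately have "(min 1 (V R / V s))\<^sup>2 \<le> q\<^sup>2" "0 \<le> q" by (intro power_mono, auto)
    moreover have "q\<^sup>2 \<le> 1" using q \<open>0 \<le> q\<close> by (intro power_le_one)
    ultimately have "(1 - q\<^sup>2)\<^sup>2 \<le> (1 - (min 1 (V R / V s))\<^sup>2)\<^sup>2" by (intro power_mono) auto
    then have "4 * (V' s)\<^sup>2 * (1 - q\<^sup>2)\<^sup>2 \<le> 4 * (V' s)\<^sup>2 * (1 - (min 1 (V R / V s))\<^sup>2)\<^sup>2"
      by (intro mult_left_mono) auto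
    also have "\<dots> = 4 * (U' s)\<^sup>2" by (simp add: U' power_mult_distrib)
    finally show ?thesis unfolding V'2[OF s] by (simp only: mult_ac)
  qed
qed

text \<open>A profile in \<open>x \<bullet> x\<close> rather than in \<open>norm x\<close> gives a
  C^1 function at the origin as well, without a condition on \<open>U' 0\<close>.\<close>

lemma radial_weak_gradient:
  fixes U U' :: "real \<Rightarrow> real"
  assumes U: "\<And>s. 0 \<le> s \<Longrightarrow> (U has_real_derivative U' s) (at s)" and U': "continuous_on {0..} U'"
  shows "is_weak_gradient (\<lambda>x::'a::euclidean_space. U (x \<bullet> x)) (\<lambda>x. (2 * U' (x \<bullet> x)) *\<^sub>R x)"
proof (rule C1_is_weak_gradient)
  fix x :: 'a
  have "((\<lambda>x::'a. x \<bullet> x) has_derivative (\<lambda>h. 2 * (x \<bullet> h))) (at x)"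
    by (auto intro!: derivative_eq_intros simp: inner_commute)
  moreover have "(U has_derivative (*) (U' (x \<bullet> x))) (at (x \<bullet> x))"
    using U[of "x \<bullet> x"] by (simp add: has_field_derivative_def)
  ultimately have "((\<lambda>x. U (x \<bullet> x)) has_derivative (\<lambda>h. U' (x \<bullet> x) * (2 * (x \<bullet> h)))) (at x)"
    by (rule has_derivative_compose)
  then show "((\<lambda>x. U (x \<bullet> x)) has_derivative (\<lambda>h. ((2 * U' (x \<bullet> x)) *\<^sub>R x) \<bullet> h)) (at x)"
    by (simp add: mult_ac)
next
  have "continuous_on UNIV (\<lambda>x::'a. U' (x \<bullet> x))"
    by (rule continuous_on_compose2[OF U']) (auto intro!: continuous_intros)
  then show "continuous_on UNIV (\<lambda>x::'a. (2 * U' (x \<bullet> x)) *\<^sub>R x)"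
    by (intro continuous_intros)
qed

lemma nn_integral_log_measure:
  fixes \<theta> :: "'a::euclidean_space \<Rightarrow> real"
  assumes \<theta>: "\<theta> \<in> Cc_infinity" "\<And>x. 0 \<le> \<theta> x" and f: "f \<in> borel_measurable borel" "\<And>x. 0 \<le> f x"
  shows "(\<integral>\<^sup>+x. ennreal (f x) \<partial>log_measure \<theta> \<alpha>)
    = (\<integral>\<^sup>+x. ennreal (\<theta> x * (ln (1 / norm x)) powr \<alpha> * f x) \<partial>lborel)"
proof -
  have [measurable]: "\<theta> \<in> borel_measurable borel" "f \<in> borel_measurable borel"
    using Cc_infinity_continuous[OF \<theta>(1)] f by (auto intro: borel_measurable_continuous_onI)
  show ?thesis unfolding log_measure_def
    using \<theta>(2) f(2) by (subst nn_integral_density) (auto simp: ennreal_mult)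
qed

text \<open>The Hardy inequality for \<open>\<alpha> = 0\<close>, applied to a constant function, replaces polar coordinates.\<close>

lemma nn_integral_inverse_square_finite:
  fixes \<theta> :: "'a::euclidean_space \<Rightarrow> real"
  assumes dim: "DIM('a) \<ge> 3" and \<theta>: "\<theta> \<in> Cc_infinity"
    and \<theta>1: "\<And>x. 0 \<le> \<theta> x \<and> \<theta> x \<le> 1" and \<theta>2: "\<And>x. x \<in> ball 0 (1/2) \<Longrightarrow> \<theta> x = 1"
    and \<theta>3: "\<And>x. x \<notin> ball 0 1 \<Longrightarrow> \<theta> x = 0"
  shows "(\<integral>\<^sup>+x. ennreal (indicator (ball (0::'a) (1/2)) x * (1 / (norm x)\<^sup>2)) \<partial>lborel) < \<infinity>"
proof -
  define M where "M = log_measure \<theta> 0"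
  have cz: "0 < c_zero DIM('a)" using dim by (simp add: c_zero_def)
  obtain C where "0 \<le> C" and hardy: "hardy_inequality M (c_zero DIM('a)) C"
    using hardy_inequality_log_measure[OF dim \<theta> \<theta>1 \<theta>2, of "c_zero DIM('a)" 0] cz by (auto simp: M_def)
  have \<theta>0: "0 \<le> \<theta> x" for x using \<theta>1 by simp
  have "(\<integral>\<^sup>+x. ennreal 1 \<partial>M) = (\<integral>\<^sup>+x. ennreal (\<theta> x * (ln (1 / norm x)) powr 0 * 1) \<partial>lborel)"
    unfolding M_def by (rule nn_integral_log_measure[OF \<theta> \<theta>0]) auto
  also have "\<dots> \<le> (\<integral>\<^sup>+x. indicator (ball (0::'a) 1) x \<partial>lborel)"
    using \<theta>1 \<theta>3 by (intro nn_integral_mono) (auto simp: indicator_def powr_def)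
  also have "\<dots> < \<infinity>" using emeasure_bounded_finite[OF bounded_ball[of "0::'a" 1]] by simp
  finally have fin: "(\<integral>\<^sup>+x. ennreal 1 \<partial>M) < \<infinity>" .
  have wg: "is_weak_gradient (\<lambda>_::'a. 1::real) (\<lambda>_. 0)"
    by (rule C1_is_weak_gradient) auto
  have "(\<lambda>_. 1::real) \<in> L2 M"
    using fin by (auto simp: L2_def integrable_iff_bounded)
  moreover have "(\<lambda>_. 0::'a) \<in> L2 M" by (simp add: L2_def)
  ultimately have "(\<lambda>_. 1) \<in> H1 M" using wg by (auto simp: H1_def)
  then have "ennreal (c_zero DIM('a)) * (\<integral>\<^sup>+x. ennreal (1 / (norm x)\<^sup>2) \<partial>M) \<le> ennreal C * (\<integral>\<^sup>+x. ennreal 1 \<partial>M)"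
    using hardy wg by (fastforce simp: hardy_inequality_def)
  also have "\<dots> < \<infinity>" using fin by (simp add: ennreal_mult_less_top)
  finally have "(\<integral>\<^sup>+x. ennreal (1 / (norm x)\<^sup>2) \<partial>M) < \<infinity>"
    using cz by (auto simp: ennreal_mult_less_top)
  moreover have "(\<integral>\<^sup>+x. ennreal (1 / (norm x)\<^sup>2) \<partial>M)
      = (\<integral>\<^sup>+x. ennreal (\<theta> x * (ln (1 / norm x)) powr 0 * (1 / (norm x)\<^sup>2)) \<partial>lborel)"
    unfolding M_def by (rule nn_integral_log_measure[OF \<theta> \<theta>0]) auto
  moreover have "(\<integral>\<^sup>+x. ennreal (indicator (ball (0::'a) (1/2)) x * (1 / (norm x)\<^sup>2)) \<partial>lborel)
      \<le> (\<integral>\<^sup>+x. ennreal (\<theta> x * (ln (1 / norm x)) powr 0 * (1 / (norm x)\<^sup>2)) \<partial>lborel)"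
  proof (intro nn_integral_mono ennreal_leI)
    \<comment> \<open>Since \<open>0 powr 0\<close> is \<open>0\<close>, the logarithm has to be
      nonzero on the punctured ball. At the origin both sides are \<open>0\<close> by the default
      value of division.\<close>
    fix x :: 'a
    show "indicator (ball 0 (1/2)) x * (1 / (norm x)\<^sup>2) \<le> \<theta> x * (ln (1 / norm x)) powr 0 * (1 / (norm x)\<^sup>2)"
    proof (cases "x \<in> ball 0 (1/2) \<and> x \<noteq> 0")
      case True
      then have "1 < 1 / norm x" by simp
      then have "ln (1 / norm x) \<noteq> 0" by (metis ln_gt_zero less_irrefl)
      then show ?thesis using True \<theta>2[of x] by (simp add: powr_def)
    next
      case False
      then show ?thesis using \<theta>0[of x] by (cases "x = 0") auto
    qed
  qed
  ultimately show ?thesis by (simp only: order_le_less_trans)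
qed

section \<open>Contradiction from a larger constant\<close>

text \<open>The assumed inequality bounds the energy near the origin of the regularised power by a
  constant \<open>D\<close> that does not depend on the regularisation length \<open>a\<close>. A
  single ball of radius \<open>a / 2\<close> at distance about \<open>a\<close> from the origin
  already contributes \<open>K0 * a powr (- (\<gamma> - k))\<close>, which is unbounded; no
  integration over spheres is needed.\<close>

lemma best_hardy_constant_log_measure:
  fixes \<theta> :: "'a::euclidean_space \<Rightarrow> real"
  assumes dim: "DIM('a) \<ge> 3" and \<theta>: "\<theta> \<in> Cc_infinity"
    and \<theta>1: "\<And>x. 0 \<le> \<theta> x \<and> \<theta> x \<le> 1" and \<theta>2: "\<And>x. x \<in> ball 0 (1/2) \<Longrightarrow> \<theta> x = 1"
    and \<theta>3: "\<And>x. x \<notin> ball 0 1 \<Longrightarrow> \<theta> x = 0"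
  shows "best_hardy_constant (log_measure \<theta> \<alpha>) (c_zero DIM('a))"
  unfolding best_hardy_constant_def
proof (intro allI impI notI, elim exE)
  fix c C0 assume c: "c_zero DIM('a) < c" and hardy0: "hardy_inequality (log_measure \<theta> \<alpha>) c C0"
  define M where "M = log_measure \<theta> \<alpha>"
  \<comment> \<open>A negative constant acts as \<open>0\<close> because \<open>ennreal\<close>
    truncates it.\<close>
  define C where "C = max C0 0"
  have C: "0 \<le> C" by (simp add: C_def)
  have "ennreal C0 = ennreal C" by (simp add: C_def max_def ennreal_neg)
  then have hardy: "hardy_inequality M c C" using hardy0 by (simp add: hardy_inequality_def M_def)
  define k where "k = (real DIM('a) - 2) / 2"
  have k: "0 < k" and ck: "k\<^sup>2 < c" using dim c by (auto simp: k_def c_zero_def)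
  define \<gamma> where "\<gamma> = (k + sqrt c) / 2"
  have c0: "0 \<le> c" using ck zero_le_power2[of k] by linarith
  have "k < sqrt c" using ck k by (simp add: real_less_rsqrt)
  then have \<gamma>: "k < \<gamma>" "\<gamma> < sqrt c" by (auto simp: \<gamma>_def)
  have \<gamma>0: "0 < \<gamma>" using k \<gamma> by simp
  have \<gamma>2: "0 < \<gamma>\<^sup>2" "\<gamma>\<^sup>2 < c"
    using \<gamma>0 real_sqrt_pow2[OF c0] power_strict_mono[OF \<gamma>(2), of 2] by auto
  \<comment> \<open>The gap between \<open>\<gamma>^2\<close> and \<open>c\<close> is split in
    three: \<open>c - c1\<close> absorbs the zero order term, \<open>c1 - c2\<close> the truncation
    at level \<open>V R\<close>, and \<open>c2 - \<gamma>^2\<close> is left for the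
    contradiction.\<close>
  define c1 where "c1 = (c + \<gamma>\<^sup>2) / 2"
  define c2 where "c2 = (c1 + \<gamma>\<^sup>2) / 2"
  have cs: "\<gamma>\<^sup>2 < c2" "c2 < c1" "c1 < c" using \<gamma>2 by (auto simp: c1_def c2_def)
  have c1: "0 < c1" and c2: "0 < c2" using cs \<gamma>2 by linarith+
  \<comment> \<open>Chosen so that Bernoulli's inequality gives
    \<open>c1 (1 - q)^4 \<ge> c1 (1 - 4 q) = c2\<close>.\<close>
  define q where "q = (c1 - c2) / (4 * c1)"
  have q: "0 < q" "q < 1" 
  proof -
    show "0 < q" unfolding q_def using cs c1 by (intro divide_pos_pos) linarith+
    show "q < 1" unfolding q_def using c1 c2 by (subst pos_divide_less_eq) linarith+
  qed
  have cq: "c2 \<le> c1 * (1 - q) ^ 4"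
  proof -
    have "1 - 4 * q \<le> (1 - q) ^ 4" using Bernoulli_inequality[of "- q" 4] q by simp
    then have "c1 * (1 - 4 * q) \<le> c1 * (1 - q) ^ 4" using c1 by (intro mult_left_mono) auto
    moreover have "c1 * (1 - 4 * q) = c2" using c1 by (simp add: q_def field_simps)
    ultimately show ?thesis by simp
  qed
  \<comment> \<open>Shrinking the argument by the factor \<open>t\<close> multiplies the power of
    exponent \<open>- \<gamma> / 2\<close> by \<open>1 / q\<close>. This fixes the radius below
    which the truncation is harmless.\<close>
  define t where "t = q powr (2 / \<gamma>)"
  have t: "0 < t" "t < 1" "t powr (\<gamma> / 2) = q"
    using q \<gamma>0 powr_less_mono2[of "2 / \<gamma>" q 1] by (auto simp: t_def powr_powr)
  \<comment> \<open>The bound \<open>1/16\<close> puts the support of \<open>u\<close> inside the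
    region where \<open>\<theta> = 1\<close>; the other one gives
    \<open>C * R \<le> c - c1\<close>.\<close>
  define R where "R = min (1/16) ((c - c1) / (C + 1))"
  have R: "0 < R" "R \<le> 1/16" 
  proof -
    show "0 < R" using cs C by (simp add: R_def)
    show "R \<le> 1/16" unfolding R_def by (rule min.cobounded1)
  qed
  have CR: "C * R \<le> c - c1"
  proof -
    have "C * R \<le> (C + 1) * ((c - c1) / (C + 1))"
      using C R by (intro mult_mono) (auto simp: R_def)
    then show ?thesis using C by simp
  qed
  define R' where "R' = R * t / 2"
  have R': "0 < R'" "R' < R" using R t by (auto simp: R'_def)
  define m where "m = (\<lambda>x. \<theta> x * (ln (1 / norm x)) powr \<alpha>)"
  have \<theta>0: "0 \<le> \<theta> x" for x using \<theta>1 by simp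
  have m0: "0 \<le> m x" for x using \<theta>0 by (simp add: m_def)
  have [measurable]: "\<theta> \<in> borel_measurable borel"
    using Cc_infinity_continuous[OF \<theta>] by (rule borel_measurable_continuous_onI)
  have [measurable]: "m \<in> borel_measurable borel" unfolding m_def by measurable
  have nnM: "(\<integral>\<^sup>+x. ennreal (f x) \<partial>M) = (\<integral>\<^sup>+x. ennreal (m x * f x) \<partial>lborel)"
    if "f \<in> borel_measurable borel" "\<And>x. 0 \<le> f x" for f
    using nn_integral_log_measure[OF \<theta> \<theta>0 that] by (simp add: m_def M_def)
  have comb: "ennreal b * ennreal p + ennreal d * ennreal r = ennreal (b * p + d * r)"
    if "0 \<le> b" "0 \<le> d" "0 \<le> p" "0 \<le> r" for b d p r
    using that by (simp add: ennreal_mult ennreal_plus)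
  define S where "S = {x::'a. x \<bullet> x < R}"
  have [measurable]: "S \<in> sets borel" unfolding S_def by measurable
  have norm_S: "norm x < 1 / 2" if "x \<bullet> x < R" for x :: 'a
  proof -
    have "(norm x)\<^sup>2 < (1/2)\<^sup>2"
      using that R by (simp add: power2_norm_eq_inner power_divide)
    then show ?thesis by (rule power2_less_imp_less) simp
  qed
  define P where "P = (\<integral>\<^sup>+x. ennreal (m x * indicator S x) \<partial>lborel)"
  \<comment> \<open>The weight is at most \<open>B / |x|^2\<close> on \<open>S\<close>, which is
    integrable in dimension at least three.\<close>
  have P: "P < \<infinity>"
  proof -
    obtain B where B: "0 < B" "\<And>r. 0 < r \<Longrightarrow> r \<le> 1 / 2 \<Longrightarrow> (ln (1 / r)) powr \<alpha> \<le> B * r powr (- 2)"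
      using log_powr_le_powr[of 2 \<alpha>] by auto
    have "m x * indicator S x \<le> B * (indicator (ball 0 (1/2)) x * (1 / (norm x)\<^sup>2))" for x
    proof (cases "x \<in> S \<and> x \<noteq> 0")
      case True
      then have n: "norm x < 1 / 2" "0 < norm x" using norm_S by (auto simp: S_def)
      have "m x = (ln (1 / norm x)) powr \<alpha>" using \<theta>2[of x] n by (simp add: m_def)
      also have "\<dots> \<le> B * norm x powr (- 2)" using B n by simp
      also have "norm x powr (- 2) = 1 / (norm x)\<^sup>2"
        using n powr_realpow[of "norm x" 2] by (simp add: powr_minus_divide)
      finally show ?thesis using True n by simp
    next
      case False
      then show ?thesis using B by (auto simp: m_def)
    qed
    then have "P \<le> (\<integral>\<^sup>+x. ennreal (B * (indicator (ball (0::'a) (1/2)) x * (1 / (norm x)\<^sup>2))) \<partial>lborel)"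
      unfolding P_def by (intro nn_integral_mono ennreal_leI)
    also have "\<dots> = (\<integral>\<^sup>+x. ennreal B * ennreal (indicator (ball (0::'a) (1/2)) x * (1 / (norm x)\<^sup>2)) \<partial>lborel)"
      by (subst ennreal_mult) (use B(1) in auto)
    also have "\<dots> = ennreal B * (\<integral>\<^sup>+x. ennreal (indicator (ball (0::'a) (1/2)) x * (1 / (norm x)\<^sup>2)) \<partial>lborel)"
    proof (rule nn_integral_cmult)
      have "(\<lambda>x::'a. indicator (ball 0 (1/2)) x * (1 / (norm x)\<^sup>2) :: real) \<in> borel_measurable lborel"
        by (intro borel_measurable_times borel_measurable_indicator borel_measurable_divide borel_measurable_power
            borel_measurable_norm borel_measurable_const) auto
      then show "(\<lambda>x::'a. ennreal (indicator (ball 0 (1/2)) x * (1 / (norm x)\<^sup>2))) \<in> borel_measurable lborel"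
        by (rule measurable_compose[OF _ measurable_ennreal])
    qed
    also have "\<dots> < \<infinity>"
      using nn_integral_inverse_square_finite[OF dim \<theta> \<theta>1 \<theta>2 \<theta>3] by (simp add: ennreal_mult_less_top)
    finally show ?thesis .
  qed
  \<comment> \<open>This bounds \<open>(norm (g x))^2\<close> on the shell
    \<open>R' \<le> x \<bullet> x < R\<close> uniformly in the regularisation.\<close>
  define E where "E = \<gamma>\<^sup>2 * R' powr (- \<gamma> - 1)"
  have E: "0 \<le> E" by (simp add: E_def)
  obtain B where B: "0 < B" "\<And>r. 0 < r \<Longrightarrow> r \<le> 1 / 2 \<Longrightarrow> (ln (1 / r)) powr (- \<alpha>) \<le> B * r powr (- (\<gamma> - k))"
    using log_powr_le_powr[of "\<gamma> - k" "- \<alpha>"] \<gamma> by auto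
  have m_lower: "norm x powr (\<gamma> - k) / B \<le> m x" if "x \<noteq> 0" "norm x < 1 / 2" for x
  proof -
    define L where "L = ln (1 / norm x)"
    have "1 < 1 / norm x" using that by simp
    then have L: "0 < L" unfolding L_def by (rule ln_gt_zero)
    have "L powr (- \<alpha>) \<le> B * norm x powr (- (\<gamma> - k))" using B that by (simp add: L_def)
    then have "inverse (B * norm x powr (- (\<gamma> - k))) \<le> inverse (L powr (- \<alpha>))"
      using L by (intro le_imp_inverse_le) auto
    moreover have "inverse (B * norm x powr (- (\<gamma> - k))) = norm x powr (\<gamma> - k) / B"
      unfolding powr_minus inverse_mult_distrib inverse_inverse_eq by (simp only: divide_inverse mult.commute)
    ultimately have "norm x powr (\<gamma> - k) / B \<le> L powr \<alpha>"
      unfolding powr_minus inverse_inverse_eq by simp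
    then show ?thesis using \<theta>2[of x] that by (simp add: m_def L_def)
  qed
  define K0 where "K0 = \<gamma>\<^sup>2 * (1 - q\<^sup>2)\<^sup>2 * 5 powr (- \<gamma> - 2) * (1 / B) * ((1/2) ^ DIM('a) * measure lborel (ball (0::'a) 1))"
  have "q\<^sup>2 < 1" using q by (simp add: power_less_one_iff)
  then have K0: "0 < K0" using \<gamma>2 B content_ball_pos[of 1 "0::'a"] by (simp add: K0_def)
  define D where "D = E * enn2real P / (c2 / \<gamma>\<^sup>2 - 1)"
  have D: "0 \<le> D" using E cs \<gamma>2 unfolding D_def by (intro divide_nonneg_nonneg mult_nonneg_nonneg) auto
  have bound: "K0 * a powr (- (\<gamma> - k)) \<le> D" if a: "0 < a" "4 * a\<^sup>2 \<le> R'" for a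
  proof -
    \<comment> \<open>The regularisation length is \<open>a\<close> itself, so at \<open>|x|\<close>
      of order \<open>a\<close> both summands of \<open>x \<bullet> x + e\<close> are
      comparable.\<close>
    define e where "e = a\<^sup>2"
    have e: "0 < e" "4 * e \<le> R'" using a by (auto simp: e_def)
    define V where "V = (\<lambda>s. (s + e) powr (- (\<gamma> / 2)))"
    define U where "U = (\<lambda>s. (max 0 (V s - V R))\<^sup>2 / V s)"
    define U' where "U' = (\<lambda>s. - (\<gamma> / 2) * (s + e) powr (- (\<gamma> / 2) - 1) * (1 - (min 1 (V R / V s))\<^sup>2))"
    note prof = truncated_power_profile[OF \<gamma>0 e(1) R(1) V_def U_def U'_def]
    define u where "u = (\<lambda>x::'a. U (x \<bullet> x))"
    define g where "g = (\<lambda>x::'a. (2 * U' (x \<bullet> x)) *\<^sub>R x)"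
    have wg: "is_weak_gradient u g"
      unfolding u_def g_def by (rule radial_weak_gradient[OF prof(1,2)])
    have [measurable]: "u \<in> borel_measurable borel" "g \<in> borel_measurable borel"
      using wg by (auto simp: is_weak_gradient_def intro: locally_integrable_measurable)
    have ng: "(norm (g x))\<^sup>2 = 4 * (U' (x \<bullet> x))\<^sup>2 * (x \<bullet> x)" for x
      by (simp add: g_def power_mult_distrib power2_norm_eq_inner)
    have out: "u x = 0" "g x = 0" if "x \<notin> S" for x
      using that prof(3,4)[of "x \<bullet> x"] by (auto simp: S_def u_def g_def)
    \<comment> \<open>The factor \<open>1/2\<close> in \<open>R'\<close> leaves room for
      \<open>e\<close>: \<open>s + e \<le> 2 R' = t R\<close>.\<close>
    have Vq: "V R \<le> q * V s" if "0 \<le> s" "s \<le> R'" for s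
    proof -
      have "s + e \<le> t * (R + e)"
      proof -
        have "s + e \<le> R' + R'" using that e by simp
        also have "\<dots> = t * R" by (simp add: R'_def)
        also have "\<dots> \<le> t * (R + e)" using t e by simp
        finally show ?thesis .
      qed
      then have "(s + e) powr (\<gamma> / 2) \<le> (t * (R + e)) powr (\<gamma> / 2)"
        using that e \<gamma>0 by (intro powr_mono2) auto
      also have "\<dots> = q * (R + e) powr (\<gamma> / 2)" using t by (simp add: powr_mult)
      finally have "(s + e) powr (\<gamma> / 2) \<le> q * (R + e) powr (\<gamma> / 2)" .
      moreover have "0 < (s + e) powr (\<gamma> / 2)" "0 < (R + e) powr (\<gamma> / 2)" using that e R by auto
      ultimately show ?thesis by (simp add: V_def powr_minus field_simps)
    qed
    have g_upper: "(norm (g x))\<^sup>2 * (x \<bullet> x) \<le> \<gamma>\<^sup>2 * (x \<bullet> x + e) powr (- \<gamma>)" for x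
    proof -
      let ?s = "x \<bullet> x"
      have "(norm (g x))\<^sup>2 * ?s = 4 * (U' ?s)\<^sup>2 * ?s\<^sup>2"
        unfolding ng by (simp add: power2_eq_square[of ?s])
      also have "\<dots> \<le> \<gamma>\<^sup>2 * (?s + e) powr (- \<gamma> - 2) * (?s + e)\<^sup>2"
        by (rule mult_mono[OF prof(6) power_mono]) (use e in auto)
      also have "(?s + e)\<^sup>2 = (?s + e) powr 2"
        using e by (subst powr_numeral) (auto intro: add_nonneg_pos)
      also have "\<gamma>\<^sup>2 * (?s + e) powr (- \<gamma> - 2) * (?s + e) powr 2 = \<gamma>\<^sup>2 * (?s + e) powr (- \<gamma>)"
        by (simp add: mult.assoc powr_add[symmetric])
      finally show ?thesis .
    qed
    have u_bounded: "(u x)\<^sup>2 \<le> e powr (- \<gamma>)" for x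
    proof -
      have "(x \<bullet> x + e) powr (- \<gamma>) \<le> e powr (- \<gamma>)" using e \<gamma>0 by (intro powr_mono2') auto
      then show ?thesis using prof(5)[of "x \<bullet> x"] by (simp add: u_def)
    qed
    have g_bounded: "(norm (g x))\<^sup>2 \<le> \<gamma>\<^sup>2 * e powr (- \<gamma> - 2) * R" for x
    proof (cases "x \<in> S")
      case True
      have "(x \<bullet> x + e) powr (- \<gamma> - 2) \<le> e powr (- \<gamma> - 2)" using e \<gamma>0 by (intro powr_mono2') auto
      then have "4 * (U' (x \<bullet> x))\<^sup>2 \<le> \<gamma>\<^sup>2 * e powr (- \<gamma> - 2)"
        using order_trans[OF prof(6)[of "x \<bullet> x"] mult_left_mono[OF _ zero_le_power2]] by simp
      then show ?thesis unfolding ng by (rule mult_mono) (use True in \<open>auto simp: S_def\<close>)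
    qed (use out R in simp)
    have finite: "(\<integral>\<^sup>+x. ennreal (m x * f x) \<partial>lborel) < \<infinity>"
      if [measurable]: "f \<in> borel_measurable borel" and f: "\<And>x. f x \<le> b" "\<And>x. x \<notin> S \<Longrightarrow> f x = 0" "0 \<le> b" for f b
    proof -
      have "m x * f x \<le> b * (m x * indicator S x)" for x
        using f(1)[of x] f(2)[of x] m0[of x] mult_left_mono[of "f x" b "m x"]
        by (cases "x \<in> S") (auto simp: mult.commute)
      then have "(\<integral>\<^sup>+x. ennreal (m x * f x) \<partial>lborel) \<le> (\<integral>\<^sup>+x. ennreal b * ennreal (m x * indicator S x) \<partial>lborel)"
        using f(3) by (intro nn_integral_mono) (simp add: ennreal_mult'[symmetric] ennreal_leI)
      also have "\<dots> = ennreal b * P" unfolding P_def by (intro nn_integral_cmult) measurable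
      also have "\<dots> < \<infinity>" using P by (simp add: ennreal_mult_less_top)
      finally show ?thesis .
    qed
    have fin_u: "(\<integral>\<^sup>+x. ennreal (m x * (u x)\<^sup>2) \<partial>lborel) < \<infinity>"
      by (rule finite[OF _ u_bounded]) (use out in auto)
    have fin_g: "(\<integral>\<^sup>+x. ennreal (m x * (norm (g x))\<^sup>2) \<partial>lborel) < \<infinity>"
      by (rule finite[OF _ g_bounded]) (use out R in auto)
    have meas_M: "f \<in> borel_measurable M \<longleftrightarrow> f \<in> borel_measurable borel" for f :: "'a \<Rightarrow> 'b::topological_space"
      by (simp add: M_def log_measure_def)
    have "u \<in> L2 M"
      using fin_u nnM[of "\<lambda>x. (u x)\<^sup>2"] by (simp add: L2_def integrable_iff_bounded meas_M)
    moreover have "g \<in> L2 M"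
      using fin_g nnM[of "\<lambda>x. (norm (g x))\<^sup>2"] by (simp add: L2_def integrable_iff_bounded meas_M)
    ultimately have "u \<in> H1 M" using wg by (auto simp: H1_def)
    then have "ennreal c * (\<integral>\<^sup>+x. ennreal ((u x)\<^sup>2 / (norm x)\<^sup>2) \<partial>M)
        \<le> (\<integral>\<^sup>+x. ennreal ((norm (g x))\<^sup>2) \<partial>M) + ennreal C * (\<integral>\<^sup>+x. ennreal ((u x)\<^sup>2) \<partial>M)"
      using hardy wg by (auto simp: hardy_inequality_def)
    then have hardy_u: "ennreal c * (\<integral>\<^sup>+x. ennreal (m x * ((u x)\<^sup>2 / (norm x)\<^sup>2)) \<partial>lborel)
        \<le> (\<integral>\<^sup>+x. ennreal (m x * (norm (g x))\<^sup>2) \<partial>lborel) + ennreal C * (\<integral>\<^sup>+x. ennreal (m x * (u x)\<^sup>2) \<partial>lborel)"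
      by (simp add: nnM)
    define H where "H = (\<integral>\<^sup>+x. ennreal (m x * ((u x)\<^sup>2 / (norm x)\<^sup>2)) \<partial>lborel)"
    \<comment> \<open>On the support of \<open>u\<close> one has \<open>|x|^2 < R\<close>, hence
      \<open>C u^2 \<le> (c - c1) u^2 / |x|^2\<close>. The origin is left out because the quotient
      is \<open>0\<close> there by default.\<close>
    have "ennreal C * (\<integral>\<^sup>+x. ennreal (m x * (u x)\<^sup>2) \<partial>lborel) + ennreal c1 * H \<le> ennreal c * H"
    proof -
      have "ennreal C * (\<integral>\<^sup>+x. ennreal (m x * (u x)\<^sup>2) \<partial>lborel) + ennreal c1 * H
        = (\<integral>\<^sup>+x. ennreal C * ennreal (m x * (u x)\<^sup>2) + ennreal c1 * ennreal (m x * ((u x)\<^sup>2 / (norm x)\<^sup>2)) \<partial>lborel)"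
        unfolding H_def by (subst nn_integral_add) (auto simp: nn_integral_cmult)
      also have "\<dots> \<le> (\<integral>\<^sup>+x. ennreal c * ennreal (m x * ((u x)\<^sup>2 / (norm x)\<^sup>2)) \<partial>lborel)"
      proof (rule nn_integral_mono_AE)
        have "C * (m x * (u x)\<^sup>2) + c1 * (m x * ((u x)\<^sup>2 / (norm x)\<^sup>2)) \<le> c * (m x * ((u x)\<^sup>2 / (norm x)\<^sup>2))"
          if "x \<noteq> 0" for x
        proof (cases "x \<in> S")
          case True
          define h where "h = m x * ((u x)\<^sup>2 / (norm x)\<^sup>2)"
          have h: "0 \<le> h" using m0 by (simp add: h_def)
          have "m x * (u x)\<^sup>2 = h * (norm x)\<^sup>2" using that by (simp add: h_def)
          moreover have "C * (h * (norm x)\<^sup>2) \<le> C * (h * R)"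
            using True C h by (intro mult_left_mono) (auto simp: S_def power2_norm_eq_inner)
          moreover have "C * (h * R) \<le> (c - c1) * h"
            using mult_right_mono[OF CR h] by (simp add: mult_ac)
          ultimately show ?thesis unfolding h_def[symmetric] by (simp add: left_diff_distrib)
        qed (simp add: out)
        then have "AE x in lborel. C * (m x * (u x)\<^sup>2) + c1 * (m x * ((u x)\<^sup>2 / (norm x)\<^sup>2)) \<le> c * (m x * ((u x)\<^sup>2 / (norm x)\<^sup>2))"
          using AE_lborel_singleton[of "0::'a"] by (auto elim: eventually_mono)
        then show "AE x in lborel. ennreal C * ennreal (m x * (u x)\<^sup>2) + ennreal c1 * ennreal (m x * ((u x)\<^sup>2 / (norm x)\<^sup>2))
            \<le> ennreal c * ennreal (m x * ((u x)\<^sup>2 / (norm x)\<^sup>2))"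
        proof eventually_elim
          case (elim x)
          have "ennreal C * ennreal (m x * (u x)\<^sup>2) + ennreal c1 * ennreal (m x * ((u x)\<^sup>2 / (norm x)\<^sup>2))
             = ennreal (C * (m x * (u x)\<^sup>2) + c1 * (m x * ((u x)\<^sup>2 / (norm x)\<^sup>2)))"
            by (rule comb) (use C c1 m0 in auto)
          also have "\<dots> \<le> ennreal (c * (m x * ((u x)\<^sup>2 / (norm x)\<^sup>2)))" using elim by (rule ennreal_leI)
          also have "\<dots> = ennreal c * ennreal (m x * ((u x)\<^sup>2 / (norm x)\<^sup>2))"
            using c1 cs m0 by (intro ennreal_mult) auto
          finally show ?case .
        qed
      qed
      also have "\<dots> = ennreal c * H" unfolding H_def by (intro nn_integral_cmult) measurable
      finally show ?thesis .
    qed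
    also note hardy_u[folded H_def]
    finally have "ennreal C * (\<integral>\<^sup>+x. ennreal (m x * (u x)\<^sup>2) \<partial>lborel) + ennreal c1 * H
       \<le> ennreal C * (\<integral>\<^sup>+x. ennreal (m x * (u x)\<^sup>2) \<partial>lborel) + (\<integral>\<^sup>+x. ennreal (m x * (norm (g x))\<^sup>2) \<partial>lborel)"
      by (simp add: add.commute)
    \<comment> \<open>The zero order term is finite, so it may be cancelled in the extended
      reals.\<close>
    then have H: "ennreal c1 * H \<le> (\<integral>\<^sup>+x. ennreal (m x * (norm (g x))\<^sup>2) \<partial>lborel)"
      using fin_u by (subst (asm) ennreal_add_left_cancel_le) (auto simp: ennreal_mult_eq_top_iff)
    define S' where "S' = {x::'a. x \<bullet> x \<le> R'}"
    have [measurable]: "S' \<in> sets borel" unfolding S'_def by measurable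
    \<comment> \<open>Only the energy on \<open>S'\<close> is compared with the Hardy integral; on
      the rest of \<open>S\<close> the constant \<open>E\<close> controls it.\<close>
    define X where "X = (\<integral>\<^sup>+x. ennreal (m x * (norm (g x))\<^sup>2 * indicator S' x) \<partial>lborel)"
    have X_fin: "X < \<infinity>"
    proof -
      have "X \<le> (\<integral>\<^sup>+x. ennreal (m x * (norm (g x))\<^sup>2) \<partial>lborel)"
        unfolding X_def using m0 by (intro nn_integral_mono ennreal_leI) (auto simp: indicator_def)
      then show ?thesis using fin_g by (rule order_le_less_trans)
    qed
    have "(\<integral>\<^sup>+x. ennreal (m x * (norm (g x))\<^sup>2) \<partial>lborel)
        \<le> (\<integral>\<^sup>+x. ennreal (m x * (norm (g x))\<^sup>2 * indicator S' x) + ennreal E * ennreal (m x * indicator S x) \<partial>lborel)"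
    proof (rule nn_integral_mono)
      fix x :: 'a
      have "m x * (norm (g x))\<^sup>2 \<le> m x * (norm (g x))\<^sup>2 * indicator S' x + E * (m x * indicator S x)"
      proof (cases "x \<in> S' \<or> x \<notin> S")
        case True
        then show ?thesis using out m0 E by auto
      next
        case False
        then have s: "R' \<le> x \<bullet> x" "0 < x \<bullet> x" using R' by (auto simp: S'_def)
        have "(norm (g x))\<^sup>2 \<le> \<gamma>\<^sup>2 * (x \<bullet> x + e) powr (- \<gamma>) / (x \<bullet> x)"
          using g_upper[of x] s by (simp add: le_divide_eq)
        also have "\<dots> \<le> \<gamma>\<^sup>2 * R' powr (- \<gamma>) / R'"
          using s R' e \<gamma>0 by (intro frac_le mult_left_mono powr_mono2') auto
        also have "\<dots> = E" using R' by (simp add: E_def powr_diff)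
        finally have "m x * (norm (g x))\<^sup>2 \<le> m x * E" using m0 by (rule mult_left_mono)
        then show ?thesis using False by (simp add: mult.commute)
      qed
      then have "ennreal (m x * (norm (g x))\<^sup>2)
          \<le> ennreal (1 * (m x * (norm (g x))\<^sup>2 * indicator S' x) + E * (m x * indicator S x))"
        unfolding mult_1_left by (rule ennreal_leI)
      also have "\<dots> = ennreal 1 * ennreal (m x * (norm (g x))\<^sup>2 * indicator S' x) + ennreal E * ennreal (m x * indicator S x)"
        by (rule comb[symmetric]) (use E m0 in auto)
      finally show "ennreal (m x * (norm (g x))\<^sup>2)
          \<le> ennreal (m x * (norm (g x))\<^sup>2 * indicator S' x) + ennreal E * ennreal (m x * indicator S x)"
        unfolding ennreal_1 mult_1_left .
    qed
    also have "\<dots> = X + ennreal E * P"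
      unfolding X_def P_def by (subst nn_integral_add) (auto simp: nn_integral_cmult)
    finally have total: "(\<integral>\<^sup>+x. ennreal (m x * (norm (g x))\<^sup>2) \<partial>lborel) \<le> X + ennreal E * P" .
    \<comment> \<open>Pointwise on \<open>S'\<close>: the gradient bound
      \<open>\<gamma>^2 (s + e)^(-\<gamma>) / s\<close> meets the lower bound
      \<open>(1 - q)^4 (s + e)^(-\<gamma>)\<close> for \<open>u^2\<close>, and
      \<open>c2 \<le> c1 (1 - q)^4\<close>.\<close>
    have "ennreal (c2 / \<gamma>\<^sup>2) * X = (\<integral>\<^sup>+x. ennreal (c2 / \<gamma>\<^sup>2) * ennreal (m x * (norm (g x))\<^sup>2 * indicator S' x) \<partial>lborel)"
      unfolding X_def by (intro nn_integral_cmult[symmetric]) measurable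
    also have "\<dots> \<le> (\<integral>\<^sup>+x. ennreal c1 * ennreal (m x * ((u x)\<^sup>2 / (norm x)\<^sup>2)) \<partial>lborel)"
    proof (rule nn_integral_mono)
      fix x :: 'a
      have "c2 / \<gamma>\<^sup>2 * (m x * (norm (g x))\<^sup>2 * indicator S' x) \<le> c1 * (m x * ((u x)\<^sup>2 / (norm x)\<^sup>2))"
      proof (cases "x \<in> S' \<and> x \<noteq> 0")
        case True
        define s where "s = x \<bullet> x"
        have s: "0 < s" "s \<le> R'" using True by (auto simp: s_def S'_def)
        have "c2 / \<gamma>\<^sup>2 * (norm (g x))\<^sup>2 \<le> c2 / \<gamma>\<^sup>2 * (\<gamma>\<^sup>2 * (s + e) powr (- \<gamma>) / s)"
          using g_upper[of x] s c2 by (intro mult_left_mono) (auto simp: s_def le_divide_eq)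
        also have "\<dots> = c2 * (s + e) powr (- \<gamma>) / s" using \<gamma>2 by simp
        also have "\<dots> \<le> c1 * (1 - q) ^ 4 * (s + e) powr (- \<gamma>) / s"
          using cq s by (intro divide_right_mono mult_right_mono) auto
        also have "\<dots> \<le> c1 * (u x)\<^sup>2 / s"
          using prof(7)[of s q] Vq[of s] s q c1 unfolding mult.assoc
          by (intro divide_right_mono mult_left_mono) (auto simp: u_def s_def)
        finally have "m x * (c2 / \<gamma>\<^sup>2 * (norm (g x))\<^sup>2) \<le> m x * (c1 * (u x)\<^sup>2 / s)"
          using m0 by (rule mult_left_mono)
        then show ?thesis using True by (simp add: s_def power2_norm_eq_inner mult_ac)
      qed (use m0 c1 in \<open>auto simp: g_def\<close>)
      then show "ennreal (c2 / \<gamma>\<^sup>2) * ennreal (m x * (norm (g x))\<^sup>2 * indicator S' x)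
          \<le> ennreal c1 * ennreal (m x * ((u x)\<^sup>2 / (norm x)\<^sup>2))"
        by (subst (1 2) ennreal_mult[symmetric]) (use c1 c2 m0 in \<open>auto intro: ennreal_leI\<close>)
    qed
    also have "\<dots> = ennreal c1 * H" unfolding H_def by (intro nn_integral_cmult) measurable
    also note H
    also note total
    finally have X_le: "ennreal (c2 / \<gamma>\<^sup>2) * X \<le> X + ennreal E * P" .
    define xr where "xr = enn2real X"
    define pr where "pr = enn2real P"
    have X: "X = ennreal xr" and Pr: "P = ennreal pr"
      using X_fin P by (simp_all add: xr_def pr_def)
    have nonneg: "0 \<le> xr" "0 \<le> pr" by (simp_all add: xr_def pr_def)
    have "ennreal (c2 / \<gamma>\<^sup>2) * ennreal xr \<le> ennreal 1 * ennreal xr + ennreal E * ennreal pr"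
      using X_le unfolding X Pr ennreal_1 mult_1_left .
    also have "\<dots> = ennreal (1 * xr + E * pr)"
      by (rule comb) (use E nonneg in auto)
    also have "ennreal (c2 / \<gamma>\<^sup>2) * ennreal xr = ennreal (c2 / \<gamma>\<^sup>2 * xr)"
      by (rule ennreal_mult[symmetric]) (use c2 nonneg in auto)
    finally have "c2 / \<gamma>\<^sup>2 * xr \<le> xr + E * pr"
      unfolding mult_1_left using E nonneg by (subst (asm) ennreal_le_iff) auto
    \<comment> \<open>Finiteness of \<open>X\<close> allows the subtraction and
      \<open>c2 > \<gamma>^2\<close> makes the factor positive. The resulting bound \<open>D\<close>
      does not involve \<open>a\<close>.\<close>
    then have "(c2 / \<gamma>\<^sup>2 - 1) * xr \<le> E * pr" by (simp add: left_diff_distrib)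
    moreover have "0 < c2 / \<gamma>\<^sup>2 - 1" using cs \<gamma>2 by simp
    ultimately have XD: "xr \<le> D" unfolding D_def pr_def[symmetric] by (subst pos_le_divide_eq) (auto simp: mult.commute)
    obtain b :: 'a where b: "b \<in> Basis" using nonempty_Basis by blast
    \<comment> \<open>This ball lies in the shell \<open>a \<le> |x| \<le> 2 a\<close>, where
      \<open>s + e \<le> 5 e\<close>; hence the \<open>5\<close> in \<open>K0\<close>.\<close>
    define T where "T = ball ((3/2 * a) *\<^sub>R b) (a/2)"
    have T_norm: "a \<le> norm x \<and> norm x \<le> 2 * a" if "x \<in> T" for x
    proof -
      have nb: "norm ((3/2 * a) *\<^sub>R b) = 3/2 * a" using a b by simp
      have "norm (x - (3/2 * a) *\<^sub>R b) < a/2" using that by (simp add: T_def dist_norm norm_minus_commute)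
      then show ?thesis
        using norm_triangle_ineq3[of x "(3/2 * a) *\<^sub>R b"] unfolding nb by linarith
    qed
    define G where "G = \<gamma>\<^sup>2 * (1 - q\<^sup>2)\<^sup>2 * (5 * e) powr (- \<gamma> - 2) * e * (a powr (\<gamma> - k) / B)"
    have G0: "0 \<le> G" using B e by (simp add: G_def)
    have "ennreal G * indicator T x \<le> ennreal (m x * (norm (g x))\<^sup>2 * indicator S' x)" for x
    proof (cases "x \<in> T")
      case True
      define s where "s = x \<bullet> x"
      have n: "a \<le> norm x" "norm x \<le> 2 * a" using T_norm[OF True] by auto
      have s: "e \<le> s" "s \<le> 4 * e"
        using power_mono[OF n(1), of 2] power_mono[OF n(2), of 2] a
        by (auto simp: s_def e_def power2_norm_eq_inner power_mult_distrib)
      have sR: "s \<le> R'" using s e by simp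
      have x: "x \<noteq> 0" "norm x < 1 / 2"
        using n a sR R' norm_S[of x] by (auto simp: s_def)
      have "a powr (\<gamma> - k) / B \<le> norm x powr (\<gamma> - k) / B"
        using n a \<gamma> B by (intro divide_right_mono powr_mono2) auto
      also have "\<dots> \<le> m x" by (rule m_lower[OF x])
      finally have m1: "a powr (\<gamma> - k) / B \<le> m x" .
      have "\<gamma>\<^sup>2 * (1 - q\<^sup>2)\<^sup>2 * (5 * e) powr (- \<gamma> - 2) * e \<le> \<gamma>\<^sup>2 * (1 - q\<^sup>2)\<^sup>2 * (s + e) powr (- \<gamma> - 2) * s"
        using s e \<gamma>0 by (intro mult_mono mult_left_mono powr_mono2') auto
      also have "\<dots> \<le> 4 * (U' s)\<^sup>2 * s"
        using prof(8)[of s q] Vq[of s] s sR q e by (intro mult_right_mono) auto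
      also have "\<dots> = (norm (g x))\<^sup>2" by (simp add: ng s_def)
      finally have "G \<le> (norm (g x))\<^sup>2 * m x"
        unfolding G_def using m1 B a by (intro mult_mono) auto
      moreover have "x \<in> S'" using sR by (simp add: S'_def s_def)
      ultimately show ?thesis using True by (simp add: ennreal_leI mult.commute)
    qed simp
    then have "(\<integral>\<^sup>+x. ennreal G * indicator T x \<partial>lborel) \<le> X"
      unfolding X_def by (intro nn_integral_mono)
    moreover have "(\<integral>\<^sup>+x. ennreal G * indicator T x \<partial>lborel) = ennreal G * emeasure lborel T"
      by (rule nn_integral_cmult_indicator) (simp add: T_def)
    moreover have "emeasure lborel T = ennreal (measure lborel T)"
      using emeasure_bounded_finite[of T] by (intro emeasure_eq_ennreal_measure) (auto simp: T_def)
    ultimately have "ennreal (G * measure lborel T) \<le> ennreal xr"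
      using X G0 by (simp add: ennreal_mult)
    then have "G * measure lborel T \<le> xr" using nonneg by (simp add: ennreal_le_iff)
    moreover have "measure lborel T = (a/2) ^ DIM('a) * measure lborel (ball (0::'a) 1)"
      unfolding T_def using a by (intro content_ball_conv_unit_ball) auto
    moreover have "G * ((a/2) ^ DIM('a) * measure lborel (ball (0::'a) 1)) = K0 * a powr (- (\<gamma> - k))"
    proof -
      have "(5 * e) powr (- \<gamma> - 2) = 5 powr (- \<gamma> - 2) * (a powr 2) powr (- \<gamma> - 2)"
        using a by (simp add: e_def powr_mult)
      also have "(a powr 2) powr (- \<gamma> - 2) = a powr (- 2 * \<gamma> - 4)" by (simp add: powr_powr)
      finally have 1: "(5 * e) powr (- \<gamma> - 2) = 5 powr (- \<gamma> - 2) * a powr (- 2 * \<gamma> - 4)" .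
      have 2: "e = a powr 2" using a by (simp add: e_def)
      have 3: "(a/2) ^ DIM('a) = (1/2) ^ DIM('a) * a powr real DIM('a)"
        using a by (simp add: powr_realpow power_divide)
      \<comment> \<open>The exponents are \<open>- 2 \<gamma> - 2\<close> from the squared gradient,
        \<open>\<gamma> - k\<close> from the weight and \<open>N = 2 k + 2\<close> from the
        volume.\<close>
      have "a powr (- 2 * \<gamma> - 4) * a powr 2 * a powr (\<gamma> - k) * a powr real DIM('a)
          = a powr (- 2 * \<gamma> - 4 + 2 + (\<gamma> - k) + real DIM('a))"
        by (simp only: powr_add)
      also have "- 2 * \<gamma> - 4 + 2 + (\<gamma> - k) + real DIM('a) = - (\<gamma> - k)"
        by (simp add: k_def field_simps)
      finally have 4: "a powr (- 2 * \<gamma> - 4) * a powr 2 * a powr (\<gamma> - k) * a powr real DIM('a) = a powr (- (\<gamma> - k))" .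
      show ?thesis
        unfolding G_def K0_def 1 3 4[symmetric] by (subst 2) (simp only: divide_inverse mult_ac mult_1_left)
    qed
    ultimately show ?thesis using XD by simp
  qed
  define \<delta> where "\<delta> = \<gamma> - k"
  have \<delta>: "0 < \<delta>" using \<gamma> by (simp add: \<delta>_def)
  \<comment> \<open>The first entry ensures \<open>4 a^2 \<le> R'\<close>, the second makes the
    lower bound at least \<open>D + 1\<close>.\<close>
  define a where "a = min (sqrt (R' / 4)) ((K0 / (D + 1)) powr (1 / \<delta>))"
  have a: "0 < a" using R' K0 D by (simp add: a_def)
  have "a\<^sup>2 \<le> (sqrt (R' / 4))\<^sup>2" using a by (intro power_mono) (auto simp: a_def)
  then have "4 * a\<^sup>2 \<le> R'" using R' by simp
  then have "K0 * a powr (- \<delta>) \<le> D" using bound[OF a] by (simp add: \<delta>_def)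
  moreover have "a powr \<delta> \<le> K0 / (D + 1)"
  proof -
    have "a powr \<delta> \<le> ((K0 / (D + 1)) powr (1 / \<delta>)) powr \<delta>"
      using a \<delta> by (intro powr_mono2) (auto simp: a_def)
    also have "\<dots> = K0 / (D + 1)" using K0 D \<delta> by (simp add: powr_powr)
    finally show ?thesis .
  qed
  then have "D + 1 \<le> K0 * a powr (- \<delta>)"
    using a D by (simp add: powr_minus field_simps)
  ultimately show False by simp
qed

theorem proposition5p4:
  fixes \<theta> :: "real ^ 'n \<Rightarrow> real" and \<alpha> :: real
  assumes "CARD('n) \<ge> 3"
    and "\<theta> \<in> Cc_infinity"
    and "\<And>x. 0 \<le> \<theta> x \<and> \<theta> x \<le> 1"
    and "\<And>x. x \<in> ball 0 (1/2) \<Longrightarrow> \<theta> x = 1"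
    and "\<And>x. x \<notin> ball 0 1 \<Longrightarrow> \<theta> x = 0"
  shows "(\<alpha> \<le> 0 \<longrightarrow>
            (\<exists>C\<ge>0. hardy_inequality (log_measure \<theta> \<alpha>) (c_zero CARD('n)) C) \<and>
            best_hardy_constant (log_measure \<theta> \<alpha>) (c_zero CARD('n))) \<and>
         (\<alpha> > 0 \<longrightarrow>
            (\<forall>c. 0 \<le> c \<and> c < c_zero CARD('n) \<longrightarrow>
               (\<exists>C\<ge>0. hardy_inequality (log_measure \<theta> \<alpha>) c C)) \<and>
            best_hardy_constant (log_measure \<theta> \<alpha>) (c_zero CARD('n)))"
proof -
  have dim: "DIM(real ^ 'n) \<ge> 3" using assms(1) by simp
  have "0 \<le> c_zero CARD('n)" by (simp add: c_zero_def)
  then show ?thesis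
    using hardy_inequality_log_measure[OF dim assms(2-4)]
      best_hardy_constant_log_measure[OF dim assms(2-5)] by simp
qed

end
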